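(* Let $(X,d,\sigma)$ be a compatible metric-topological space with $(X,d)$ complete, and let $\phi:X\to(-\infty,\infty]$ be proper and satisfy the LSCC assumptions. Suppose that the relaxed slope $|\partial^-\phi|$ is an upper gradient for $\phi$. Let $\bar u\in D(\phi)$ and let $(u_\varepsilon)_\varepsilon$ (with $\varepsilon>0$ such that $\frac1{16\varepsilon}\ge \mathsf B$) be a family of curves such that $u_\varepsilon$ minimizes $\mathcal I_\varepsilon$ among all trajectories in $\mathscr C_\varepsilon(\bar u)$. Then, for any vanishing sequence $(\varepsilon_k)_k$, the curves $(u_{\varepsilon_k})_k$ converge pointwise on $[0,\infty)$ with respect to $\sigma$, up to a subsequence, to a curve of maximal slope for $\phi$ with respect to $|\partial^-\phi|$.
   Context: **Setting.** $(X,d)$ is a complete metric space and $\sigma$ is a Hausdorff topology on $X$; $(X,d,\sigma)$ is called compatible if (MT1) $u_n\to u$ and $v_n\to v$ in $\sigma$ imply $\liminf_n d(u_n,v_n)\ge d(u,v)$; (MT2) for every $\sigma$-open set $U$ and $x\in U$ there exist a $\sigma$-open neighborhood $V$ of $x$ and $\delta>0$ such that $d(y,V)<\delta$ implies $y\in U$, where $d(y,V)=\inf_{v\in V}d(y,v)$. For an interval $I\subset\mathbb R$ and $p\in[1,\infty]$, $AC^p(I;X)$ is the set of curves $u:I\to X$ for which there is $m\in L^p(I)$ with $d(u(s),u(t))\le\int_s^t m(r)\,dr$ for all $s\le t$ in $I$; $AC=AC^1$; $AC^p_{\rm loc}(I;X)$ is the set of curves belonging to $AC^p(J;X)$ for every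 compact interval $J\subset I$. The metric derivative $|u'|(t)=\lim_{s\to t}\frac{d(u(s),u(t))}{|t-s|}$ exists for a.e. $t\in I$. **LSCC assumptions.** $\phi:X\to(-\infty,\infty]$ is proper, $D(\phi)=\{\phi<\infty\}$, and: (Lower semicontinuity) if $\sup_{n,m}d(u_n,u_m)<\infty$ and $u_n\to u$ in $\sigma$, then $\liminf_n\phi(u_n)\ge\phi(u)$; (Compactness) every sequence with $\sup_n\phi(u_n)<\infty$ and $\sup_{n,m}d(u_n,u_m)<\infty$ has a $\sigma$-convergent subsequence; (Coercivity) there are $u_*\in X$ and constants $\mathsf A,\mathsf B\ge0$ such that $\phi(u)\ge-\mathsf B\,d^2(u,v)-\mathsf Q(v)$ for all $u,v\in X$, where $\mathsf Q(v)=\mathsf B\,d^2(v,u_* )+\mathsf A$. **WED functional.** For $\varepsilon>0$, $\mathcal I_\varepsilon[u]=\int_0^\infty e^{-t/\varepsilon}\big(\frac12|u'|^2(t)+\frac1\varepsilon\phi(u(t))\big)\,dt$, well defined in $(-\infty,\infty]$ on $\mathscr C_\varepsilon(\bar u)$ when $\frac1{16\varepsilon}\ge\mathsf B$, where $\mathscr C_\varepsilon(\bar u)=\{u\in AC^2_{\rm loc}([0,\infty);X): u(0)=\bar u,\ \int_0^\infty|u'|^2(t)e^{-t/\varepsilon}\,dt<\infty\}$. **Slopes, upper gradients, curves of maximal slope.** The local slope is $|\partial\phi|(u)=\limsup_{v\to u}\frac{(\phi(u)-\phi(v))^+}{d(u,v)}$ for $u\in D(\phi)$ (limit in $d$), and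 $|\partial\phi|=\infty$ off $D(\phi)$. The relaxed slope is $|\partial^-\phi|(u)=\inf\{\liminf_n|\partial\phi|(u_n): u_n\to u\text{ in }\sigma,\ \sup_n d(u_n,u)<\infty,\ \sup_n\phi(u_n)<\infty\}$. A function $g:X\to[0,\infty]$ is an upper gradient for $\phi$ if for every curve $u\in AC(I;X)$ the function $g\circ u$ is Borel and $|\phi(u(t))-\phi(u(s))|\le\int_s^t g(u(r))|u'|(r)\,dr$ for all $s\le t$. A curve $u\in AC^2_{\rm loc}([0,\infty);X)$ is a curve of maximal slope for $\phi$ with respect to $g$ if $\phi\circ u$ is locally bounded and $-(\phi\circ u)'(t)=|u'|^2(t)=g^2(u(t))$ for a.e. $t\in(0,\infty)$. *)

theory Defs
  imports "HOL-Analysis.Analysis"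
begin

text \<open>
  The complete metric space \<open>(X,d)\<close> is a type of class \<^class>\<open>complete_space\<close> with \<open>d =\<close> \<^const>\<open>dist\<close>;
  the second topology \<open>\<sigma>\<close> is an abstract \<open>topology\<close> whose underlying set is the whole type.
  Curves on \<open>I\<close> are functions on \<^typ>\<open>real\<close> of which only the values on \<open>I\<close> play a role.
\<close>

definition compatible :: "('a::metric_space) topology \<Rightarrow> bool" where
  "compatible \<sigma> \<longleftrightarrow>
     topspace \<sigma> = UNIV \<and> Hausdorff_space \<sigma> \<and>
     (\<forall>us vs u v. limitin \<sigma> us u sequentially \<longrightarrow> limitin \<sigma> vs v sequentially \<longrightarrow>
        liminf (\<lambda>n. ereal (dist (us n) (vs n))) \<ge> ereal (dist u v)) \<and>
     (\<forall>U x. openin \<sigma> U \<longrightarrow> x \<in> U \<longrightarrow>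
        (\<exists>V \<delta>. openin \<sigma> V \<and> x \<in> V \<and> \<delta> > 0 \<and> (\<forall>y. infdist y V < \<delta> \<longrightarrow> y \<in> U)))"

text \<open>The exponent is meant to be finite with \<open>p \<ge> 1\<close>; only \<open>p = 1\<close> and \<open>p = 2\<close> are used.\<close>

definition Lp_on :: "real \<Rightarrow> real set \<Rightarrow> (real \<Rightarrow> real) \<Rightarrow> bool" where
  "Lp_on p I m \<longleftrightarrow>
     set_borel_measurable lborel I m \<and> set_integrable lborel I (\<lambda>t. \<bar>m t\<bar> powr p)"

definition AC :: "real \<Rightarrow> real set \<Rightarrow> (real \<Rightarrow> 'a::metric_space) \<Rightarrow> bool" where
  "AC p I u \<longleftrightarrow>
     (\<exists>m. Lp_on p I m \<and>
        (\<forall>s\<in>I. \<forall>t\<in>I. s \<le> t \<longrightarrow> dist (u s) (u t) \<le> (LINT r:{s..t}|lborel. m r)))"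

definition AC_loc :: "real \<Rightarrow> real set \<Rightarrow> (real \<Rightarrow> 'a::metric_space) \<Rightarrow> bool" where
  "AC_loc p I u \<longleftrightarrow> (\<forall>a b. {a..b} \<subseteq> I \<longrightarrow> AC p {a..b} u)"

text \<open>The value is unspecified at times where the limit does not exist; for absolutely continuous
  curves these form a null set.\<close>

definition metric_deriv :: "real set \<Rightarrow> (real \<Rightarrow> 'a::metric_space) \<Rightarrow> real \<Rightarrow> real" where
  "metric_deriv I u t = Lim (at t within I) (\<lambda>s. dist (u s) (u t) / \<bar>t - s\<bar>)"

definition eff_dom :: "('a \<Rightarrow> ereal) \<Rightarrow> 'a set" where
  "eff_dom \<phi> = {u. \<phi> u < \<infinity>}"

definition proper_functional :: "('a \<Rightarrow> ereal) \<Rightarrow> bool" where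
  "proper_functional \<phi> \<longleftrightarrow> (\<forall>u. \<phi> u \<noteq> -\<infinity>) \<and> eff_dom \<phi> \<noteq> {}"

definition lower_semicont :: "('a::metric_space) topology \<Rightarrow> ('a \<Rightarrow> ereal) \<Rightarrow> bool" where
  "lower_semicont \<sigma> \<phi> \<longleftrightarrow>
     (\<forall>us u. bounded (range us) \<longrightarrow> limitin \<sigma> us u sequentially \<longrightarrow>
        liminf (\<lambda>n. \<phi> (us n)) \<ge> \<phi> u)"

definition compact_sublevels :: "('a::metric_space) topology \<Rightarrow> ('a \<Rightarrow> ereal) \<Rightarrow> bool" where
  "compact_sublevels \<sigma> \<phi> \<longleftrightarrow>
     (\<forall>us. (SUP n. \<phi> (us n)) < \<infinity> \<longrightarrow> bounded (range us) \<longrightarrow>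
        (\<exists>r u. strict_mono (r :: nat \<Rightarrow> nat) \<and> limitin \<sigma> (us \<circ> r) u sequentially))"

definition coercive :: "('a::metric_space \<Rightarrow> ereal) \<Rightarrow> 'a \<Rightarrow> real \<Rightarrow> real \<Rightarrow> bool" where
  "coercive \<phi> ustar A B \<longleftrightarrow>
     A \<ge> 0 \<and> B \<ge> 0 \<and>
     (\<forall>u v. \<phi> u \<ge> ereal (- B * (dist u v)\<^sup>2 - (B * (dist v ustar)\<^sup>2 + A)))"

definition LSCC ::
  "('a::metric_space) topology \<Rightarrow> ('a \<Rightarrow> ereal) \<Rightarrow> 'a \<Rightarrow> real \<Rightarrow> real \<Rightarrow> bool" where
  "LSCC \<sigma> \<phi> ustar A B \<longleftrightarrow>
     lower_semicont \<sigma> \<phi> \<and> compact_sublevels \<sigma> \<phi> \<and> coercive \<phi> ustar A B"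

text \<open>Integral of an extended real function as the difference of the integrals of its positive and
  negative parts (\<^const>\<open>e2ennreal\<close> truncates negative values to \<open>0\<close>). It is meaningful when one of
  the two is finite.\<close>

definition ext_integral :: "real set \<Rightarrow> (real \<Rightarrow> ereal) \<Rightarrow> ereal" where
  "ext_integral S f =
     enn2ereal (\<integral>\<^sup>+ t\<in>S. e2ennreal (f t) \<partial>lborel) - enn2ereal (\<integral>\<^sup>+ t\<in>S. e2ennreal (- f t) \<partial>lborel)"

definition WED :: "('a::metric_space \<Rightarrow> ereal) \<Rightarrow> real \<Rightarrow> (real \<Rightarrow> 'a) \<Rightarrow> ereal" where
  "WED \<phi> \<epsilon> u =
     ext_integral {0..} (\<lambda>t. ereal (exp (- t / \<epsilon>)) *
       (ereal (1/2 * (metric_deriv {0..} u t)\<^sup>2) + ereal (1 / \<epsilon>) * \<phi> (u t)))"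

definition trajectories :: "real \<Rightarrow> 'a::metric_space \<Rightarrow> (real \<Rightarrow> 'a) set" where
  "trajectories \<epsilon> ubar =
     {u. AC_loc 2 {0..} u \<and> u 0 = ubar \<and>
         (\<integral>\<^sup>+ t\<in>{0..}. ennreal ((metric_deriv {0..} u t)\<^sup>2 * exp (- t / \<epsilon>)) \<partial>lborel) < \<infinity>}"

definition WED_minimizer ::
  "('a::metric_space \<Rightarrow> ereal) \<Rightarrow> real \<Rightarrow> 'a \<Rightarrow> (real \<Rightarrow> 'a) \<Rightarrow> bool" where
  "WED_minimizer \<phi> \<epsilon> ubar u \<longleftrightarrow>
     u \<in> trajectories \<epsilon> ubar \<and> (\<forall>v \<in> trajectories \<epsilon> ubar. WED \<phi> \<epsilon> u \<le> WED \<phi> \<epsilon> v)"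

text \<open>In \<^typ>\<open>ennreal\<close> the slope at a \<open>d\<close>-isolated point of the domain is \<open>0\<close>.\<close>

definition local_slope :: "('a::metric_space \<Rightarrow> ereal) \<Rightarrow> 'a \<Rightarrow> ennreal" where
  "local_slope \<phi> u =
     (if u \<in> eff_dom \<phi>
      then Limsup (at u) (\<lambda>v. e2ennreal (\<phi> u - \<phi> v) / ennreal (dist u v))
      else \<infinity>)"

definition relaxed_slope ::
  "('a::metric_space) topology \<Rightarrow> ('a \<Rightarrow> ereal) \<Rightarrow> 'a \<Rightarrow> ennreal" where
  "relaxed_slope \<sigma> \<phi> u =
     Inf {liminf (\<lambda>n. local_slope \<phi> (us n)) | us.
            limitin \<sigma> us u sequentially \<and> bdd_above (range (\<lambda>n. dist (us n) u)) \<and>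
            (SUP n. \<phi> (us n)) < \<infinity>}"

text \<open>The increment \<open>\<phi> (u t) - \<phi> (u s)\<close> is undefined when both values are infinite, and nothing is
  required then (in \<^typ>\<open>ereal\<close>, \<open>\<infinity> - \<infinity> = \<infinity>\<close>, so that without this guard constant curves outside
  the domain would violate the inequality). If exactly one of them is infinite, the integral has to
  be infinite.\<close>

definition upper_gradient :: "('a::metric_space \<Rightarrow> ereal) \<Rightarrow> ('a \<Rightarrow> ennreal) \<Rightarrow> bool" where
  "upper_gradient \<phi> g \<longleftrightarrow>
     (\<forall>I u. is_interval I \<longrightarrow> AC 1 I u \<longrightarrow>
        (\<lambda>t. g (u t)) \<in> borel_measurable (restrict_space borel I) \<and>
        (\<forall>s\<in>I. \<forall>t\<in>I. s \<le> t \<longrightarrow> u s \<in> eff_dom \<phi> \<or> u t \<in> eff_dom \<phi> \<longrightarrow>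
           e2ennreal \<bar>\<phi> (u t) - \<phi> (u s)\<bar>
             \<le> (\<integral>\<^sup>+ r\<in>{s..t}. g (u r) * ennreal (metric_deriv I u r) \<partial>lborel)))"

text \<open>Local boundedness makes \<open>\<phi> \<circ> u\<close> finite, so that \<^const>\<open>real_of_ereal\<close> loses nothing.\<close>

definition curve_of_maximal_slope ::
  "('a::metric_space \<Rightarrow> ereal) \<Rightarrow> ('a \<Rightarrow> ennreal) \<Rightarrow> (real \<Rightarrow> 'a) \<Rightarrow> bool" where
  "curve_of_maximal_slope \<phi> g u \<longleftrightarrow>
     AC_loc 2 {0..} u \<and>
     (\<forall>T. \<exists>C::real. \<forall>t\<in>{0..T}. \<bar>\<phi> (u t)\<bar> \<le> ereal C) \<and>
     (AE t in lborel. t > 0 \<longrightarrow>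
        ((\<lambda>s. real_of_ereal (\<phi> (u s))) has_real_derivative - (metric_deriv {0..} u t)\<^sup>2) (at t) \<and>
        ennreal ((metric_deriv {0..} u t)\<^sup>2) = (g (u t))\<^sup>2)"

end

theory Submission
  imports Defs "HOL-Library.Diagonal_Subsequence"
begin

text \<open>
  Let \<open>F(t)\<close> be the minimal value of the functional over curves issuing from \<open>u\<^sub>\<epsilon>(t)\<close>. Dynamic
  programming shows that \<open>F\<close> is nonincreasing along \<open>u\<^sub>\<epsilon>\<close>, with
  \<open>F(s) - F(t) = \<integral> |u\<^sub>\<epsilon>'|\<^sup>2 / 2 + (\<phi>(u\<^sub>\<epsilon>) - F) / \<epsilon>\<close> over \<open>[s, t]\<close>, and the constant competitor gives
  \<open>F \<le> \<phi>(u\<^sub>\<epsilon>)\<close>. Coercivity bounds \<open>F\<close> from below, so the identity yields uniform bounds on the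
  speed, and the excess \<open>\<phi>(u\<^sub>\<epsilon>) - F\<close> is of order \<open>\<epsilon>\<close> in the mean. Hence a subsequence converges
  pointwise, and each of the three terms is lower semicontinuous in the limit. For the excess,
  suppose that the slope exceeds \<open>c\<close> near \<open>u\<^sub>\<epsilon>(t)\<close>. Minimizing \<open>\<phi> + c d(\<cdot>, x)\<close> over small balls
  successively produces a curve from \<open>u\<^sub>\<epsilon>(t)\<close> along which \<open>\<phi>\<close> decreases at rate \<open>c\<close> per unit length;
  run at speed \<open>c\<close>, it is a competitor that shows \<open>(\<phi> - F) / \<epsilon> \<ge> c\<^sup>2 / 2\<close> up to a vanishing factor.
  The limit therefore satisfies \<open>\<phi>(ubar) \<ge> \<phi>(u(t)) + \<integral> (|u'|\<^sup>2 + g\<^sup>2) / 2\<close> on \<open>[0, t]\<close> with \<open>g\<close> the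
  relaxed slope, whereas the upper gradient property bounds \<open>\<phi>(ubar) - \<phi>(u(t))\<close> by \<open>\<integral> g |u'|\<close>, so that
  equality holds throughout.
\<close>

section \<open>Differentiation of integrals\<close>

text \<open>Speed \<open>c\<close> is the optimal choice on a descending curve: where the energy
  falls at rate \<open>c\<close> per unit length, moving at speed \<open>v\<close> costs
  \<open>v^2 / 2\<close> and gains \<open>c * v\<close> per unit time, and the best net gain
  \<open>c^2 / 2\<close> occurs at \<open>v = c\<close>. The discount leaves only times of order
  \<open>\<epsilon>\<close> relevant, so a descending curve of fixed length, however short, captures
  the whole gain in the limit. The obstacle is that the energy of a minimizer is known to be finite
  only almost everywhere and is not controlled at a given time. The value \<open>F\<close> is
  monotone and finite everywhere, and the energy is compared with it at nearby times only. The
  functional is written with the metric derivative, so competitors and limits require its existence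
  and a description that is lower semicontinuous under \<open>\<sigma>\<close>. Both come from
  difference quotients over dyadic grids: their norms in L2 grow under refinement by the triangle
  inequality, and each distance in them is lower semicontinuous by (MT1). This stands in for weak
  compactness of the speeds.\<close>

lemma Vitali_average_negligible:
  fixes f :: "real \<Rightarrow> real"
  assumes f: "integrable lborel f" and pq: "p < q"
  shows "negligible {t. -R < t \<and> t < R \<and> f t < p \<and>
    (\<forall>d>0. \<exists>a b. a \<le> t \<and> t \<le> b \<and> a < b \<and> b - a < d \<and> (LINT r:{a..b}|lborel. f r) > q * (b - a))}"
    (is "negligible ?E")
proof -
  have fm[measurable]: "f \<in> borel_measurable borel" using f by auto
  define E0 where "E0 = {t. -R < t \<and> t < R \<and> f t < p}"
  define J where "J = {-R<..<R}"
  have Jfin: "emeasure lborel J < \<infinity>" unfolding J_def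
    by (rule emeasure_bounded_finite) simp
  have E0[measurable]: "E0 \<in> sets borel" unfolding E0_def by measurable
  define \<kappa> where "\<kappa> = density lborel (\<lambda>t. ennreal (max 0 (f t - p)) * indicator J t)"
  have [simp]: "sets \<kappa> = sets borel" "space \<kappa> = UNIV" unfolding \<kappa>_def by auto
  have Jm[measurable]: "J \<in> sets borel" unfolding J_def by auto
  have em: "emeasure \<kappa> S = (\<integral>\<^sup>+t. ennreal (max 0 (f t - p)) * indicator J t * indicator S t \<partial>lborel)"
    if "S \<in> sets borel" for S
    unfolding \<kappa>_def using that by (subst emeasure_density) auto
  have fin: "emeasure \<kappa> (space \<kappa>) \<noteq> \<infinity>"
  proof -
    have "emeasure \<kappa> UNIV \<le> (\<integral>\<^sup>+t. ennreal (norm (f t)) + ennreal \<bar>p\<bar> * indicator J t \<partial>lborel)"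
      by (subst em) (auto intro!: nn_integral_mono simp: indicator_def simp flip: ennreal_plus)
    also have "\<dots> = (\<integral>\<^sup>+t. ennreal (norm (f t)) \<partial>lborel) + ennreal \<bar>p\<bar> * emeasure lborel J"
      by (subst nn_integral_add) (auto simp: nn_integral_cmult_indicator)
    also have "\<dots> < \<infinity>"
      using f Jfin by (simp add: integrable_iff_bounded ennreal_mult_less_top)
    finally show ?thesis by auto
  qed
  have E0null: "emeasure \<kappa> E0 = 0"
    by (subst em) (auto simp: E0_def indicator_def nn_integral_0_iff_AE)
  show ?thesis unfolding negligible_outer_le
  proof (intro allI impI)
    fix e :: real assume e: "e > 0"
    have "(INF U \<in> {U. E0 \<subseteq> U \<and> open U}. emeasure \<kappa> U) < ennreal (e * (q - p))"
      using outer_regular[of \<kappa> E0] fin E0null e pq by simp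
    then obtain U where U: "E0 \<subseteq> U" "open U" "emeasure \<kappa> U < ennreal (e * (q - p))"
      by (auto simp: INF_less_iff)
    define K where "K = {(a::real,b). a < b \<and> {a..b} \<subseteq> U \<inter> J \<and> (LINT r:{a..b}|lborel. f r) > q * (b - a)}"
    have cb: "cball ((fst i + snd i)/2) ((snd i - fst i)/2) = {fst i..snd i}" for i :: "real \<times> real"
      by (simp add: cball_eq_atLeastAtMost) argo
    have fine: "\<exists>i. i \<in> K \<and> t \<in> cball ((fst i + snd i)/2) ((snd i - fst i)/2) \<and> (snd i - fst i)/2 < d"
      if t: "t \<in> ?E" and d: "d > 0" for t d
    proof -
      have "t \<in> U \<inter> J" using t U(1) by (auto simp: E0_def J_def)
      moreover have "open (U \<inter> J)" using U(2) by (auto simp: J_def)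
      ultimately obtain r where r: "r > 0" "ball t r \<subseteq> U \<inter> J" by (meson open_contains_ball)
      obtain a b where ab: "a \<le> t" "t \<le> b" "a < b" "b - a < min d r" "(LINT r:{a..b}|lborel. f r) > q * (b - a)"
        using t d r(1) by (auto dest!: spec[of _ "min d r"])
      have "{a..b} \<subseteq> ball t r" using ab by (auto simp: dist_real_def)
      then have "(a,b) \<in> K" using ab r(2) unfolding K_def by auto
      then show ?thesis using ab d unfolding cb by (intro exI[of _ "(a,b)"]) auto
    qed
    have pos: "0 < (snd i - fst i)/2" if "i \<in> K" for i using that by (auto simp: K_def)
    obtain C where C: "countable C" "C \<subseteq> K"
      "pairwise (\<lambda>i j. disjnt (cball ((fst i + snd i)/2) ((snd i - fst i)/2)) (cball ((fst j + snd j)/2) ((snd j - fst j)/2))) C"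
      "negligible (?E - (\<Union>i \<in> C. cball ((fst i + snd i)/2) ((snd i - fst i)/2)))"
      by (rule Vitali_covering_theorem_cballs[of K "\<lambda>i. (snd i - fst i)/2" ?E "\<lambda>i. (fst i + snd i)/2", OF pos fine])
    define I where "I = (\<lambda>i::real\<times>real. {fst i..snd i})"
    define W where "W = (\<Union>i\<in>C. I i)"
    have Wm[measurable]: "W \<in> sets borel" unfolding W_def I_def using C(1) by (intro sets.countable_UN') auto
    have WUJ: "W \<subseteq> U \<inter> J"
    proof -
      have "I i \<subseteq> U \<inter> J" if "i \<in> C" for i
        using C(2) that unfolding K_def I_def by (cases i) fastforce
      then show ?thesis unfolding W_def by blast
    qed
    have disj: "disjoint_family_on I C"
      using C(3) unfolding cb disjoint_family_on_def pairwise_def disjnt_def I_def by blast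
    have one: "ennreal (q - p) * emeasure lborel (I i) \<le> emeasure \<kappa> (I i)" if "i \<in> C" for i
    proof -
      obtain a b where i: "i = (a,b)" by force
      have K: "a < b" "{a..b} \<subseteq> U \<inter> J" "(LINT r:{a..b}|lborel. f r) > q * (b - a)"
        using that C(2) unfolding i K_def by auto
      have int: "set_integrable lborel {a..b} f"
        unfolding set_integrable_def using f by (rule integrable_mult_indicator[rotated]) auto
      have ic: "set_integrable lborel {a..b} (\<lambda>_. c)" for c :: real
        unfolding set_integrable_def using K(1) by simp
      have int2: "set_integrable lborel {a..b} (\<lambda>r. f r - p)"
        by (rule set_integral_diff(1)[OF int ic])
      have "(LINT r:{a..b}|lborel. f r - p) = (LINT r:{a..b}|lborel. f r) - p * (b - a)"
        using K(1) by (subst set_integral_diff(2)[OF int ic]) (simp add: set_lebesgue_integral_def)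
      then have "(q - p) * (b - a) \<le> (LINT r:{a..b}|lborel. f r - p)" using K by (simp add: algebra_simps)
      also have "\<dots> \<le> (LINT r:{a..b}|lborel. max 0 (f r - p))"
        unfolding set_lebesgue_integral_def using int2 unfolding set_integrable_def
        by (intro integral_mono) (auto simp: indicator_def
            intro: Bochner_Integration.integrable_bound[OF int2[unfolded set_integrable_def]])
      finally have "ennreal ((q - p) * (b - a)) \<le> ennreal (LINT r:{a..b}|lborel. max 0 (f r - p))"
        by (rule ennreal_leI)
      also have "\<dots> = (\<integral>\<^sup>+r. ennreal (indicator {a..b} r * max 0 (f r - p)) \<partial>lborel)"
        unfolding set_lebesgue_integral_def
        by (subst nn_integral_eq_integral)
           (auto intro!: Bochner_Integration.integrable_bound[OF int2[unfolded set_integrable_def]]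
             simp: indicator_def)
      also have "\<dots> = emeasure \<kappa> (I i)" using K(2)
        by (subst em) (auto simp: I_def i intro!: nn_integral_cong simp: indicator_def)
      finally show ?thesis using K(1) pq by (simp add: I_def i ennreal_mult)
    qed
    have "ennreal (q - p) * emeasure lborel W = (\<integral>\<^sup>+i. ennreal (q - p) * emeasure lborel (I i) \<partial>count_space C)"
      unfolding W_def using C(1) disj
      by (subst emeasure_UN_countable) (auto simp: I_def nn_integral_cmult)
    also have "\<dots> \<le> (\<integral>\<^sup>+i. emeasure \<kappa> (I i) \<partial>count_space C)"
      using one by (intro nn_integral_mono) auto
    also have "\<dots> = emeasure \<kappa> W"
      unfolding W_def using C(1) disj
      by (subst emeasure_UN_countable) (auto simp: I_def)
    also have "\<dots> \<le> emeasure \<kappa> U"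
      using WUJ U(2) by (intro emeasure_mono) auto
    finally have le: "ennreal (q - p) * emeasure lborel W \<le> ennreal (e * (q - p))" using U(3) by simp
    have WJ: "W \<subseteq> J" using WUJ by blast
    have Wfin: "emeasure lborel W < \<infinity>"
      using emeasure_mono[OF WJ, of lborel] Jfin by (simp add: Jm le_less_trans)
    then have Wl: "W \<in> lmeasurable" by (auto simp: fmeasurable_def)
    have "emeasure lborel W = ennreal (measure lborel W)" using Wfin by (simp add: emeasure_eq_ennreal_measure)
    then have Wmeas: "measure lborel W \<le> e"
      using le pq e by (simp flip: ennreal_mult)
    let ?N = "?E - W"
    have N: "negligible ?N" using C(4) unfolding cb W_def I_def .
    show "\<exists>T. ?E \<subseteq> T \<and> T \<in> lmeasurable \<and> measure lebesgue T \<le> e"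
    proof (intro exI[of _ "?N \<union> W"] conjI)
      show "?N \<union> W \<in> lmeasurable"
        by (rule fmeasurable.Un[OF negligible_imp_measurable[OF N] Wl])
      have "measure lebesgue (?N \<union> W) \<le> measure lebesgue ?N + measure lebesgue W"
        by (intro measure_Un_le negligible_imp_sets[OF N] fmeasurableD[OF Wl])
      then show "measure lebesgue (?N \<union> W) \<le> e"
        using Wmeas negligible_imp_measure0[OF N] by simp
    qed auto
  qed
qed

text \<open>The covering lemma is applied to \<open>f\<close> and to \<open>- f\<close>, with
  rational thresholds so that the exceptional null sets stay countable in number. The intervals only
  have to contain \<open>t\<close>: centred, one-sided and skew averages are all covered, and
  difference quotients from either side can be read off.\<close>

theorem Lebesgue_differentiation:
  fixes f :: "real \<Rightarrow> real"
  assumes f: "integrable lborel f"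
  shows "AE t in lborel. \<forall>e>0. \<exists>d>0. \<forall>a b. a \<le> t \<and> t \<le> b \<and> a < b \<and> b - a < d \<longrightarrow>
           \<bar>(LINT r:{a..b}|lborel. f r) - f t * (b - a)\<bar> \<le> e * (b - a)"
proof -
  define N where "N g p q (R::nat) = {t. -real R < t \<and> t < real R \<and> g t < p \<and>
    (\<forall>d>0. \<exists>a b. a \<le> t \<and> t \<le> b \<and> a < b \<and> b - a < d \<and> (LINT r:{a..b}|lborel. g r) > q * (b - a))}"
    for g and p q :: real and R
  have ae: "AE t in lborel. \<forall>p\<in>\<rat>. \<forall>q\<in>\<rat>. \<forall>R. p < q \<longrightarrow> t \<notin> N g p q R" if g: "integrable lborel g" for g
  proof -
    have "AE t in lborel. t \<notin> N g p q R" if "p < q" for p q R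
    proof -
      have "negligible (N g p q R)" unfolding N_def by (rule Vitali_average_negligible[OF g that])
      then have "AE t in lebesgue. t \<notin> N g p q R" by (simp add: negligible_iff_null_sets AE_not_in)
      then show ?thesis by (simp add: AE_completion_iff)
    qed
    then show ?thesis by (simp add: AE_ball_countable countable_rat AE_all_countable)
  qed
  have upper: "\<exists>d>0. \<forall>a b. a \<le> t \<and> t \<le> b \<and> a < b \<and> b - a < d \<longrightarrow> (LINT r:{a..b}|lborel. g r) \<le> (g t + e) * (b - a)"
    if *: "\<forall>p\<in>\<rat>. \<forall>q\<in>\<rat>. \<forall>R. p < q \<longrightarrow> t \<notin> N g p q R" and e: "e > 0" for t g e
  proof -
    obtain p where p: "p \<in> \<rat>" "g t < p" "p < g t + e" using Rats_dense_in_real[of "g t" "g t + e"] e by auto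
    obtain q where q: "q \<in> \<rat>" "p < q" "q < g t + e" using Rats_dense_in_real[OF p(3)] by auto
    obtain R :: nat where R: "\<bar>t\<bar> < real R" using reals_Archimedean2 by blast
    have "t \<notin> N g p q R" using * p q by auto
    then obtain d where d: "d > 0"
      "\<And>a b. a \<le> t \<Longrightarrow> t \<le> b \<Longrightarrow> a < b \<Longrightarrow> b - a < d \<Longrightarrow> (LINT r:{a..b}|lborel. g r) \<le> q * (b - a)"
    proof -
      assume *: "\<And>d. 0 < d \<Longrightarrow> (\<And>a b. a \<le> t \<Longrightarrow> t \<le> b \<Longrightarrow> a < b \<Longrightarrow> b - a < d \<Longrightarrow> (LINT r:{a..b}|lborel. g r) \<le> q * (b - a)) \<Longrightarrow> thesis"
      have "- real R < t" "t < real R" using R by auto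
      then have "\<not> (\<forall>d>0. \<exists>a b. a \<le> t \<and> t \<le> b \<and> a < b \<and> b - a < d \<and> (LINT r:{a..b}|lborel. g r) > q * (b - a))"
        using \<open>t \<notin> N g p q R\<close> p(2) unfolding N_def by blast
      then show thesis using * by (meson not_less)
    qed
    show ?thesis
    proof (intro exI[of _ d] conjI allI impI d(1))
      fix a b assume ab: "a \<le> t \<and> t \<le> b \<and> a < b \<and> b - a < d"
      then have "q * (b - a) \<le> (g t + e) * (b - a)" using q by (intro mult_right_mono) auto
      moreover have "(LINT r:{a..b}|lborel. g r) \<le> q * (b - a)" using d(2)[of a b] ab by blast
      ultimately show "(LINT r:{a..b}|lborel. g r) \<le> (g t + e) * (b - a)" by linarith
    qed
  qed
  have f': "integrable lborel (\<lambda>t. - f t)" using f by simp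
  show ?thesis using ae[OF f] ae[OF f']
  proof eventually_elim
    case (elim t)
    show ?case
    proof (intro allI impI)
      fix e :: real assume e: "e > 0"
      obtain d1 where d1: "d1 > 0" "\<forall>a b. a \<le> t \<and> t \<le> b \<and> a < b \<and> b - a < d1 \<longrightarrow> (LINT r:{a..b}|lborel. f r) \<le> (f t + e) * (b - a)"
        using upper[OF elim(1) e] by auto
      obtain d2 where d2: "d2 > 0" "\<forall>a b. a \<le> t \<and> t \<le> b \<and> a < b \<and> b - a < d2 \<longrightarrow> (LINT r:{a..b}|lborel. - f r) \<le> (- f t + e) * (b - a)"
        using upper[OF elim(2) e] by auto
      show "\<exists>d>0. \<forall>a b. a \<le> t \<and> t \<le> b \<and> a < b \<and> b - a < d \<longrightarrow>
           \<bar>(LINT r:{a..b}|lborel. f r) - f t * (b - a)\<bar> \<le> e * (b - a)"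
      proof (intro exI[of _ "min d1 d2"] conjI allI impI)
        fix a b assume ab: "a \<le> t \<and> t \<le> b \<and> a < b \<and> b - a < min d1 d2"
        have "(LINT r:{a..b}|lborel. f r) \<le> (f t + e) * (b - a)" using d1 ab by auto
        moreover have "- (LINT r:{a..b}|lborel. f r) \<le> (- f t + e) * (b - a)"
          using d2 ab by (auto simp: set_integral_uminus[symmetric] set_lebesgue_integral_def)
        ultimately show "\<bar>(LINT r:{a..b}|lborel. f r) - f t * (b - a)\<bar> \<le> e * (b - a)"
          by (simp add: abs_le_iff algebra_simps)
      qed (use d1 d2 in auto)
    qed
  qed
qed


section \<open>Curves with square integrable speed\<close>

definition grid :: "nat \<Rightarrow> real \<Rightarrow> real" where
  "grid k t = of_int \<lfloor>2 ^ k * t\<rfloor> / 2 ^ k"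

definition cell :: "nat \<Rightarrow> real \<Rightarrow> real set" where
  "cell k t = {grid k t..<grid k t + 1 / 2 ^ k}"

definition diffquot :: "nat \<Rightarrow> (real \<Rightarrow> 'a::metric_space) \<Rightarrow> real \<Rightarrow> real" where
  "diffquot k u t = dist (u (grid k t)) (u (grid k t + 1 / 2 ^ k)) * 2 ^ k"

lemma grid_le: "grid k t \<le> t" and less_grid: "t < grid k t + 1 / 2 ^ k"
  unfolding grid_def by (simp_all add: field_simps) linarith

lemma grid_eq: "of_int i / 2 ^ k \<le> t \<Longrightarrow> t < of_int (i + 1) / 2 ^ k \<Longrightarrow> grid k t = of_int i / 2 ^ k"
  unfolding grid_def by (simp add: field_simps floor_unique)

lemma in_cell_iff: "r \<in> cell k t \<longleftrightarrow> grid k r = grid k t"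
proof
  assume "r \<in> cell k t"
  then show "grid k r = grid k t"
    using grid_eq[of "\<lfloor>2 ^ k * t\<rfloor>" k r] unfolding cell_def grid_def by (simp add: add_divide_distrib)
next
  assume "grid k r = grid k t"
  then show "r \<in> cell k t" using grid_le[of k r] less_grid[of r k] unfolding cell_def by auto
qed

lemma grid_measurable[measurable]: "grid k \<in> borel_measurable borel"
  unfolding grid_def[abs_def] by measurable

lemma emeasure_cell[simp]: "emeasure lborel (cell k t) = ennreal (1 / 2 ^ k)"
  unfolding cell_def by simp

lemma cell_borel[measurable]: "cell k t \<in> sets borel"
  unfolding cell_def by simp

lemma measurable_grid_fun: "(\<lambda>t. h (grid k t)) \<in> borel_measurable borel"
  for h :: "real \<Rightarrow> 'b::topological_space"
proof -
  have "(\<lambda>t::real. \<lfloor>2 ^ k * t\<rfloor>) \<in> measurable borel (count_space UNIV)" by measurable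
  then have "(\<lambda>t::real. (\<lambda>i. h (of_int i / 2 ^ k)) \<lfloor>2 ^ k * t\<rfloor>) \<in> borel_measurable borel"
    by (rule measurable_compose) simp
  then show ?thesis by (simp add: grid_def)
qed

lemma diffquot_measurable[measurable]: "diffquot k u \<in> borel_measurable borel"
  unfolding diffquot_def by (rule measurable_grid_fun[where h="\<lambda>g. dist (u g) (u (g + 1 / 2 ^ k)) * 2 ^ k"])

lemma diffquot_nonneg[simp]: "0 \<le> diffquot k u t"
  unfolding diffquot_def by simp

text \<open>The conditional expectation of \<open>f\<close> with respect to the dyadic cells of
  generation \<open>k\<close>; the factor \<open>2 ^ k\<close> is the inverse length of a
  cell.\<close>

definition cell_avg :: "nat \<Rightarrow> (real \<Rightarrow> ennreal) \<Rightarrow> real \<Rightarrow> ennreal" where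
  "cell_avg k f t = ennreal (2 ^ k) * (\<integral>\<^sup>+r. f r * indicator (cell k t) r \<partial>lborel)"

lemma cell_avg_cellwise:
  assumes "\<And>r. f r = f (grid k r)"
  shows "cell_avg k f t = f t"
proof -
  have "f r * indicator (cell k t) r = f t * indicator (cell k t) r" for r
    using assms[of r] assms[of t] by (auto simp: in_cell_iff indicator_def)
  then have "cell_avg k f t = ennreal (2 ^ k) * (f t * ennreal (1 / 2 ^ k))"
    unfolding cell_avg_def by (simp add: nn_integral_cmult_indicator)
  also have "\<dots> = f t * (ennreal (2 ^ k) * ennreal (1 / 2 ^ k))" by (simp add: mult_ac)
  also have "ennreal (2 ^ k) * ennreal (1 / 2 ^ k) = 1" by (simp flip: ennreal_mult)
  finally show ?thesis by simp
qed

lemma cell_pair_borel[measurable]: "{p. fst p \<in> cell k (snd p)} \<in> sets (borel \<Otimes>\<^sub>M borel)"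
  "{p. snd p \<in> cell k (fst p)} \<in> sets (borel \<Otimes>\<^sub>M borel)"
proof -
  have "{p \<in> space (borel \<Otimes>\<^sub>M borel). grid k (fst p) = grid k (snd p)} \<in> sets (borel \<Otimes>\<^sub>M borel)"
    by measurable
  then show "{p. fst p \<in> cell k (snd p)} \<in> sets (borel \<Otimes>\<^sub>M borel)"
    "{p. snd p \<in> cell k (fst p)} \<in> sets (borel \<Otimes>\<^sub>M borel)"
    by (auto simp: in_cell_iff space_pair_measure eq_commute)
qed

text \<open>Self-adjointness of the conditional expectation: lying in a common cell is a symmetric
  relation, so Fubini exchanges the two functions. With \<open>g = 1\<close> it says that averaging
  preserves the integral.\<close>

lemma cell_avg_symmetric:
  assumes [measurable]: "f \<in> borel_measurable borel" "g \<in> borel_measurable borel"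
  shows "(\<integral>\<^sup>+t. cell_avg k f t * g t \<partial>lborel) = (\<integral>\<^sup>+t. f t * cell_avg k g t \<partial>lborel)"
proof -
  have i1: "(\<integral>\<^sup>+t. f t * indicator (cell k s) t \<partial>lborel) * (ennreal (2 ^ k) * g s) =
     (\<integral>\<^sup>+t. f t * indicator (cell k s) t * (ennreal (2 ^ k) * g s) \<partial>lborel)" for s
    by (rule nn_integral_multc[symmetric]) measurable
  have i2: "(\<integral>\<^sup>+s. g s * indicator (cell k t) s \<partial>lborel) * (ennreal (2 ^ k) * f t) =
     (\<integral>\<^sup>+s. g s * indicator (cell k t) s * (ennreal (2 ^ k) * f t) \<partial>lborel)" for t
    by (rule nn_integral_multc[symmetric]) measurable
  have ind: "indicator (cell k s) t = (indicator {p. fst p \<in> cell k (snd p)} (t, s) :: ennreal)" for s t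
    by (auto simp: indicator_def)
  have "(\<integral>\<^sup>+s. cell_avg k f s * g s \<partial>lborel) =
     (\<integral>\<^sup>+s. \<integral>\<^sup>+t. f t * indicator {p. fst p \<in> cell k (snd p)} (t, s) * (ennreal (2 ^ k) * g s) \<partial>lborel \<partial>lborel)"
    unfolding cell_avg_def using i1 by (simp add: mult_ac flip: ind)
  also have "\<dots> = (\<integral>\<^sup>+t. \<integral>\<^sup>+s. f t * indicator {p. fst p \<in> cell k (snd p)} (t, s) * (ennreal (2 ^ k) * g s) \<partial>lborel \<partial>lborel)"
    by (rule lborel_pair.Fubini') measurable
  also have "\<dots> = (\<integral>\<^sup>+t. \<integral>\<^sup>+s. g s * indicator (cell k t) s * (ennreal (2 ^ k) * f t) \<partial>lborel \<partial>lborel)"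
    by (intro nn_integral_cong) (auto simp: in_cell_iff indicator_def mult_ac)
  also have "\<dots> = (\<integral>\<^sup>+t. f t * cell_avg k g t \<partial>lborel)"
    unfolding cell_avg_def i2[symmetric] by (simp add: mult_ac)
  finally show ?thesis .
qed

lemma nn_integral_Icc_Ico:
  "(\<integral>\<^sup>+t. f t * indicator {a..b} t \<partial>lborel) = (\<integral>\<^sup>+t. f t * indicator {a..<b::real} t \<partial>lborel)"
  by (intro nn_integral_cong_AE) (use AE_lborel_singleton[of b] in eventually_elim, auto simp: indicator_def)

lemma nn_integral_Cauchy_Schwarz_indicator:
  assumes [measurable]: "f \<in> borel_measurable borel" "S \<in> sets borel"
  shows "(\<integral>\<^sup>+t. f t * indicator S t \<partial>lborel)\<^sup>2 \<le> (\<integral>\<^sup>+t. (f t)\<^sup>2 * indicator S t \<partial>lborel) * emeasure lborel S"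
proof -
  have "(\<integral>\<^sup>+t. f t * indicator S t \<partial>lborel)\<^sup>2 = (\<integral>\<^sup>+t. (f t * indicator S t) * indicator S t \<partial>lborel)\<^sup>2"
    by (auto intro!: arg_cong[where f="\<lambda>x. x\<^sup>2"] nn_integral_cong simp: indicator_def)
  also have "\<dots> \<le> (\<integral>\<^sup>+t. (f t * indicator S t)\<^sup>2 \<partial>lborel) * (\<integral>\<^sup>+t. (indicator S t)\<^sup>2 \<partial>lborel)"
    by (rule Cauchy_Schwarz_nn_integral) measurable
  also have "(\<integral>\<^sup>+t. (indicator S t :: ennreal)\<^sup>2 \<partial>lborel) = (\<integral>\<^sup>+t. indicator S t \<partial>lborel)"
    by (intro nn_integral_cong) (auto simp: indicator_def)
  also have "(\<integral>\<^sup>+t. (f t * indicator S t)\<^sup>2 \<partial>lborel) = (\<integral>\<^sup>+t. (f t)\<^sup>2 * indicator S t \<partial>lborel)"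
    by (intro nn_integral_cong) (auto simp: indicator_def)
  finally show ?thesis by simp
qed

text \<open>Cauchy-Schwarz in each cell bounds the squared quotient by the cell average of the
  squared density, and averaging preserves the integral. What matters is that the bound is the same
  for every \<open>k\<close>.\<close>

lemma diffquot_square_le:
  assumes [measurable]: "m \<in> borel_measurable borel"
    and d: "\<And>s t. s \<le> t \<Longrightarrow> ennreal (dist (u s) (u t)) \<le> (\<integral>\<^sup>+r\<in>{s..t}. m r \<partial>lborel)"
  shows "(\<integral>\<^sup>+t. ennreal ((diffquot k u t)\<^sup>2) \<partial>lborel) \<le> (\<integral>\<^sup>+t. (m t)\<^sup>2 \<partial>lborel)"
proof -
  have pt: "ennreal ((diffquot k u t)\<^sup>2) \<le> cell_avg k (\<lambda>r. (m r)\<^sup>2) t" for t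
  proof -
    have "ennreal (diffquot k u t) \<le> (\<integral>\<^sup>+r. m r * indicator (cell k t) r \<partial>lborel) * ennreal (2 ^ k)"
      unfolding diffquot_def cell_def nn_integral_Icc_Ico[symmetric]
      by (subst ennreal_mult) (auto intro!: mult_right_mono d)
    then have "(ennreal (diffquot k u t))\<^sup>2 \<le> ((\<integral>\<^sup>+r. m r * indicator (cell k t) r \<partial>lborel) * ennreal (2 ^ k))\<^sup>2"
      by (rule power_mono) simp
    also have "\<dots> \<le> (\<integral>\<^sup>+r. (m r)\<^sup>2 * indicator (cell k t) r \<partial>lborel) * emeasure lborel (cell k t) * (ennreal (2 ^ k))\<^sup>2"
      unfolding power_mult_distrib by (intro mult_right_mono nn_integral_Cauchy_Schwarz_indicator) auto
    also have "\<dots> = (\<integral>\<^sup>+r. (m r)\<^sup>2 * indicator (cell k t) r \<partial>lborel) * (ennreal (1 / 2 ^ k) * (ennreal (2 ^ k))\<^sup>2)"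
      by (simp add: mult_ac)
    also have "ennreal (1 / 2 ^ k) * (ennreal (2 ^ k))\<^sup>2 = ennreal (2 ^ k)"
      unfolding power2_eq_square mult.assoc[symmetric] by (simp flip: ennreal_mult)
    finally show ?thesis by (simp add: cell_avg_def mult_ac ennreal_power)
  qed
  have "(\<integral>\<^sup>+t. ennreal ((diffquot k u t)\<^sup>2) \<partial>lborel) \<le> (\<integral>\<^sup>+t. cell_avg k (\<lambda>r. (m r)\<^sup>2) t * 1 \<partial>lborel)"
    using pt by (intro nn_integral_mono) simp
  also have "\<dots> = (\<integral>\<^sup>+t. (m t)\<^sup>2 * cell_avg k (\<lambda>_. 1) t \<partial>lborel)"
    by (rule cell_avg_symmetric) auto
  also have "\<dots> = (\<integral>\<^sup>+t. (m t)\<^sup>2 \<partial>lborel)"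
    by (subst cell_avg_cellwise) auto
  finally show ?thesis .
qed

lemma nn_integral_diffquot_cell:
  "(\<integral>\<^sup>+r. ennreal (diffquot k u r) * indicator {of_int i / 2 ^ k..<of_int (i + 1) / 2 ^ k} r \<partial>lborel)
    = ennreal (dist (u (of_int i / 2 ^ k)) (u (of_int (i + 1) / 2 ^ k)))" (is "?L = ennreal ?d")
proof -
  let ?I = "{of_int i / 2 ^ k..<of_int (i + 1) / 2 ^ k} :: real set"
  have "ennreal (diffquot k u r) * indicator ?I r = ennreal (?d * 2 ^ k) * indicator ?I r" for r
    using grid_eq[of i k r] by (auto simp: indicator_def diffquot_def add_divide_distrib)
  then have "?L = ennreal (?d * 2 ^ k) * emeasure lborel ?I"
    by (simp add: nn_integral_cmult_indicator)
  also have "\<dots> = ennreal ?d"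
    by (simp add: divide_right_mono flip: ennreal_mult) (simp add: field_simps)
  finally show ?thesis .
qed

lemma nn_integral_Ico_split:
  fixes f :: "real \<Rightarrow> ennreal"
  assumes [measurable]: "f \<in> borel_measurable borel" and "a \<le> b" "b \<le> c"
  shows "(\<integral>\<^sup>+r. f r * indicator {a..<c} r \<partial>lborel) =
    (\<integral>\<^sup>+r. f r * indicator {a..<b} r \<partial>lborel) + (\<integral>\<^sup>+r. f r * indicator {b..<c} r \<partial>lborel)"
proof -
  have "(\<integral>\<^sup>+r. f r * indicator {a..<c} r \<partial>lborel) =
    (\<integral>\<^sup>+r. f r * indicator {a..<b} r + f r * indicator {b..<c} r \<partial>lborel)"
    using assms(2,3) by (intro nn_integral_cong) (auto simp: indicator_def)
  also have "\<dots> = (\<integral>\<^sup>+r. f r * indicator {a..<b} r \<partial>lborel) + (\<integral>\<^sup>+r. f r * indicator {b..<c} r \<partial>lborel)"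
    by (rule nn_integral_add) measurable
  finally show ?thesis .
qed

lemma diffquot_triangle:
  "ennreal (dist (u (of_int i / 2 ^ k)) (u (of_int (i + int j) / 2 ^ k)))
    \<le> (\<integral>\<^sup>+r. ennreal (diffquot k u r) * indicator {of_int i / 2 ^ k..<of_int (i + int j) / 2 ^ k} r \<partial>lborel)"
proof (induction j)
  case (Suc j)
  let ?a = "of_int i / 2 ^ k :: real" and ?b = "of_int (i + int j) / 2 ^ k :: real"
    and ?c = "of_int (i + int (Suc j)) / 2 ^ k :: real"
  have c: "?c = of_int ((i + int j) + 1) / 2 ^ k" by (simp add: algebra_simps)
  have "ennreal (dist (u ?a) (u ?c)) \<le> ennreal (dist (u ?a) (u ?b)) + ennreal (dist (u ?b) (u ?c))"
    by (simp add: dist_triangle flip: ennreal_plus)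
  also have "\<dots> \<le> (\<integral>\<^sup>+r. ennreal (diffquot k u r) * indicator {?a..<?b} r \<partial>lborel) +
     (\<integral>\<^sup>+r. ennreal (diffquot k u r) * indicator {?b..<?c} r \<partial>lborel)"
    unfolding c nn_integral_diffquot_cell by (intro add_mono Suc) simp
  also have "\<dots> = (\<integral>\<^sup>+r. ennreal (diffquot k u r) * indicator {?a..<?c} r \<partial>lborel)"
    by (rule nn_integral_Ico_split[symmetric]) (auto simp: divide_right_mono)
  finally show ?case .
qed simp

text \<open>For a monotone function the triangle inequality along the grid is an equality. This is
  what later makes the density of such a function reproduce its increments exactly instead of merely
  dominating them.\<close>

lemma diffquot_mono_total:
  fixes u :: "real \<Rightarrow> real"
  assumes "mono u"
  shows "(\<integral>\<^sup>+r. ennreal (diffquot k u r) * indicator {of_int i / 2 ^ k..<of_int (i + int j) / 2 ^ k} r \<partial>lborel)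
    = ennreal (u (of_int (i + int j) / 2 ^ k) - u (of_int i / 2 ^ k))"
proof (induction j)
  case (Suc j)
  let ?a = "of_int i / 2 ^ k :: real" and ?b = "of_int (i + int j) / 2 ^ k :: real"
    and ?c = "of_int (i + int (Suc j)) / 2 ^ k :: real"
  have ab: "?a \<le> ?b" "?b \<le> ?c" by (simp_all add: divide_right_mono)
  have c: "?c = of_int ((i + int j) + 1) / 2 ^ k" by (simp add: algebra_simps)
  have "(\<integral>\<^sup>+r. ennreal (diffquot k u r) * indicator {?a..<?c} r \<partial>lborel) =
    (\<integral>\<^sup>+r. ennreal (diffquot k u r) * indicator {?a..<?b} r \<partial>lborel) +
     (\<integral>\<^sup>+r. ennreal (diffquot k u r) * indicator {?b..<?c} r \<partial>lborel)"
    by (rule nn_integral_Ico_split) (auto simp: divide_right_mono)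
  also have "\<dots> = ennreal (u ?b - u ?a) + ennreal (dist (u ?b) (u ?c))"
    unfolding c nn_integral_diffquot_cell Suc ..
  also have "\<dots> = ennreal (u ?c - u ?a)"
    using monoD[OF assms ab(1)] monoD[OF assms ab(2)] by (simp add: dist_real_def flip: ennreal_plus)
  finally show ?case .
qed simp


definition dq_sq :: "(real \<Rightarrow> 'a::metric_space) \<Rightarrow> nat \<Rightarrow> ennreal" where
  "dq_sq u k = (\<integral>\<^sup>+t. ennreal ((diffquot k u t)\<^sup>2) \<partial>lborel)"

lemma diffquot_le_avg:
  assumes "k \<le> l"
  shows "ennreal (diffquot k u t) \<le> cell_avg k (\<lambda>r. ennreal (diffquot l u r)) t"
proof -
  define i where "i = \<lfloor>2 ^ k * t\<rfloor> * 2 ^ (l - k)"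
  have p: "(2::real) ^ l = 2 ^ k * 2 ^ (l - k)" using assms by (simp flip: power_add)
  have a: "of_int i / 2 ^ l = grid k t" unfolding i_def grid_def p by simp
  have b: "of_int (i + int (2 ^ (l - k))) / 2 ^ l = grid k t + 1 / 2 ^ k"
    unfolding a[symmetric] by (simp add: add_divide_distrib p)
  have "ennreal (diffquot k u t) = ennreal (2 ^ k) * ennreal (dist (u (grid k t)) (u (grid k t + 1 / 2 ^ k)))"
    unfolding diffquot_def by (simp add: mult.commute flip: ennreal_mult)
  also have "\<dots> \<le> cell_avg k (\<lambda>r. ennreal (diffquot l u r)) t"
    unfolding cell_avg_def cell_def
    using diffquot_triangle[of u i l "2 ^ (l - k)"] unfolding a b by (intro mult_left_mono) auto
  finally show ?thesis .
qed

text \<open>One factor of the square is replaced by the average of the finer quotient. By symmetry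
  the averaging moves to the other factor, where it does nothing because \<open>diffquot k\<close>
  is constant on its cells.\<close>

lemma dq_sq_le_inner:
  assumes "k \<le> l"
  shows "dq_sq u k \<le> (\<integral>\<^sup>+t. ennreal (diffquot l u t) * ennreal (diffquot k u t) \<partial>lborel)"
proof -
  have "dq_sq u k \<le> (\<integral>\<^sup>+t. cell_avg k (\<lambda>r. ennreal (diffquot l u r)) t * ennreal (diffquot k u t) \<partial>lborel)"
    unfolding dq_sq_def using diffquot_le_avg[OF assms, of u]
    by (intro nn_integral_mono) (auto simp: power2_eq_square ennreal_mult intro: mult_right_mono)
  also have "\<dots> = (\<integral>\<^sup>+t. ennreal (diffquot l u t) * cell_avg k (\<lambda>r. ennreal (diffquot k u r)) t \<partial>lborel)"
    by (rule cell_avg_symmetric) auto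
  also have "cell_avg k (\<lambda>r. ennreal (diffquot k u r)) = (\<lambda>t. ennreal (diffquot k u t))"
  proof
    have "grid k (grid k r) = grid k r" for r
      unfolding in_cell_iff[symmetric] by (simp add: cell_def)
    then show "cell_avg k (\<lambda>r. ennreal (diffquot k u r)) t = ennreal (diffquot k u t)" for t
      by (intro cell_avg_cellwise) (simp add: diffquot_def)
  qed
  finally show ?thesis .
qed

text \<open>By the triangle inequality the difference quotients form a submartingale for the dyadic
  filtration, which makes them a Cauchy sequence in \<open>L\<^sup>2\<close> as soon as they are bounded there.\<close>

lemma dq_sq_Cauchy:
  assumes "k \<le> l" and fin: "\<And>k. dq_sq u k < \<infinity>"
  shows "(\<integral>\<^sup>+t. ennreal ((diffquot l u t - diffquot k u t)\<^sup>2) \<partial>lborel) + dq_sq u k \<le> dq_sq u l"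
proof -
  let ?X = "\<integral>\<^sup>+t. ennreal ((diffquot l u t - diffquot k u t)\<^sup>2) \<partial>lborel"
  let ?Y = "\<integral>\<^sup>+t. ennreal (diffquot l u t) * ennreal (diffquot k u t) \<partial>lborel"
  \<comment> \<open>The expansion of the square is kept as an identity between sums, since
    subtraction in \<open>ennreal\<close> truncates. Each \<open>?Y\<close> is at least the coarse
    norm, and one copy of that norm is cancelled at the end because it is finite.\<close>
  have "?X + (?Y + ?Y) = (\<integral>\<^sup>+t. ennreal ((diffquot l u t - diffquot k u t)\<^sup>2) +
      (ennreal (diffquot l u t) * ennreal (diffquot k u t) + ennreal (diffquot l u t) * ennreal (diffquot k u t)) \<partial>lborel)"
    by (simp add: nn_integral_add)
  also have "\<dots> = (\<integral>\<^sup>+t. ennreal ((diffquot l u t)\<^sup>2) + ennreal ((diffquot k u t)\<^sup>2) \<partial>lborel)"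
  proof (intro nn_integral_cong)
    fix t
    have "ennreal ((x - y)\<^sup>2) + (ennreal x * ennreal y + ennreal x * ennreal y) = ennreal (x\<^sup>2) + ennreal (y\<^sup>2)"
      if "0 \<le> x" "0 \<le> y" for x y :: real
    proof -
      have "ennreal ((x - y)\<^sup>2) + (ennreal x * ennreal y + ennreal x * ennreal y) = ennreal ((x - y)\<^sup>2 + (x * y + x * y))"
        using that by (simp only: ennreal_mult ennreal_plus zero_le_power2 mult_nonneg_nonneg add_nonneg_nonneg)
      also have "(x - y)\<^sup>2 + (x * y + x * y) = x\<^sup>2 + y\<^sup>2"
        by (simp add: power2_eq_square algebra_simps)
      finally show ?thesis by simp
    qed
    then show "ennreal ((diffquot l u t - diffquot k u t)\<^sup>2) +
      (ennreal (diffquot l u t) * ennreal (diffquot k u t) + ennreal (diffquot l u t) * ennreal (diffquot k u t))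
      = ennreal ((diffquot l u t)\<^sup>2) + ennreal ((diffquot k u t)\<^sup>2)" by simp
  qed
  also have "\<dots> = dq_sq u l + dq_sq u k"
    unfolding dq_sq_def by (simp add: nn_integral_add)
  finally have eq: "?X + (?Y + ?Y) = dq_sq u l + dq_sq u k" .
  have "(?X + dq_sq u k) + dq_sq u k \<le> ?X + (?Y + ?Y)"
    using dq_sq_le_inner[OF assms(1), of u] by (simp add: add.assoc add_mono)
  then have "dq_sq u k + (?X + dq_sq u k) \<le> dq_sq u k + dq_sq u l" unfolding eq by (simp add: add.commute)
  then show ?thesis using fin[of k] by (auto simp: ennreal_add_left_cancel_le)
qed

text \<open>The squared norms increase to a finite limit, so the gaps can be made as small as
  desired. Squared distances of \<open>(1/4) ^ j\<close> are distances of \<open>(1/2) ^ j\<close>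
  in L2, which are summable, and this gives almost everywhere convergence afterwards.\<close>

lemma dq_fast_subseq:
  assumes bound: "\<And>k. dq_sq u k \<le> \<Lambda>" and fin: "\<Lambda> < \<infinity>"
  obtains \<kappa> :: "nat \<Rightarrow> nat" where "strict_mono \<kappa>"
    "\<And>j. (\<integral>\<^sup>+t. ennreal ((diffquot (\<kappa> (Suc j)) u t - diffquot (\<kappa> j) u t)\<^sup>2) \<partial>lborel) \<le> ennreal ((1/4) ^ j)"
proof -
  have finS: "dq_sq u k < \<infinity>" for k using bound[of k] fin by (rule le_less_trans)
  define s where "s k = enn2real (dq_sq u k)" for k
  have S: "dq_sq u k = ennreal (s k)" for k using finS[of k] by (simp add: s_def)
  have mono: "dq_sq u k \<le> dq_sq u l" if "k \<le> l" for k l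
    by (rule order.trans[OF _ dq_sq_Cauchy[OF that finS]]) simp
  have inc: "incseq s" unfolding incseq_def s_def using mono finS by (simp add: enn2real_mono)
  have "\<forall>k. s k \<le> enn2real \<Lambda>" unfolding s_def using bound fin by (simp add: enn2real_mono)
  then obtain L where L: "s \<longlonglongrightarrow> L" "\<And>k. s k \<le> L"
    using incseq_convergent[OF inc] by metis
  have ex: "\<exists>k. k > n \<and> L - s k \<le> (1/4) ^ j" for n j
  proof -
    have "\<forall>\<^sub>F k in sequentially. s k > L - (1/4) ^ j" using L(1) by (rule order_tendstoD) simp
    then have "\<forall>\<^sub>F k in sequentially. s k > L - (1/4) ^ j \<and> k > n"
      using eventually_gt_at_top[of n] by eventually_elim auto
    then obtain k where "s k > L - (1/4) ^ j" "k > n" by (auto simp: eventually_sequentially)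
    then show ?thesis by (intro exI[of _ k]) auto
  qed
  obtain \<kappa> :: "nat \<Rightarrow> nat" where \<kappa>: "\<And>j. L - s (\<kappa> j) \<le> (1/4) ^ j" "\<And>j. \<kappa> j < \<kappa> (Suc j)"
    using dependent_nat_choice[of "\<lambda>j k. L - s k \<le> (1/4) ^ j" "\<lambda>j k k'. k < k'"] ex by metis
  show ?thesis
  proof (rule that)
    show "strict_mono \<kappa>" using \<kappa>(2) by (simp add: strict_mono_Suc_iff)
    fix j
    let ?X = "\<integral>\<^sup>+t. ennreal ((diffquot (\<kappa> (Suc j)) u t - diffquot (\<kappa> j) u t)\<^sup>2) \<partial>lborel"
    have "?X + ennreal (s (\<kappa> j)) \<le> ennreal (s (\<kappa> (Suc j)))"
      using dq_sq_Cauchy[OF less_imp_le[OF \<kappa>(2)] finS, of j] unfolding S .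
    also have "\<dots> \<le> ennreal ((1/4) ^ j + s (\<kappa> j))"
      using \<kappa>(1)[of j] L(2)[of "\<kappa> (Suc j)"] by (intro ennreal_leI) auto
    also have "\<dots> = ennreal ((1/4) ^ j) + ennreal (s (\<kappa> j))"
      by (rule ennreal_plus) (simp_all add: s_def)
    finally have "ennreal (s (\<kappa> j)) + ?X \<le> ennreal (s (\<kappa> j)) + ennreal ((1/4) ^ j)" by (simp add: add.commute)
    then show "?X \<le> ennreal ((1/4) ^ j)"
      by (simp add: ennreal_add_left_cancel_le)
  qed
qed

text \<open>Young's inequality. The free constant balances the two terms: \<open>c = 2 ^ j\<close>
  against a squared norm of \<open>(1/4) ^ j\<close> leaves a multiple of \<open>(1/2) ^ j\<close>
  on a bounded interval, and \<open>c = 1\<close> gives plain local integrability.\<close>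

lemma nn_integral_abs_indicator_le:
  assumes [measurable]: "f \<in> borel_measurable borel" "S \<in> sets borel" and c: "c > 0"
  shows "(\<integral>\<^sup>+t. ennreal \<bar>f t\<bar> * indicator S t \<partial>lborel)
    \<le> ennreal c * (\<integral>\<^sup>+t. ennreal ((f t)\<^sup>2) \<partial>lborel) + ennreal (1 / c) * emeasure lborel S"
proof -
  have "ennreal \<bar>f t\<bar> * indicator S t \<le> ennreal c * ennreal ((f t)\<^sup>2) + ennreal (1 / c) * indicator S t" for t
  proof -
    have "0 \<le> (c * \<bar>f t\<bar> - 1)\<^sup>2 / c" using c by simp
    also have "\<dots> = c * (f t)\<^sup>2 - 2 * \<bar>f t\<bar> + 1 / c"
      using c by (simp add: power2_eq_square field_simps)
    finally have "\<bar>f t\<bar> \<le> c * (f t)\<^sup>2 + 1 / c" by linarith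
    then show ?thesis using c by (auto simp: indicator_def simp flip: ennreal_mult ennreal_plus)
  qed
  then have "(\<integral>\<^sup>+t. ennreal \<bar>f t\<bar> * indicator S t \<partial>lborel)
    \<le> (\<integral>\<^sup>+t. ennreal c * ennreal ((f t)\<^sup>2) + ennreal (1 / c) * indicator S t \<partial>lborel)"
    by (rule nn_integral_mono)
  also have "\<dots> = ennreal c * (\<integral>\<^sup>+t. ennreal ((f t)\<^sup>2) \<partial>lborel) + ennreal (1 / c) * emeasure lborel S"
    by (simp add: nn_integral_add nn_integral_cmult nn_integral_cmult_indicator)
  finally show ?thesis .
qed

text \<open>The function \<open>W\<close>, the first quotient plus all absolute increments of the
  fast subsequence, is locally integrable. Where it is finite the subsequence converges absolutely,
  and it dominates the subsequence, which yields convergence of the integrals over bounded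
  intervals. Fatou bounds the limit in L2.\<close>

lemma dq_limit:
  fixes u :: "real \<Rightarrow> 'a::metric_space"
  assumes bound: "\<And>k. dq_sq u k \<le> \<Lambda>" and fin: "\<Lambda> < \<infinity>"
  obtains \<kappa> :: "nat \<Rightarrow> nat" and m :: "real \<Rightarrow> real" where "strict_mono \<kappa>" "m \<in> borel_measurable borel" "\<And>t. 0 \<le> m t"
    "(\<integral>\<^sup>+t. ennreal ((m t)\<^sup>2) \<partial>lborel) \<le> \<Lambda>"
    "\<And>a b. (\<lambda>j. \<integral>\<^sup>+t. ennreal (diffquot (\<kappa> j) u t) * indicator {a..b} t \<partial>lborel)
        \<longlonglongrightarrow> (\<integral>\<^sup>+t. ennreal (m t) * indicator {a..b} t \<partial>lborel)"
proof -
  obtain \<kappa> where \<kappa>: "strict_mono \<kappa>"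
    "\<And>j. (\<integral>\<^sup>+t. ennreal ((diffquot (\<kappa> (Suc j)) u t - diffquot (\<kappa> j) u t)\<^sup>2) \<partial>lborel) \<le> ennreal ((1/4) ^ j)"
    using dq_fast_subseq[OF bound fin] by blast
  define D where "D j t = diffquot (\<kappa> j) u t" for j t
  \<comment> \<open>Off the set of convergence \<open>lim\<close> is an arbitrary value; the
    absolute value keeps \<open>m\<close> nonnegative there too, and changes nothing elsewhere
    because the quotients are nonnegative.\<close>
  define m where "m t = \<bar>lim (\<lambda>j. D j t)\<bar>" for t
  have Dm[measurable]: "D j \<in> borel_measurable borel" for j unfolding D_def[abs_def] by measurable
  have mm[measurable]: "m \<in> borel_measurable borel" unfolding m_def[abs_def] by measurable
  define W where "W t = ennreal (D 0 t) + (\<Sum>j. ennreal \<bar>D (Suc j) t - D j t\<bar>)" for t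
  have Wm[measurable]: "W \<in> borel_measurable borel" unfolding W_def[abs_def] by measurable
  have Wfin: "(\<integral>\<^sup>+t. W t * indicator {a..b} t \<partial>lborel) < \<infinity>" for a b :: real
  proof -
    let ?R = "emeasure lborel {a..b}"
    have R: "?R = ennreal (max 0 (b - a))" by (cases "a \<le> b") auto
    have 1: "(\<integral>\<^sup>+t. ennreal (D 0 t) * indicator {a..b} t \<partial>lborel) < \<infinity>"
    proof -
      have "(\<integral>\<^sup>+t. ennreal (D 0 t) * indicator {a..b} t \<partial>lborel) \<le> ennreal 1 * dq_sq u (\<kappa> 0) + ennreal (1/1) * ?R"
        using nn_integral_abs_indicator_le[of "D 0" "{a..b}" 1] by (simp add: dq_sq_def D_def)
      also have "\<dots> < \<infinity>" using bound[of "\<kappa> 0"] fin R by (simp add: le_less_trans)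
      finally show ?thesis .
    qed
    have 2: "(\<integral>\<^sup>+t. ennreal \<bar>D (Suc j) t - D j t\<bar> * indicator {a..b} t \<partial>lborel) \<le> ennreal ((1 + max 0 (b - a)) * (1/2) ^ j)" for j
    proof -
      have "(\<integral>\<^sup>+t. ennreal \<bar>D (Suc j) t - D j t\<bar> * indicator {a..b} t \<partial>lborel)
        \<le> ennreal (2 ^ j) * (\<integral>\<^sup>+t. ennreal ((D (Suc j) t - D j t)\<^sup>2) \<partial>lborel) + ennreal (1 / 2 ^ j) * ?R"
        by (rule nn_integral_abs_indicator_le) auto
      also have "\<dots> \<le> ennreal (2 ^ j) * ennreal ((1/4) ^ j) + ennreal (1 / 2 ^ j) * ?R"
        using \<kappa>(2)[of j] by (intro add_mono mult_left_mono) (auto simp: D_def)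
      also have "\<dots> = ennreal (2 ^ j * (1/4) ^ j + 1 / 2 ^ j * max 0 (b - a))"
        by (simp add: R flip: ennreal_mult ennreal_plus)
      also have "2 ^ j * (1/4) ^ j + 1 / 2 ^ j * max 0 (b - a) = (1 + max 0 (b - a)) * (1/2) ^ j"
      proof -
        have "2 ^ j * (1/4) ^ j = (1/2 :: real) ^ j" by (simp flip: power_mult_distrib)
        then show ?thesis by (simp add: add_divide_distrib power_one_over)
      qed
      finally show ?thesis .
    qed
    have sm: "summable (\<lambda>j. (1 + max 0 (b - a)) * (1/2) ^ j)" by (intro summable_mult summable_geometric) simp
    have "(\<integral>\<^sup>+t. (\<Sum>j. ennreal \<bar>D (Suc j) t - D j t\<bar>) * indicator {a..b} t \<partial>lborel)
      = (\<integral>\<^sup>+t. (\<Sum>j. ennreal \<bar>D (Suc j) t - D j t\<bar> * indicator {a..b} t) \<partial>lborel)"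
      by simp
    also have "\<dots> = (\<Sum>j. \<integral>\<^sup>+t. ennreal \<bar>D (Suc j) t - D j t\<bar> * indicator {a..b} t \<partial>lborel)"
      by (rule nn_integral_suminf) measurable
    also have "\<dots> \<le> (\<Sum>j. ennreal ((1 + max 0 (b - a)) * (1/2) ^ j))"
      using 2 by (intro suminf_le) auto
    also have "\<dots> < \<infinity>" using sm by (subst suminf_ennreal2) auto
    finally have 3: "(\<integral>\<^sup>+t. (\<Sum>j. ennreal \<bar>D (Suc j) t - D j t\<bar>) * indicator {a..b} t \<partial>lborel) < \<infinity>" .
    show ?thesis unfolding W_def using 1 3 by (simp add: distrib_right nn_integral_add)
  qed
  have Dle: "ennreal (D j t) \<le> W t" for j t
  proof -
    have "D j t \<le> D 0 t + (\<Sum>i<j. \<bar>D (Suc i) t - D i t\<bar>)" by (induction j) auto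
    then have "ennreal (D j t) \<le> ennreal (D 0 t + (\<Sum>i<j. \<bar>D (Suc i) t - D i t\<bar>))" by (rule ennreal_leI)
    also have "\<dots> = ennreal (D 0 t) + (\<Sum>i<j. ennreal \<bar>D (Suc i) t - D i t\<bar>)"
      by (subst ennreal_plus) (auto simp: D_def sum_nonneg)
    also have "\<dots> \<le> W t" unfolding W_def by (intro add_left_mono sum_le_suminf) auto
    finally show ?thesis .
  qed
  have conv: "(\<lambda>j. D j t) \<longlonglongrightarrow> m t" if "W t < \<infinity>" for t
  proof -
    have "(\<Sum>j. ennreal \<bar>D (Suc j) t - D j t\<bar>) \<noteq> top" using that by (auto simp: W_def)
    then have "summable (\<lambda>j. \<bar>D (Suc j) t - D j t\<bar>)" by (rule summable_suminf_not_top[rotated]) auto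
    then have "summable (\<lambda>j. D (Suc j) t - D j t)" by (rule summable_rabs_cancel)
    then have "convergent (\<lambda>n. \<Sum>j<n. D (Suc j) t - D j t)" by (simp add: summable_iff_convergent)
    moreover have "(\<lambda>n. \<Sum>j<n. D (Suc j) t - D j t) = (\<lambda>n. D n t - D 0 t)"
      by (rule ext) (rule sum_lessThan_telescope[of "\<lambda>j. D j t"])
    ultimately have "convergent (\<lambda>n. D n t - D 0 t)" by simp
    then have c: "convergent (\<lambda>n. D n t)"
      using convergent_add[OF _ convergent_const[of "D 0 t"]] by fastforce
    then have lim: "(\<lambda>n. D n t) \<longlonglongrightarrow> lim (\<lambda>j. D j t)" by (simp add: convergent_LIMSEQ_iff)
    then have "lim (\<lambda>j. D j t) \<ge> 0" by (rule LIMSEQ_le_const) (auto simp: D_def)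
    then show ?thesis using lim by (simp add: m_def)
  qed
  have Wae: "AE t in lborel. W t < \<infinity>"
  proof -
    have "AE t in lborel. W t * indicator {-real n..real n} t \<noteq> \<infinity>" for n
      using Wfin[of "-real n" "real n"] by (intro nn_integral_PInf_AE) auto
    then have "AE t in lborel. \<forall>n. W t * indicator {-real n..real n} t \<noteq> \<infinity>" by (simp add: AE_all_countable)
    then show ?thesis
    proof eventually_elim
      case (elim t)
      obtain n where "\<bar>t\<bar> \<le> real n" using real_arch_simple by blast
      then have "t \<in> {-real n..real n}" by auto
      then show ?case using elim[rule_format, of n] by (simp add: less_top)
    qed
  qed
  show ?thesis
  proof (rule that[of \<kappa> m])
    show "(\<integral>\<^sup>+t. ennreal ((m t)\<^sup>2) \<partial>lborel) \<le> \<Lambda>"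
    proof -
      have "AE t in lborel. ennreal ((m t)\<^sup>2) = liminf (\<lambda>j. ennreal ((D j t)\<^sup>2))"
        using Wae
      proof eventually_elim
        case (elim t)
        have "(\<lambda>j. ennreal ((D j t)\<^sup>2)) \<longlonglongrightarrow> ennreal ((m t)\<^sup>2)"
          by (intro tendsto_ennrealI tendsto_power conv elim)
        from lim_imp_Liminf[OF sequentially_bot this] show ?case by (rule sym)
      qed
      then have "(\<integral>\<^sup>+t. ennreal ((m t)\<^sup>2) \<partial>lborel) = (\<integral>\<^sup>+t. liminf (\<lambda>j. ennreal ((D j t)\<^sup>2)) \<partial>lborel)"
        by (rule nn_integral_cong_AE)
      also have "\<dots> \<le> liminf (\<lambda>j. \<integral>\<^sup>+t. ennreal ((D j t)\<^sup>2) \<partial>lborel)"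
        by (rule nn_integral_liminf) measurable
      also have "\<dots> \<le> liminf (\<lambda>j::nat. \<Lambda>)"
        using bound unfolding D_def dq_sq_def by (intro Liminf_mono) auto
      finally show ?thesis unfolding Liminf_const[OF sequentially_bot] .
    qed
    show "(\<lambda>j. \<integral>\<^sup>+t. ennreal (diffquot (\<kappa> j) u t) * indicator {a..b} t \<partial>lborel)
        \<longlonglongrightarrow> (\<integral>\<^sup>+t. ennreal (m t) * indicator {a..b} t \<partial>lborel)" for a b
      unfolding D_def[symmetric]
    proof (rule nn_integral_dominated_convergence[where w="\<lambda>t. W t * indicator {a..b} t"])
      show "AE t in lborel. (\<lambda>j. ennreal (D j t) * indicator {a..b} t) \<longlonglongrightarrow> ennreal (m t) * indicator {a..b} t"
        using Wae
      proof eventually_elim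
        case (elim t)
        have "(\<lambda>j. ennreal (D j t)) \<longlonglongrightarrow> ennreal (m t)" by (intro tendsto_ennrealI conv elim)
        then show ?case by (cases "t \<in> {a..b}") auto
      qed
    qed (use Wfin[of a b] Dle in \<open>auto simp: indicator_def\<close>)
  qed (use \<kappa>(1) in \<open>auto simp: m_def\<close>)
qed

lemma grid_tendsto: "(\<lambda>k. grid k t) \<longlonglongrightarrow> t"
proof (rule tendsto_sandwich[where f="\<lambda>k. t - (1/2) ^ k" and h="\<lambda>k. t"])
  show "(\<lambda>k. t - (1/2) ^ k) \<longlonglongrightarrow> t"
    by (rule tendsto_eq_intros LIMSEQ_power_zero refl | simp)+
  show "\<forall>\<^sub>F k in sequentially. t - (1/2) ^ k \<le> grid k t"
    using less_grid[of t] by (auto simp: power_one_over intro!: always_eventually) (metis diff_le_eq less_imp_le)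
qed (auto simp: grid_le)

lemma grid_refine:
  assumes "k \<le> l"
  shows "grid k t = of_int (\<lfloor>2 ^ k * t\<rfloor> * 2 ^ (l - k)) / 2 ^ l"
    "grid k t + 1 / 2 ^ k = of_int ((\<lfloor>2 ^ k * t\<rfloor> + 1) * 2 ^ (l - k)) / 2 ^ l"
proof -
  have p: "(2::real) ^ l = 2 ^ k * 2 ^ (l - k)" using assms by (simp flip: power_add)
  show "grid k t = of_int (\<lfloor>2 ^ k * t\<rfloor> * 2 ^ (l - k)) / 2 ^ l" unfolding grid_def p by simp
  show "grid k t + 1 / 2 ^ k = of_int ((\<lfloor>2 ^ k * t\<rfloor> + 1) * 2 ^ (l - k)) / 2 ^ l"
    unfolding grid_def p by (simp add: add_divide_distrib distrib_right)
qed

text \<open>With dyadic end points held fixed, the chain of triangle inequalities passes to the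
  limit along \<open>\<kappa>\<close>; continuity of \<open>u\<close> then moves the end points to
  \<open>s\<close> and \<open>t\<close>. The interval is enlarged to the left because
  \<open>grid k s\<close> may precede \<open>s\<close>, and the enlargement vanishes with
  \<open>k\<close>.\<close>

lemma dist_le_density:
  fixes u :: "real \<Rightarrow> 'a::metric_space"
  assumes cont: "continuous_on UNIV u" and \<kappa>: "strict_mono \<kappa>"
    and [measurable]: "m \<in> borel_measurable borel" and nn: "\<And>t. 0 \<le> m t"
    and fin: "(\<integral>\<^sup>+t. ennreal ((m t)\<^sup>2) \<partial>lborel) < \<infinity>"
    and conv: "\<And>a b. (\<lambda>j. \<integral>\<^sup>+t. ennreal (diffquot (\<kappa> j) u t) * indicator {a..b} t \<partial>lborel)
        \<longlonglongrightarrow> (\<integral>\<^sup>+t. ennreal (m t) * indicator {a..b} t \<partial>lborel)"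
    and st: "s \<le> t"
  shows "ennreal (dist (u s) (u t)) \<le> (\<integral>\<^sup>+r. ennreal (m r) * indicator {s..t} r \<partial>lborel)"
proof -
  have le: "ennreal (dist (u (grid k s)) (u (grid k t))) \<le> (\<integral>\<^sup>+r. ennreal (m r) * indicator {s - (1/2) ^ k..t} r \<partial>lborel)" for k
  proof -
    have "\<forall>\<^sub>F j in sequentially. ennreal (dist (u (grid k s)) (u (grid k t))) \<le>
       (\<integral>\<^sup>+r. ennreal (diffquot (\<kappa> j) u r) * indicator {grid k s..grid k t} r \<partial>lborel)"
      using eventually_ge_at_top[of k]
    proof eventually_elim
      case (elim j)
      have kl: "k \<le> \<kappa> j" using elim seq_suble[OF \<kappa>, of j] by simp
      define i where "i = \<lfloor>2 ^ k * s\<rfloor> * 2 ^ (\<kappa> j - k)"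
      define n where "n = nat ((\<lfloor>2 ^ k * t\<rfloor> - \<lfloor>2 ^ k * s\<rfloor>) * 2 ^ (\<kappa> j - k))"
      have "\<lfloor>2 ^ k * s\<rfloor> \<le> \<lfloor>2 ^ k * t\<rfloor>" using st by (intro floor_mono) simp
      then have "i + int n = \<lfloor>2 ^ k * t\<rfloor> * 2 ^ (\<kappa> j - k)" unfolding i_def n_def by (simp add: algebra_simps)
      then show ?case
        using diffquot_triangle[of u i "\<kappa> j" n] grid_refine(1)[OF kl, of s] grid_refine(1)[OF kl, of t]
        unfolding i_def nn_integral_Icc_Ico by simp
    qed
    then have "ennreal (dist (u (grid k s)) (u (grid k t))) \<le> (\<integral>\<^sup>+r. ennreal (m r) * indicator {grid k s..grid k t} r \<partial>lborel)"
      by (intro tendsto_lowerbound[OF conv]) auto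
    also have "\<dots> \<le> (\<integral>\<^sup>+r. ennreal (m r) * indicator {s - (1/2) ^ k..t} r \<partial>lborel)"
      using less_grid[of s k] grid_le[of k t]
      by (intro nn_integral_mono mult_left_mono) (auto simp: indicator_def power_one_over)
    finally show ?thesis .
  qed
  have rhs: "(\<lambda>k. \<integral>\<^sup>+r. ennreal (m r) * indicator {s - (1/2) ^ k..t} r \<partial>lborel)
    \<longlonglongrightarrow> (\<integral>\<^sup>+r. ennreal (m r) * indicator {s..t} r \<partial>lborel)"
  proof (rule nn_integral_dominated_convergence[where w="\<lambda>r. ennreal (m r) * indicator {s - 1..t} r"])
    show "AE r in lborel. (\<lambda>k. ennreal (m r) * indicator {s - (1/2) ^ k..t} r) \<longlonglongrightarrow> ennreal (m r) * indicator {s..t} r"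
    proof (rule AE_I2)
      fix r
      have "\<forall>\<^sub>F k in sequentially. ennreal (m r) * indicator {s - (1/2) ^ k..t} r = ennreal (m r) * indicator {s..t} r"
      proof (cases "r < s")
        case True
        have "(\<lambda>k. s - (1/2) ^ k) \<longlonglongrightarrow> s - (0::real)" by (intro tendsto_intros LIMSEQ_power_zero) simp
        then have "\<forall>\<^sub>F k in sequentially. r < s - (1/2) ^ k" using True by (intro order_tendstoD) auto
        then show ?thesis by eventually_elim (use True in \<open>auto simp: indicator_def\<close>)
      next
        case False
        have "0 \<le> (1/2 :: real) ^ k" for k by simp
        then have "s - (1/2) ^ k \<le> r" for k using False by (smt (verit))
        then show ?thesis using False by (intro always_eventually) (auto simp: indicator_def)
      qed
      then show "(\<lambda>k. ennreal (m r) * indicator {s - (1/2) ^ k..t} r) \<longlonglongrightarrow> ennreal (m r) * indicator {s..t} r"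
        by (rule tendsto_eventually)
    qed
    show "AE r in lborel. ennreal (m r) * indicator {s - (1/2) ^ k..t} r \<le> ennreal (m r) * indicator {s - 1..t} r" for k
    proof (rule AE_I2)
      fix r
      have "(1/2 :: real) ^ k \<le> 1" by (simp add: power_le_one)
      then show "ennreal (m r) * indicator {s - (1/2) ^ k..t} r \<le> ennreal (m r) * indicator {s - 1..t} r"
        by (auto simp: indicator_def)
    qed
    have "(\<integral>\<^sup>+r. ennreal \<bar>m r\<bar> * indicator {s - 1..t} r \<partial>lborel) \<le>
      ennreal 1 * (\<integral>\<^sup>+t. ennreal ((m t)\<^sup>2) \<partial>lborel) + ennreal (1/1) * emeasure lborel {s - 1..t}"
      by (rule nn_integral_abs_indicator_le) auto
    also have "\<dots> < \<infinity>" using fin st by simp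
    finally show "(\<integral>\<^sup>+r. ennreal (m r) * indicator {s - 1..t} r \<partial>lborel) < \<infinity>" using nn by simp
  qed auto
  have lhs: "(\<lambda>k. ennreal (dist (u (grid k s)) (u (grid k t)))) \<longlonglongrightarrow> ennreal (dist (u s) (u t))"
    using cont by (intro tendsto_ennrealI tendsto_dist) (auto intro!: continuous_on_tendsto_compose[OF cont] grid_tendsto)
  show ?thesis by (rule LIMSEQ_le[OF lhs rhs]) (use le in blast)
qed

text \<open>The converse bound. Both end points are now rounded outwards, the right one to
  \<open>grid k t + 1 / 2 ^ k\<close>, so that the dyadic interval contains \<open>{s..t}\<close>
  and its increment, an exact integral of the quotients, is an upper bound.\<close>

lemma mono_density_le:
  fixes u :: "real \<Rightarrow> real"
  assumes cont: "continuous_on UNIV u" and \<kappa>: "strict_mono \<kappa>" and mono: "mono u"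
    and conv: "\<And>a b. (\<lambda>j. \<integral>\<^sup>+t. ennreal (diffquot (\<kappa> j) u t) * indicator {a..b} t \<partial>lborel)
        \<longlonglongrightarrow> (\<integral>\<^sup>+t. ennreal (m t) * indicator {a..b} t \<partial>lborel)"
    and st: "s \<le> t"
  shows "(\<integral>\<^sup>+r. ennreal (m r) * indicator {s..t} r \<partial>lborel) \<le> ennreal (u t - u s)"
proof -
  have le: "(\<integral>\<^sup>+r. ennreal (m r) * indicator {s..t} r \<partial>lborel) \<le> ennreal (u (grid k t + 1 / 2 ^ k) - u (grid k s))" for k
  proof -
    have "\<forall>\<^sub>F j in sequentially. (\<integral>\<^sup>+r. ennreal (diffquot (\<kappa> j) u r) * indicator {s..t} r \<partial>lborel) \<le>
       ennreal (u (grid k t + 1 / 2 ^ k) - u (grid k s))"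
      using eventually_ge_at_top[of k]
    proof eventually_elim
      case (elim j)
      have kl: "k \<le> \<kappa> j" using elim seq_suble[OF \<kappa>, of j] by simp
      define i where "i = \<lfloor>2 ^ k * s\<rfloor> * 2 ^ (\<kappa> j - k)"
      define n where "n = nat ((\<lfloor>2 ^ k * t\<rfloor> + 1 - \<lfloor>2 ^ k * s\<rfloor>) * 2 ^ (\<kappa> j - k))"
      have "\<lfloor>2 ^ k * s\<rfloor> \<le> \<lfloor>2 ^ k * t\<rfloor>" using st by (intro floor_mono) simp
      then have "0 \<le> (\<lfloor>2 ^ k * t\<rfloor> + 1 - \<lfloor>2 ^ k * s\<rfloor>) * 2 ^ (\<kappa> j - k)" by simp
      then have "i + int n = (\<lfloor>2 ^ k * t\<rfloor> + 1) * 2 ^ (\<kappa> j - k)" unfolding i_def n_def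
        by (subst int_nat_eq) (simp add: algebra_simps)
      then have "(\<integral>\<^sup>+r. ennreal (diffquot (\<kappa> j) u r) * indicator {grid k s..<grid k t + 1 / 2 ^ k} r \<partial>lborel)
         = ennreal (u (grid k t + 1 / 2 ^ k) - u (grid k s))"
        using diffquot_mono_total[OF mono, of "\<kappa> j" i n] grid_refine(1)[OF kl, of s] grid_refine(2)[OF kl, of t]
        unfolding i_def by simp
      moreover have "(\<integral>\<^sup>+r. ennreal (diffquot (\<kappa> j) u r) * indicator {s..t} r \<partial>lborel) \<le>
         (\<integral>\<^sup>+r. ennreal (diffquot (\<kappa> j) u r) * indicator {grid k s..<grid k t + 1 / 2 ^ k} r \<partial>lborel)"
        using grid_le[of k s] less_grid[of t k]
        by (intro nn_integral_mono mult_left_mono) (auto simp: indicator_def)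
      ultimately show ?case by simp
    qed
    then show ?thesis by (intro tendsto_upperbound[OF conv]) auto
  qed
  have "(\<lambda>k. grid k t + (1/2) ^ k) \<longlonglongrightarrow> t + 0"
    by (intro tendsto_intros grid_tendsto LIMSEQ_power_zero) simp
  then have "(\<lambda>k. ennreal (u (grid k t + 1 / 2 ^ k) - u (grid k s))) \<longlonglongrightarrow> ennreal (u t - u s)"
    by (intro tendsto_ennrealI tendsto_diff) (auto intro!: continuous_on_tendsto_compose[OF cont] grid_tendsto simp: power_one_over)
  then show ?thesis using le by (intro tendsto_lowerbound[where F=sequentially]) auto
qed


lemma set_nn_integral_finite:
  fixes m :: "real \<Rightarrow> real"
  assumes [measurable]: "m \<in> borel_measurable borel" and "(\<integral>\<^sup>+t. ennreal ((m t)\<^sup>2) \<partial>lborel) < \<infinity>"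
  shows "set_integrable lborel {a..b} m"
proof -
  have "(\<integral>\<^sup>+t. ennreal (norm (indicator {a..b} t *\<^sub>R m t)) \<partial>lborel) = (\<integral>\<^sup>+t. ennreal \<bar>m t\<bar> * indicator {a..b} t \<partial>lborel)"
    by (intro nn_integral_cong) (auto simp: indicator_def)
  also have "\<dots> \<le> ennreal 1 * (\<integral>\<^sup>+t. ennreal ((m t)\<^sup>2) \<partial>lborel) + ennreal (1/1) * emeasure lborel {a..b}"
    by (rule nn_integral_abs_indicator_le) auto
  also have "\<dots> < \<infinity>" using assms(2) by (cases "a \<le> b") auto
  finally show ?thesis unfolding set_integrable_def by (intro integrableI_bounded) auto
qed

lemma ennreal_set_integral:
  fixes m :: "real \<Rightarrow> real"
  assumes "set_integrable lborel {a..b} m" "\<And>t. 0 \<le> m t"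
  shows "(\<integral>\<^sup>+t. ennreal (m t) * indicator {a..b} t \<partial>lborel) = ennreal (LINT t:{a..b}|lborel. m t)"
proof -
  have "(\<integral>\<^sup>+t. ennreal (m t) * indicator {a..b} t \<partial>lborel) = (\<integral>\<^sup>+t. ennreal (indicator {a..b} t *\<^sub>R m t) \<partial>lborel)"
    by (intro nn_integral_cong) (auto simp: indicator_def)
  also have "\<dots> = ennreal (LINT t:{a..b}|lborel. m t)"
    unfolding set_lebesgue_integral_def using assms unfolding set_integrable_def
    by (intro nn_integral_eq_integral) auto
  finally show ?thesis .
qed

lemma set_integral_Icc_split:
  fixes m :: "real \<Rightarrow> real"
  assumes m: "\<And>a b. set_integrable lborel {a..b} m" and st: "a \<le> s" "s \<le> t"
  shows "(LINT r:{a..t}|lborel. m r) = (LINT r:{a..s}|lborel. m r) + (LINT r:{s..t}|lborel. m r)"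
proof -
  have 1: "set_integrable lborel {a..<s} m" "set_integrable lborel {s..t} m"
    using m by (auto intro: set_integrable_subset[OF m[of a s]])
  have "{a..t} = {a..<s} \<union> {s..t}" using st by auto
  moreover have "{a..<s} \<inter> {s..t} = {}" by auto
  ultimately have "(LINT r:{a..t}|lborel. m r) = (LINT r:{a..<s}|lborel. m r) + (LINT r:{s..t}|lborel. m r)"
    using set_integral_Un[OF _ 1] by simp
  also have "(LINT r:{a..<s}|lborel. m r) = (LINT r:{a..s}|lborel. m r)"
    by (rule set_integral_cong_set)
       (use m[of a s] 1(1) AE_lborel_singleton[of s] in \<open>auto simp: set_borel_measurable_def set_integrable_def\<close>)
  finally show ?thesis .
qed

lemma Lebesgue_differentiation_local:
  fixes f :: "real \<Rightarrow> real"
  assumes f: "\<And>a b. set_integrable lborel {a..b} f"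
  shows "AE t in lborel. \<forall>e>0. \<exists>d>0. \<forall>a b. a \<le> t \<and> t \<le> b \<and> a < b \<and> b - a < d \<longrightarrow>
           \<bar>(LINT r:{a..b}|lborel. f r) - f t * (b - a)\<bar> \<le> e * (b - a)"
proof -
  let ?g = "\<lambda>n t. indicator {-real n..real n} t *\<^sub>R f t"
  have "integrable lborel (?g n)" for n using f[of "-real n" "real n"] unfolding set_integrable_def .
  then have "AE t in lborel. \<forall>n. \<forall>e>0. \<exists>d>0. \<forall>a b. a \<le> t \<and> t \<le> b \<and> a < b \<and> b - a < d \<longrightarrow>
           \<bar>(LINT r:{a..b}|lborel. ?g n r) - ?g n t * (b - a)\<bar> \<le> e * (b - a)"
    unfolding AE_all_countable by (intro allI Lebesgue_differentiation)
  then show ?thesis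
  proof eventually_elim
    case (elim t)
    show ?case
    proof (intro allI impI)
      fix e :: real assume "e > 0"
      obtain n where n: "\<bar>t\<bar> + 1 \<le> real n" using real_arch_simple by blast
      obtain d where d: "d > 0" "\<And>a b. a \<le> t \<and> t \<le> b \<and> a < b \<and> b - a < d \<Longrightarrow>
           \<bar>(LINT r:{a..b}|lborel. ?g n r) - ?g n t * (b - a)\<bar> \<le> e * (b - a)"
        using elim[rule_format, of e n] \<open>e > 0\<close> by blast
      show "\<exists>d>0. \<forall>a b. a \<le> t \<and> t \<le> b \<and> a < b \<and> b - a < d \<longrightarrow>
           \<bar>(LINT r:{a..b}|lborel. f r) - f t * (b - a)\<bar> \<le> e * (b - a)"
      proof (intro exI[of _ "min d 1"] conjI allI impI)
        fix a b assume ab: "a \<le> t \<and> t \<le> b \<and> a < b \<and> b - a < min d 1"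
        have eq1: "(LINT r:{a..b}|lborel. ?g n r) = (LINT r:{a..b}|lborel. f r)"
          by (rule set_lebesgue_integral_cong) (use ab n in \<open>auto simp: indicator_def\<close>)
        have eq2: "?g n t = f t" using n by (auto simp: indicator_def)
        show "\<bar>(LINT r:{a..b}|lborel. f r) - f t * (b - a)\<bar> \<le> e * (b - a)"
          using d(2)[of a b] ab unfolding eq1 eq2 by simp
      qed (use d(1) in simp)
    qed
  qed
qed

text \<open>Here \<open>m\<close> is only an upper bound for the speed, not the metric derivative.
  The curve lives on the whole line and the bound is globally square integrable; curves on an
  interval are brought to this form by freezing them outside it.\<close>

definition has_speed :: "(real \<Rightarrow> 'a::metric_space) \<Rightarrow> (real \<Rightarrow> real) \<Rightarrow> bool" where
  "has_speed u m \<longleftrightarrow> m \<in> borel_measurable borel \<and> (\<forall>t. 0 \<le> m t) \<and>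
     (\<integral>\<^sup>+t. ennreal ((m t)\<^sup>2) \<partial>lborel) < \<infinity> \<and>
     (\<forall>s t. s \<le> t \<longrightarrow> ennreal (dist (u s) (u t)) \<le> (\<integral>\<^sup>+r. ennreal (m r) * indicator {s..t} r \<partial>lborel))"

lemma has_speedD:
  assumes "has_speed u m"
  shows "m \<in> borel_measurable borel" "\<And>t. 0 \<le> m t" "(\<integral>\<^sup>+t. ennreal ((m t)\<^sup>2) \<partial>lborel) < \<infinity>"
    "\<And>s t. s \<le> t \<Longrightarrow> ennreal (dist (u s) (u t)) \<le> (\<integral>\<^sup>+r. ennreal (m r) * indicator {s..t} r \<partial>lborel)"
    "\<And>a b. set_integrable lborel {a..b} m"
    "\<And>s t. s \<le> t \<Longrightarrow> dist (u s) (u t) \<le> (LINT r:{s..t}|lborel. m r)"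
proof -
  show 1: "m \<in> borel_measurable borel" "\<And>t. 0 \<le> m t" "(\<integral>\<^sup>+t. ennreal ((m t)\<^sup>2) \<partial>lborel) < \<infinity>"
    "\<And>s t. s \<le> t \<Longrightarrow> ennreal (dist (u s) (u t)) \<le> (\<integral>\<^sup>+r. ennreal (m r) * indicator {s..t} r \<partial>lborel)"
    using assms unfolding has_speed_def by auto
  show 2: "\<And>a b. set_integrable lborel {a..b} m" by (rule set_nn_integral_finite[OF 1(1,3)])
  fix s t :: real assume "s \<le> t"
  then have "ennreal (dist (u s) (u t)) \<le> ennreal (LINT r:{s..t}|lborel. m r)"
    using 1(4)[of s t] ennreal_set_integral[OF 2 1(2)] by simp
  moreover have "0 \<le> (LINT r:{s..t}|lborel. m r)"
    unfolding set_lebesgue_integral_def using 1(2) by (intro integral_nonneg_AE) auto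
  ultimately show "dist (u s) (u t) \<le> (LINT r:{s..t}|lborel. m r)" by simp
qed

lemma has_speed_dist_sq:
  assumes u: "has_speed u m" and st: "s \<le> t"
  shows "ennreal ((dist (u s) (u t))\<^sup>2) \<le> ennreal (t - s) * (\<integral>\<^sup>+r. ennreal ((m r)\<^sup>2) * indicator {s..t} r \<partial>lborel)"
proof -
  note [measurable] = has_speedD(1)[OF u]
  have "(ennreal (dist (u s) (u t)))\<^sup>2 \<le> (\<integral>\<^sup>+r. ennreal (m r) * indicator {s..t} r \<partial>lborel)\<^sup>2"
    using has_speedD(4)[OF u st] by (rule power_mono) simp
  also have "\<dots> \<le> (\<integral>\<^sup>+r. (ennreal (m r))\<^sup>2 * indicator {s..t} r \<partial>lborel) * emeasure lborel {s..t}"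
    by (rule nn_integral_Cauchy_Schwarz_indicator) auto
  finally show ?thesis using st has_speedD(2)[OF u] by (simp add: ennreal_power mult.commute)
qed

lemma has_speed_continuous:
  assumes u: "has_speed u m"
  shows "continuous_on UNIV u"
proof -
  define L where "L = enn2real (\<integral>\<^sup>+t. ennreal ((m t)\<^sup>2) \<partial>lborel)"
  have L: "ennreal L = (\<integral>\<^sup>+t. ennreal ((m t)\<^sup>2) \<partial>lborel)" "0 \<le> L"
    using has_speedD(3)[OF u] by (auto simp: L_def)
  have sq: "(dist (u s) (u t))\<^sup>2 \<le> \<bar>t - s\<bar> * L" for s t
  proof -
    have "(dist (u s) (u t))\<^sup>2 \<le> (t - s) * L" if "s \<le> t" for s t
    proof -
      have "ennreal ((dist (u s) (u t))\<^sup>2) \<le> ennreal (t - s) * (\<integral>\<^sup>+r. ennreal ((m r)\<^sup>2) * indicator {s..t} r \<partial>lborel)"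
        by (rule has_speed_dist_sq[OF u that])
      also have "\<dots> \<le> ennreal (t - s) * ennreal L" unfolding L
        by (intro mult_left_mono nn_integral_mono) (auto simp: indicator_def)
      finally show ?thesis using that L(2) by (simp flip: ennreal_mult)
    qed
    from this[of s t] this[of t s] show ?thesis by (cases "s \<le> t") (auto simp: dist_commute)
  qed
  show ?thesis
  proof (rule continuous_at_imp_continuous_on, intro ballI)
    fix t
    have "((\<lambda>s. sqrt (\<bar>t - s\<bar> * L)) \<longlongrightarrow> sqrt (\<bar>t - t\<bar> * L)) (at t)" by (intro tendsto_intros)
    then have lim: "((\<lambda>s. sqrt (\<bar>t - s\<bar> * L)) \<longlongrightarrow> 0) (at t)" by simp
    have "dist (u s) (u t) \<le> sqrt (\<bar>t - s\<bar> * L)" for s by (rule real_le_rsqrt[OF sq])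
    then have "((\<lambda>s. dist (u s) (u t)) \<longlongrightarrow> 0) (at t)"
      by (intro tendsto_sandwich[OF _ _ tendsto_const lim]) (simp_all add: always_eventually)
    then show "isCont u t" unfolding isCont_def by (rule iffD2[OF tendsto_dist_iff])
  qed
qed

lemma has_speed_dq_sq: "has_speed u m \<Longrightarrow> dq_sq u k \<le> (\<integral>\<^sup>+t. ennreal ((m t)\<^sup>2) \<partial>lborel)"
  using diffquot_square_le[of "\<lambda>t. ennreal (m t)" u k] has_speedD[of u m]
  by (simp add: dq_sq_def ennreal_power)

text \<open>The converse of \<open>has_speed_dq_sq\<close>. Finite kinetic energy of a continuous
  curve is thus expressed by distances between dyadic points alone, and distances behave well under
  convergence in \<open>\<sigma>\<close>; the lower semicontinuity of the kinetic energy rests on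
  this.\<close>

lemma has_speedI_dq_sq:
  assumes cont: "continuous_on UNIV u" and bound: "\<And>k. dq_sq u k \<le> \<Lambda>" and fin: "\<Lambda> < \<infinity>"
  obtains m where "has_speed u m" "(\<integral>\<^sup>+t. ennreal ((m t)\<^sup>2) \<partial>lborel) \<le> \<Lambda>"
proof -
  obtain \<kappa> m where m: "strict_mono \<kappa>" "m \<in> borel_measurable borel" "\<And>t. 0 \<le> m t"
    "(\<integral>\<^sup>+t. ennreal ((m t)\<^sup>2) \<partial>lborel) \<le> \<Lambda>"
    "\<And>a b. (\<lambda>j. \<integral>\<^sup>+t. ennreal (diffquot (\<kappa> j) u t) * indicator {a..b} t \<partial>lborel)
        \<longlonglongrightarrow> (\<integral>\<^sup>+t. ennreal (m t) * indicator {a..b} t \<partial>lborel)"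
    using dq_limit[OF bound fin] by blast
  have fin': "(\<integral>\<^sup>+t. ennreal ((m t)\<^sup>2) \<partial>lborel) < \<infinity>" using m(4) fin by (rule le_less_trans)
  have "has_speed u m" unfolding has_speed_def
    using m(2,3) fin' dist_le_density[OF cont m(1-3) fin' m(5)] by blast
  then show ?thesis using m(4) that by blast
qed

text \<open>The density of \<open>f\<close> is read off the one of the monotone function \<open>f + \<integral> m\<close>, for which the
  inequality between increments and integrals is an equality.\<close>

lemma has_speed_real_density:
  fixes f :: "real \<Rightarrow> real"
  assumes f: "has_speed f m" and mi: "integrable lborel m"
  obtains h where "h \<in> borel_measurable borel" "\<And>a b. set_integrable lborel {a..b} h"
    "\<And>s t. s \<le> t \<Longrightarrow> f t - f s = (LINT r:{s..t}|lborel. h r)"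
proof -
  note [measurable] = has_speedD(1)[OF f]
  define P where "P t = (LINT r:{..t}|lborel. m r)" for t
  have mset: "set_integrable lborel {..t} m" "set_integrable lborel {..<t} m" "set_integrable lborel {s..t} m" for s t
    unfolding set_integrable_def by (intro integrable_mult_indicator[OF _ mi]; simp)+
  have P: "P t - P s = (LINT r:{s..t}|lborel. m r)" if "s \<le> t" for s t
  proof -
    have "{..t} = {..<s} \<union> {s..t}" "{..<s} \<inter> {s..t} = {}" using that by auto
    then have "P t = (LINT r:{..<s}|lborel. m r) + (LINT r:{s..t}|lborel. m r)"
      unfolding P_def using set_integral_Un[OF _ mset(2) mset(3)[of s t], of s] by simp
    also have "(LINT r:{..<s}|lborel. m r) = P s" unfolding P_def
      by (rule set_integral_cong_set)
         (use AE_lborel_singleton[of s] in \<open>auto simp: set_borel_measurable_def\<close>)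
    finally show ?thesis by simp
  qed
  \<comment> \<open>Increments of \<open>f\<close> are at most those of \<open>P\<close> in absolute
    value, so those of \<open>G\<close> lie between zero and twice those of \<open>P\<close>: the
    function is monotone and inherits a speed bound.\<close>
  define G where "G t = f t + P t" for t
  have inc: "\<bar>f t - f s\<bar> \<le> P t - P s" if "s \<le> t" for s t
    using has_speedD(6)[OF f that] P[OF that] by (simp add: dist_real_def abs_minus_commute)
  have Gmono: "mono G" unfolding mono_def G_def using inc by (smt (verit))
  have "has_speed G (\<lambda>t. 2 * m t)" unfolding has_speed_def
  proof (intro conjI allI impI)
    have "(\<integral>\<^sup>+t. ennreal ((2 * m t)\<^sup>2) \<partial>lborel) = (\<integral>\<^sup>+t. ennreal 4 * ennreal ((m t)\<^sup>2) \<partial>lborel)"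
      by (intro nn_integral_cong) (simp add: power_mult_distrib ennreal_mult')
    also have "\<dots> < \<infinity>" using has_speedD(3)[OF f] by (simp add: nn_integral_cmult ennreal_mult_less_top)
    finally show "(\<integral>\<^sup>+t. ennreal ((2 * m t)\<^sup>2) \<partial>lborel) < \<infinity>" .
    fix s t :: real assume st: "s \<le> t"
    have "ennreal (dist (G s) (G t)) \<le> ennreal (2 * (P t - P s))"
      using inc[OF st] by (intro ennreal_leI) (simp add: dist_real_def G_def)
    also have "\<dots> = ennreal 2 * (\<integral>\<^sup>+r. ennreal (m r) * indicator {s..t} r \<partial>lborel)"
      unfolding P[OF st] ennreal_set_integral[OF has_speedD(5)[OF f] has_speedD(2)[OF f]]
      by (rule ennreal_mult') simp
    also have "\<dots> = (\<integral>\<^sup>+r. ennreal (2 * m r) * indicator {s..t} r \<partial>lborel)"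
      by (subst nn_integral_cmult[symmetric]) (auto simp: ennreal_mult' mult.assoc)
    finally show "ennreal (dist (G s) (G t)) \<le> (\<integral>\<^sup>+r. ennreal (2 * m r) * indicator {s..t} r \<partial>lborel)" .
  qed (use has_speedD(2)[OF f] in auto)
  note G = this
  have Gc: "continuous_on UNIV G" by (rule has_speed_continuous[OF G])
  obtain \<kappa> p where p: "strict_mono \<kappa>" "p \<in> borel_measurable borel" "\<And>t. 0 \<le> p t"
    "(\<integral>\<^sup>+t. ennreal ((p t)\<^sup>2) \<partial>lborel) \<le> (\<integral>\<^sup>+t. ennreal ((2 * m t)\<^sup>2) \<partial>lborel)"
    "\<And>a b. (\<lambda>j. \<integral>\<^sup>+t. ennreal (diffquot (\<kappa> j) G t) * indicator {a..b} t \<partial>lborel)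
        \<longlonglongrightarrow> (\<integral>\<^sup>+t. ennreal (p t) * indicator {a..b} t \<partial>lborel)"
    using dq_limit[OF has_speed_dq_sq[OF G] has_speedD(3)[OF G]] by blast
  have pfin: "(\<integral>\<^sup>+t. ennreal ((p t)\<^sup>2) \<partial>lborel) < \<infinity>"
    using p(4) has_speedD(3)[OF G] by (rule le_less_trans)
  have pset: "set_integrable lborel {a..b} p" for a b by (rule set_nn_integral_finite[OF p(2) pfin])
  have pG: "(LINT r:{s..t}|lborel. p r) = G t - G s" if "s \<le> t" for s t
  proof -
    have G0: "0 \<le> G t - G s" using Gmono that by (simp add: monoD)
    have p0: "0 \<le> (LINT r:{s..t}|lborel. p r)"
      unfolding set_lebesgue_integral_def using p(3) by (intro integral_nonneg_AE) auto
    have "ennreal (LINT r:{s..t}|lborel. p r) \<le> ennreal (G t - G s)"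
      using mono_density_le[OF Gc p(1) Gmono p(5) that] unfolding ennreal_set_integral[OF pset p(3)] .
    moreover have "ennreal (dist (G s) (G t)) \<le> ennreal (LINT r:{s..t}|lborel. p r)"
      using dist_le_density[OF Gc p(1-3) pfin p(5) that] unfolding ennreal_set_integral[OF pset p(3)] .
    ultimately show ?thesis using G0 p0 by (simp add: dist_real_def)
  qed
  show ?thesis
  proof (rule that[of "\<lambda>t. p t - m t"])
    show "(\<lambda>t. p t - m t) \<in> borel_measurable borel" using p(2) by measurable
    show "set_integrable lborel {a..b} (\<lambda>t. p t - m t)" for a b
      by (rule set_integral_diff(1)[OF pset mset(3)])
    show "f t - f s = (LINT r:{s..t}|lborel. p r - m r)" if "s \<le> t" for s t
      unfolding set_integral_diff(2)[OF pset mset(3)] pG[OF that] P[OF that, symmetric] by (simp add: G_def)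
  qed
qed




text \<open>The speed is the supremum of the absolute derivatives of the real functions
  \<open>dist (u t) (u y)\<close>. Taking \<open>y\<close> rational keeps the supremum countable,
  and by continuity the points \<open>u y\<close> are dense in the range of the curve, so that the
  space itself need not be separable.\<close>

theorem has_speed_derivative:
  fixes u :: "real \<Rightarrow> 'a::metric_space"
  assumes u: "has_speed u m" and mi: "integrable lborel m"
  obtains M where "has_speed u M" "\<And>t. M t \<le> m t"
    "AE t in lborel. ((\<lambda>s. dist (u s) (u t) / \<bar>t - s\<bar>) \<longlongrightarrow> M t) (at t)"
proof -
  note mD = has_speedD[OF u]
  note [measurable] = mD(1)
  define f where "f y t = dist (u t) (u y)" for y t
  have f_le: "dist (f y s) (f y t) \<le> dist (u s) (u t)" for y s t
    unfolding f_def dist_real_def using abs_dist_diff_le[of "u s" "u y" "u t"] by (simp add: dist_commute)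
  have fs: "has_speed (f y) m" for y
    unfolding has_speed_def using mD(1,2,3) mD(4) f_le[of y] by (meson ennreal_leI order_trans)
  have "\<forall>y. \<exists>h. h \<in> borel_measurable borel \<and> (\<forall>a b. set_integrable lborel {a..b} h) \<and>
    (\<forall>s t. s \<le> t \<longrightarrow> f y t - f y s = (LINT r:{s..t}|lborel. h r))"
    using has_speed_real_density[OF fs mi] by metis
  then obtain h where h[measurable]: "\<And>y. h y \<in> borel_measurable borel"
    and hint: "\<And>y a b. set_integrable lborel {a..b} (h y)"
    and hf: "\<And>y s t. s \<le> t \<Longrightarrow> f y t - f y s = (LINT r:{s..t}|lborel. h y r)"
    by metis
  \<comment> \<open>The cut at \<open>m t\<close> keeps the supremum finite at every
    \<open>t\<close>. By \<open>h_le\<close> it has no effect at common Lebesgue points, hence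
    almost everywhere.\<close>
  define hc where "hc y t = min (m t) \<bar>h y t\<bar>" for y t
  define M where "M t = (SUP y\<in>\<rat>. hc y t)" for t
  have bdd: "bdd_above ((\<lambda>y. hc y t) ` \<rat>)" for t
    by (rule bdd_aboveI2[where M="m t"]) (simp add: hc_def)
  have hcM: "hc y t \<le> M t" if "y \<in> \<rat>" for y t
    unfolding M_def using that by (intro cSUP_upper bdd)
  have Mm: "M t \<le> m t" for t
    unfolding M_def by (rule cSUP_least) (auto simp: hc_def intro: Rats_0)
  have M0: "0 \<le> M t" for t
    using hcM[OF Rats_0, of t] mD(2)[of t] by (auto simp: hc_def)
  have Mmeas[measurable]: "M \<in> borel_measurable borel"
    unfolding M_def[abs_def] by (rule borel_measurable_cSUP) (auto simp: countable_rat hc_def bdd[unfolded hc_def])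
  have Msq: "(\<integral>\<^sup>+t. ennreal ((M t)\<^sup>2) \<partial>lborel) < \<infinity>"
    by (rule le_less_trans[OF nn_integral_mono mD(3)]) (simp add: ennreal_leI power_mono Mm M0)
  have Mint: "set_integrable lborel {a..b} M" for a b by (rule set_nn_integral_finite[OF Mmeas Msq])
  define leb where "leb g t \<longleftrightarrow> (\<forall>e>0. \<exists>d>0. \<forall>a b. a \<le> t \<and> t \<le> b \<and> a < b \<and> b - a < d \<longrightarrow>
           \<bar>(LINT r:{a..b}|lborel. g r) - g t * (b - a)\<bar> \<le> e * (b - a))" for g :: "real \<Rightarrow> real" and t
  have lebE: thesis if "leb g t" "0 < e" and "\<And>d. d > 0 \<Longrightarrow> (\<And>a b. a \<le> t \<and> t \<le> b \<and> a < b \<and> b - a < d \<Longrightarrow>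
           \<bar>(LINT r:{a..b}|lborel. g r) - g t * (b - a)\<bar> \<le> e * (b - a)) \<Longrightarrow> thesis" for g t e thesis
    using that unfolding leb_def by blast
  have leb: "AE t in lborel. leb g t" if "\<And>a b. set_integrable lborel {a..b} g" for g
    unfolding leb_def by (rule Lebesgue_differentiation_local[OF that])
  have h_le: "\<bar>h y t\<bar> \<le> m t" if l1: "leb m t" and l2: "leb (h y) t" for y t
  proof (rule field_le_epsilon)
    fix e :: real assume e: "e > 0"
    obtain d1 where d1: "d1 > 0" "\<And>a b. a \<le> t \<and> t \<le> b \<and> a < b \<and> b - a < d1 \<Longrightarrow>
           \<bar>(LINT r:{a..b}|lborel. m r) - m t * (b - a)\<bar> \<le> (e/2) * (b - a)"
      by (rule lebE[OF l1 half_gt_zero[OF e]]) (rule that; blast)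
    obtain d2 where d2: "d2 > 0" "\<And>a b. a \<le> t \<and> t \<le> b \<and> a < b \<and> b - a < d2 \<Longrightarrow>
           \<bar>(LINT r:{a..b}|lborel. h y r) - h y t * (b - a)\<bar> \<le> (e/2) * (b - a)"
      by (rule lebE[OF l2 half_gt_zero[OF e]]) (rule that; blast)
    define \<delta> where "\<delta> = min d1 d2 / 2"
    have \<delta>: "\<delta> > 0" "\<delta> < d1" "\<delta> < d2" using d1(1) d2(1) by (auto simp: \<delta>_def)
    have 1: "\<bar>(LINT r:{t..t+\<delta>}|lborel. m r) - m t * \<delta>\<bar> \<le> (e/2) * \<delta>" using d1(2)[of t "t+\<delta>"] \<delta> by simp
    have 2: "\<bar>(LINT r:{t..t+\<delta>}|lborel. h y r) - h y t * \<delta>\<bar> \<le> (e/2) * \<delta>" using d2(2)[of t "t+\<delta>"] \<delta> by simp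
    have 3: "\<bar>LINT r:{t..t+\<delta>}|lborel. h y r\<bar> \<le> (LINT r:{t..t+\<delta>}|lborel. m r)"
      using has_speedD(6)[OF fs, of t "t+\<delta>" y] hf[of t "t+\<delta>" y] \<delta>(1) by (simp add: dist_real_def abs_minus_commute)
    have "\<bar>h y t\<bar> * \<delta> = \<bar>h y t * \<delta>\<bar>" using \<delta>(1) by (simp add: abs_mult)
    also have "\<dots> \<le> (LINT r:{t..t+\<delta>}|lborel. m r) + (e/2) * \<delta>" using 2 3 by linarith
    also have "\<dots> \<le> m t * \<delta> + (e/2) * \<delta> + (e/2) * \<delta>" using 1 by linarith
    also have "\<dots> = (m t + e) * \<delta>" by (simp add: algebra_simps)
    finally show "\<bar>h y t\<bar> \<le> m t + e" using \<delta>(1) by simp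
  qed
  have ae: "AE t in lborel. leb m t \<and> leb M t \<and> (\<forall>y\<in>\<rat>. leb (h y) t)"
  proof -
    have "AE t in lborel. \<forall>y\<in>\<rat>. leb (h y) t"
      unfolding AE_ball_countable[OF countable_rat] by (intro ballI leb hint)
    then show ?thesis using leb[OF mD(5)] leb[OF Mint] by eventually_elim blast
  qed
  have ae_h: "AE t in lborel. \<forall>y\<in>\<rat>. \<bar>h y t\<bar> \<le> M t"
    using ae
  proof eventually_elim
    case (elim t)
    then show ?case using h_le hcM by (auto simp: hc_def) (metis min.absorb2)
  qed
  have dist_le: "ennreal (dist (u s) (u t)) \<le> (\<integral>\<^sup>+r. ennreal (M r) * indicator {s..t} r \<partial>lborel)" if "s \<le> t" for s t
  proof -
    have fle: "\<bar>f y t - f y s\<bar> \<le> (LINT r:{s..t}|lborel. M r)" if "y \<in> \<rat>" for y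
    proof -
      have "\<bar>f y t - f y s\<bar> = \<bar>LINT r:{s..t}|lborel. h y r\<bar>" using hf[OF \<open>s \<le> t\<close>] by simp
      also have "\<dots> \<le> (LINT r:{s..t}|lborel. \<bar>h y r\<bar>)"
        unfolding set_lebesgue_integral_def by (rule order_trans[OF integral_abs_bound]) (simp add: abs_mult)
      also have "\<dots> \<le> (LINT r:{s..t}|lborel. M r)"
        by (intro set_integral_mono_AE set_integrable_abs hint Mint) (use ae_h that in auto)
      finally show ?thesis .
    qed
    have "dist (u s) (u t) \<le> (LINT r:{s..t}|lborel. M r)"
    proof (rule field_le_epsilon)
      fix e :: real assume "e > 0"
      have "isCont u s" using has_speed_continuous[OF u] by (simp add: continuous_on_eq_continuous_at)
      then obtain d where d: "d > 0" "\<And>y. dist y s < d \<Longrightarrow> dist (u y) (u s) < e/2"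
        unfolding continuous_at_eps_delta using \<open>e > 0\<close> by (metis half_gt_zero)
      \<comment> \<open>For \<open>u y\<close> close to \<open>u s\<close> the increment of the
        distance to \<open>u y\<close> between \<open>s\<close> and \<open>t\<close> is almost the
        full distance from \<open>u s\<close> to \<open>u t\<close>, up to twice the error.\<close>
      obtain y where y: "y \<in> \<rat>" "s < y" "y < s + d" using Rats_dense_in_real[of s "s + d"] d(1) by auto
      have "dist (u y) (u s) < e/2" using y by (intro d(2)) (simp add: dist_real_def)
      moreover have "dist (u s) (u t) \<le> \<bar>f y t - f y s\<bar> + 2 * dist (u y) (u s)"
        unfolding f_def by (smt (verit) dist_commute dist_triangle)
      ultimately show "dist (u s) (u t) \<le> (LINT r:{s..t}|lborel. M r) + e" using fle[OF y(1)] by linarith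
    qed
    then show ?thesis unfolding ennreal_set_integral[OF Mint M0] by (rule ennreal_leI)
  qed
  have sM: "has_speed u M" unfolding has_speed_def using Mmeas M0 Msq dist_le by blast
  have "AE t in lborel. ((\<lambda>s. dist (u s) (u t) / \<bar>t - s\<bar>) \<longlongrightarrow> M t) (at t)"
    using ae
  proof eventually_elim
    case (elim t)
    show ?case
    proof (rule tendstoI)
      fix e :: real assume e: "e > 0"
      obtain y where y: "y \<in> \<rat>" "hc y t > M t - e/2"
        using less_cSUP_iff[of \<rat> "\<lambda>y. hc y t" "M t - e/2"] bdd[of t] e unfolding M_def
        by (metis (no_types, lifting) Rats_0 diff_less_eq empty_iff half_gt_zero less_add_same_cancel1)
      have e4: "0 < e/4" using e by simp
      have lM: "leb M t" using elim by blast
      obtain d1 where d1: "d1 > 0" "\<And>a b. a \<le> t \<and> t \<le> b \<and> a < b \<and> b - a < d1 \<Longrightarrow>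
           \<bar>(LINT r:{a..b}|lborel. M r) - M t * (b - a)\<bar> \<le> (e/4) * (b - a)"
        by (rule lebE[OF lM e4]) (rule that; blast)
      have lh: "leb (h y) t" using elim y(1) by blast
      obtain d2 where d2: "d2 > 0" "\<And>a b. a \<le> t \<and> t \<le> b \<and> a < b \<and> b - a < d2 \<Longrightarrow>
           \<bar>(LINT r:{a..b}|lborel. h y r) - h y t * (b - a)\<bar> \<le> (e/4) * (b - a)"
        by (rule lebE[OF lh e4]) (rule that; blast)
      \<comment> \<open>The upper bound uses that \<open>t\<close> is a Lebesgue point of
        \<open>M\<close>. The lower bound uses the same for \<open>h y\<close>, where
        \<open>y\<close> almost attains the supremum: increments of the distance to
        \<open>u y\<close> never exceed those of the curve.\<close>
      have near: "dist (dist (u s) (u t) / \<bar>t - s\<bar>) (M t) < e" if s: "s \<noteq> t" "dist s t < min d1 d2" for s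
      proof -
        define a b where "a = min s t" and "b = max s t"
        have ab: "a \<le> t \<and> t \<le> b \<and> a < b \<and> b - a < d1" "a \<le> t \<and> t \<le> b \<and> a < b \<and> b - a < d2" "b - a = \<bar>t - s\<bar>"
          using s by (auto simp: a_def b_def dist_real_def)
        have ba: "0 < b - a" using ab(1) by linarith
        have D: "dist (u s) (u t) = dist (u a) (u b)" by (auto simp: a_def b_def min_def max_def dist_commute)
        have "dist (u a) (u b) \<le> (LINT r:{a..b}|lborel. M r)" using has_speedD(6)[OF sM, of a b] ab by simp
        also have "\<dots> \<le> M t * (b - a) + e/4 * (b - a)" using d1(2)[OF ab(1)] by linarith
        also have "\<dots> = (M t + e/4) * (b - a)" by (simp add: algebra_simps)
        finally have up: "dist (u a) (u b) / (b - a) \<le> M t + e/4" using ba by (simp only: pos_divide_le_eq)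
        have "(M t - 3*e/4) * (b - a) \<le> (\<bar>h y t\<bar> - e/4) * (b - a)"
          using y(2) ab by (intro mult_right_mono) (auto simp: hc_def)
        also have "\<dots> = \<bar>h y t * (b - a)\<bar> - e/4 * (b - a)" using ab by (simp add: abs_mult algebra_simps)
        also have "\<dots> \<le> \<bar>LINT r:{a..b}|lborel. h y r\<bar>" using d2(2)[OF ab(2)] by linarith
        also have "\<dots> = dist (f y a) (f y b)" using hf[of a b y] ab by (simp add: dist_real_def abs_minus_commute)
        also have "\<dots> \<le> dist (u a) (u b)" by (rule f_le)
        finally have lo: "M t - 3*e/4 \<le> dist (u a) (u b) / (b - a)" using ba by (simp only: pos_le_divide_eq)
        have "\<bar>dist (u a) (u b) / (b - a) - M t\<bar> < e" using up lo e by (simp add: abs_less_iff)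
        then show ?thesis unfolding D dist_real_def ab(3) .
      qed
      show "\<forall>\<^sub>F s in at t. dist (dist (u s) (u t) / \<bar>t - s\<bar>) (M t) < e"
        unfolding eventually_at using near d1(1) d2(1) by (intro exI[of _ "min d1 d2"]) auto
    qed
  qed
  then show ?thesis using that sM Mm by blast
qed


text \<open>In contrast to \<open>has_speed\<close>, the function \<open>M\<close> is the metric
  derivative itself almost everywhere on the half-line, and its square is integrable on bounded
  intervals only, which is what \<open>AC_loc\<close> provides.\<close>

definition metric_speed :: "(real \<Rightarrow> 'a::metric_space) \<Rightarrow> (real \<Rightarrow> real) \<Rightarrow> bool" where
  "metric_speed u M \<longleftrightarrow> M \<in> borel_measurable borel \<and> (\<forall>t. 0 \<le> M t) \<and>
     (\<forall>T. (\<integral>\<^sup>+t. ennreal ((M t)\<^sup>2) * indicator {0..T} t \<partial>lborel) < \<infinity>) \<and>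
     (\<forall>s t. 0 \<le> s \<longrightarrow> s \<le> t \<longrightarrow> ennreal (dist (u s) (u t)) \<le> (\<integral>\<^sup>+r. ennreal (M r) * indicator {s..t} r \<partial>lborel)) \<and>
     (AE t in lborel. 0 < t \<longrightarrow> ((\<lambda>s. dist (u s) (u t) / \<bar>t - s\<bar>) \<longlongrightarrow> M t) (at t))"

lemma ennreal_set_integral_le:
  fixes m :: "real \<Rightarrow> real"
  assumes [measurable]: "(\<lambda>t. indicator I t *\<^sub>R m t) \<in> borel_measurable borel" and "{s..t} \<subseteq> I"
  shows "ennreal (LINT r:{s..t}|lborel. m r) \<le> (\<integral>\<^sup>+r. ennreal \<bar>indicator I r *\<^sub>R m r\<bar> * indicator {s..t} r \<partial>lborel)"
proof -
  have eq: "(LINT r:{s..t}|lborel. m r) = (\<integral>r. indicator {s..t} r *\<^sub>R (indicator I r *\<^sub>R m r) \<partial>lborel)"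
    unfolding set_lebesgue_integral_def using assms(2)
    by (intro Bochner_Integration.integral_cong) (auto simp: indicator_def)
  have "ennreal (LINT r:{s..t}|lborel. m r) \<le> ennreal (norm (\<integral>r. indicator {s..t} r *\<^sub>R (indicator I r *\<^sub>R m r) \<partial>lborel))"
    unfolding eq by (intro ennreal_leI) simp
  also have "\<dots> \<le> (\<integral>\<^sup>+r. ennreal (norm (indicator {s..t} r *\<^sub>R (indicator I r *\<^sub>R m r))) \<partial>lborel)"
  proof (cases "integrable lborel (\<lambda>r. indicator {s..t} r *\<^sub>R (indicator I r *\<^sub>R m r))")
    case True
    then show ?thesis by (rule integral_norm_bound_ennreal)
  qed (simp add: not_integrable_integral_eq)
  also have "\<dots> = (\<integral>\<^sup>+r. ennreal \<bar>indicator I r *\<^sub>R m r\<bar> * indicator {s..t} r \<partial>lborel)"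
    by (intro nn_integral_cong) (auto simp: indicator_def)
  finally show ?thesis .
qed

text \<open>Clamping the time to \<open>{0..N}\<close> freezes the curve outside and yields a curve
  on the whole line whose speed bound vanishes there, hence is integrable as well as square
  integrable.\<close>

lemma AC_has_speed:
  fixes u :: "real \<Rightarrow> 'a::metric_space"
  assumes "AC 2 {0..N} u" and N: "0 \<le> N"
  obtains m where "has_speed (\<lambda>t. u (max 0 (min t N))) m" "integrable lborel m"
proof -
  obtain m0 where m0: "Lp_on 2 {0..N} m0"
    "\<And>s t. s \<in> {0..N} \<Longrightarrow> t \<in> {0..N} \<Longrightarrow> s \<le> t \<Longrightarrow> dist (u s) (u t) \<le> (LINT r:{s..t}|lborel. m0 r)"
    using assms unfolding AC_def by metis
  define m where "m t = \<bar>indicator {0..N} t *\<^sub>R m0 t\<bar>" for t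
  have m0m[measurable]: "(\<lambda>t. indicator {0..N} t *\<^sub>R m0 t) \<in> borel_measurable borel"
    using m0(1) unfolding Lp_on_def set_borel_measurable_def by simp
  have mm[measurable]: "m \<in> borel_measurable borel" unfolding m_def[abs_def] by measurable
  have sq: "(\<integral>\<^sup>+t. ennreal ((m t)\<^sup>2) \<partial>lborel) < \<infinity>"
  proof -
    have "integrable lborel (\<lambda>t. indicator {0..N} t *\<^sub>R \<bar>m0 t\<bar> powr 2)"
      using m0(1) unfolding Lp_on_def set_integrable_def by simp
    then have "(\<integral>\<^sup>+t. ennreal (norm (indicator {0..N} t *\<^sub>R \<bar>m0 t\<bar> powr 2)) \<partial>lborel) < \<infinity>"
      by (simp add: integrable_iff_bounded)
    also have "(\<lambda>t. norm (indicator {0..N} t *\<^sub>R \<bar>m0 t\<bar> powr 2)) = (\<lambda>t. (m t)\<^sup>2)"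
      by (auto simp: m_def indicator_def fun_eq_iff powr_numeral)
    finally show ?thesis .
  qed
  have mset: "set_integrable lborel {0..N} m" by (rule set_nn_integral_finite[OF mm sq])
  have "(\<lambda>t. indicator {0..N} t *\<^sub>R m t) = m" by (auto simp: m_def indicator_def)
  then have mi: "integrable lborel m" using mset unfolding set_integrable_def by simp
  have "has_speed (\<lambda>t. u (max 0 (min t N))) m" unfolding has_speed_def
  proof (intro conjI allI impI mm sq)
    show "0 \<le> m t" for t by (simp add: m_def)
    fix s t :: real assume st: "s \<le> t"
    define s' t' where "s' = max 0 (min s N)" and "t' = max 0 (min t N)"
    have in': "s' \<in> {0..N}" "t' \<in> {0..N}" "s' \<le> t'" using st N by (auto simp: s'_def t'_def)
    show "ennreal (dist (u (max 0 (min s N))) (u (max 0 (min t N)))) \<le> (\<integral>\<^sup>+r. ennreal (m r) * indicator {s..t} r \<partial>lborel)"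
    proof (cases "s' = t'")
      case False
      then have sub: "{s'..t'} \<subseteq> {s..t}" using st N by (auto simp: s'_def t'_def min_def max_def split: if_splits)
      have "ennreal (dist (u s') (u t')) \<le> ennreal (LINT r:{s'..t'}|lborel. m0 r)"
        by (intro ennreal_leI m0(2) in')
      also have "\<dots> \<le> (\<integral>\<^sup>+r. ennreal (m r) * indicator {s'..t'} r \<partial>lborel)"
        unfolding m_def by (rule ennreal_set_integral_le[OF m0m]) (use in' in auto)
      also have "\<dots> \<le> (\<integral>\<^sup>+r. ennreal (m r) * indicator {s..t} r \<partial>lborel)"
        using sub by (intro nn_integral_mono mult_left_mono) (auto simp: indicator_def)
      finally show ?thesis by (simp add: s'_def t'_def)
    qed (simp add: s'_def t'_def)
  qed
  then show ?thesis using mi that by blast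
qed

theorem AC_loc_metric_speed:
  fixes u :: "real \<Rightarrow> 'a::metric_space"
  assumes "AC_loc 2 {0..} u"
  obtains M where "metric_speed u M"
proof -
  define uN where "uN N t = u (max 0 (min t (real N)))" for N :: nat and t
  have "\<exists>M. has_speed (uN N) M \<and> (AE t in lborel. ((\<lambda>s. dist (uN N s) (uN N t) / \<bar>t - s\<bar>) \<longlongrightarrow> M t) (at t))" for N
  proof -
    have "AC 2 {0..real N} u" using assms unfolding AC_loc_def by auto
    then obtain m where m: "has_speed (uN N) m" "integrable lborel m"
      unfolding uN_def[abs_def] by (rule AC_has_speed[OF _ of_nat_0_le_iff])
    show ?thesis by (rule has_speed_derivative[OF m]) blast
  qed
  then have "\<exists>MN. \<forall>N. has_speed (uN N) (MN N) \<and> (AE t in lborel. ((\<lambda>s. dist (uN N s) (uN N t) / \<bar>t - s\<bar>) \<longlongrightarrow> MN N t) (at t))"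
    by (intro choice allI)
  then obtain MN where MN: "\<And>N. has_speed (uN N) (MN N)"
    "\<And>N. AE t in lborel. ((\<lambda>s. dist (uN N s) (uN N t) / \<bar>t - s\<bar>) \<longlongrightarrow> MN N t) (at t)"
    by blast
  define u' where "u' t = u (max 0 t)" for t
  have cont: "isCont u' t" for t
  proof -
    obtain N :: nat where N: "t < real N" using reals_Archimedean2 by blast
    have "isCont (uN N) t" using has_speed_continuous[OF MN(1)] by (simp add: continuous_on_eq_continuous_at)
    moreover have "\<forall>\<^sub>F s in nhds t. uN N s = u' s"
      using eventually_nhds_in_open[of "{..<real N}" t] N by (auto simp: uN_def u'_def elim!: eventually_mono)
    ultimately show ?thesis by (simp add: isCont_cong)
  qed
  have [measurable]: "(\<lambda>t. dist (u' (t + 1 / real (Suc n))) (u' t) * real (Suc n)) \<in> borel_measurable borel" for n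
    by (intro borel_measurable_continuous_onI continuous_at_imp_continuous_on ballI continuous_intros
        isCont_o2[OF _ cont] cont)
  \<comment> \<open>A single measurable function has to agree almost everywhere with the speed of
    every clamped piece. It is read off the curve itself, through right difference quotients with
    increment \<open>1 / real (Suc n)\<close>, so the pieces need not be glued.\<close>
  define M where "M t = \<bar>lim (\<lambda>n. dist (u' (t + 1 / real (Suc n))) (u' t) * real (Suc n))\<bar>" for t
  have Mm[measurable]: "M \<in> borel_measurable borel" unfolding M_def[abs_def] by measurable
  have "AE t in lborel. \<forall>N. ((\<lambda>s. dist (uN N s) (uN N t) / \<bar>t - s\<bar>) \<longlongrightarrow> MN N t) (at t)"
    using MN(2) by (simp add: AE_all_countable)
  then have ae: "AE t in lborel. \<forall>N. 0 < t \<and> t < real N \<longrightarrow> M t = MN N t \<and> ((\<lambda>s. dist (u s) (u t) / \<bar>t - s\<bar>) \<longlongrightarrow> MN N t) (at t)"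
  proof eventually_elim
    case (elim t)
    show ?case
    proof (intro allI impI)
      fix N assume N: "0 < t \<and> t < real N"
      have ev: "\<forall>\<^sub>F s in at t. dist (uN N s) (uN N t) / \<bar>t - s\<bar> = dist (u s) (u t) / \<bar>t - s\<bar>"
        using eventually_at_in_open[of "{0<..<real N}" t] N by (auto simp: uN_def elim!: eventually_mono)
      have lim: "((\<lambda>s. dist (u s) (u t) / \<bar>t - s\<bar>) \<longlongrightarrow> MN N t) (at t)"
        using elim[rule_format, of N] tendsto_cong[OF ev] by simp
      have "(\<lambda>n. t + 1 / real (Suc n)) \<longlonglongrightarrow> t + 0"
        by (intro tendsto_add tendsto_const LIMSEQ_Suc[OF lim_1_over_n])
      then have "filterlim (\<lambda>n. t + 1 / real (Suc n)) (at t) sequentially"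
        unfolding filterlim_at by (simp add: add_nonneg_eq_0_iff)
      from filterlim_compose[OF lim this]
      have "(\<lambda>n. dist (u (t + 1 / real (Suc n))) (u t) / \<bar>t - (t + 1 / real (Suc n))\<bar>) \<longlonglongrightarrow> MN N t" .
      moreover have "dist (u (t + 1 / real (Suc n))) (u t) / \<bar>t - (t + 1 / real (Suc n))\<bar>
        = dist (u' (t + 1 / real (Suc n))) (u' t) * real (Suc n)" for n
        using N by (simp add: u'_def)
      ultimately have "(\<lambda>n. dist (u' (t + 1 / real (Suc n))) (u' t) * real (Suc n)) \<longlonglongrightarrow> MN N t" by simp
      then have "M t = MN N t" unfolding M_def using has_speedD(2)[OF MN(1)] by (simp add: limI)
      then show "M t = MN N t \<and> ((\<lambda>s. dist (u s) (u t) / \<bar>t - s\<bar>) \<longlongrightarrow> MN N t) (at t)" using lim by blast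
    qed
  qed
  have ae0: "AE t in lborel. t \<noteq> 0" by (rule AE_lborel_singleton)
  have eqI: "AE r in lborel. (g (M r)) * indicator {s..t} r = g (MN N r) * indicator {s..t} r"
    if "0 \<le> s" "t < real N" for s t N and g :: "real \<Rightarrow> ennreal"
    using ae ae0
  proof eventually_elim
    case (elim r)
    show ?case
    proof (cases "r \<in> {s..t}")
      case True
      then have "M r = MN N r" using elim that by auto
      then show ?thesis by simp
    qed simp
  qed
  have "metric_speed u M" unfolding metric_speed_def
  proof (intro conjI allI impI Mm)
    show "0 \<le> M t" for t by (simp add: M_def)
    show "(\<integral>\<^sup>+t. ennreal ((M t)\<^sup>2) * indicator {0..T} t \<partial>lborel) < \<infinity>" for T
    proof -
      obtain N :: nat where N: "T < real N" using reals_Archimedean2 by blast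
      have "(\<integral>\<^sup>+t. ennreal ((M t)\<^sup>2) * indicator {0..T} t \<partial>lborel) = (\<integral>\<^sup>+t. ennreal ((MN N t)\<^sup>2) * indicator {0..T} t \<partial>lborel)"
        by (rule nn_integral_cong_AE) (rule eqI[OF order_refl N, of "\<lambda>x. ennreal (x\<^sup>2)"])
      also have "\<dots> \<le> (\<integral>\<^sup>+t. ennreal ((MN N t)\<^sup>2) \<partial>lborel)"
        by (intro nn_integral_mono) (auto simp: indicator_def)
      also have "\<dots> < \<infinity>" by (rule has_speedD(3)[OF MN(1)])
      finally show ?thesis .
    qed
    show "ennreal (dist (u s) (u t)) \<le> (\<integral>\<^sup>+r. ennreal (M r) * indicator {s..t} r \<partial>lborel)" if st: "0 \<le> s" "s \<le> t" for s t
    proof -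
      obtain N :: nat where N: "t < real N" using reals_Archimedean2 by blast
      have "ennreal (dist (u s) (u t)) = ennreal (dist (uN N s) (uN N t))" using st N by (simp add: uN_def)
      also have "\<dots> \<le> (\<integral>\<^sup>+r. ennreal (MN N r) * indicator {s..t} r \<partial>lborel)"
        by (rule has_speedD(4)[OF MN(1) st(2)])
      also have "\<dots> = (\<integral>\<^sup>+r. ennreal (M r) * indicator {s..t} r \<partial>lborel)"
        by (rule nn_integral_cong_AE) (use eqI[OF st(1) N, of ennreal] in \<open>auto\<close>)
      finally show ?thesis .
    qed
    show "AE t in lborel. 0 < t \<longrightarrow> ((\<lambda>s. dist (u s) (u t) / \<bar>t - s\<bar>) \<longlongrightarrow> M t) (at t)"
      using ae
    proof eventually_elim
      case (elim t)
      obtain N :: nat where N: "t < real N" using reals_Archimedean2 by blast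
      show ?case using elim[rule_format, of N] N by auto
    qed
  qed
  then show ?thesis by (rule that)
qed

lemma metric_derivI:
  assumes "((\<lambda>s. dist (u s) (u t) / \<bar>t - s\<bar>) \<longlongrightarrow> l) (at t)" and I: "t \<in> interior I"
  shows "metric_deriv I u t = l"
  unfolding metric_deriv_def at_within_interior[OF I] by (rule tendsto_Lim[OF _ assms(1)]) simp

lemma metric_speed_deriv:
  assumes "metric_speed u M"
  shows "AE t in lborel. 0 < t \<longrightarrow> metric_deriv {0..} u t = M t"
proof -
  have "AE t in lborel. 0 < t \<longrightarrow> ((\<lambda>s. dist (u s) (u t) / \<bar>t - s\<bar>) \<longlongrightarrow> M t) (at t)"
    using assms unfolding metric_speed_def by blast
  then show ?thesis by eventually_elim (auto intro: metric_derivI)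
qed

lemma AC_2I:
  fixes u :: "real \<Rightarrow> 'a::metric_space"
  assumes [measurable]: "M \<in> borel_measurable borel" and nn: "\<And>t. 0 \<le> M t"
    and fin: "(\<integral>\<^sup>+t. ennreal ((M t)\<^sup>2) * indicator {a..b} t \<partial>lborel) < \<infinity>"
    and d: "\<And>s t. a \<le> s \<Longrightarrow> s \<le> t \<Longrightarrow> t \<le> b \<Longrightarrow> ennreal (dist (u s) (u t)) \<le> (\<integral>\<^sup>+r. ennreal (M r) * indicator {s..t} r \<partial>lborel)"
  shows "AC 2 {a..b} u"
proof -
  define m where "m t = indicator {a..b} t *\<^sub>R M t" for t
  have mm[measurable]: "m \<in> borel_measurable borel" unfolding m_def[abs_def] by measurable
  have m0: "0 \<le> m t" for t using nn by (simp add: m_def)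
  have eq: "ennreal ((m t)\<^sup>2) = ennreal ((M t)\<^sup>2) * indicator {a..b} t" for t by (auto simp: m_def indicator_def)
  have sq: "(\<integral>\<^sup>+t. ennreal ((m t)\<^sup>2) \<partial>lborel) < \<infinity>" unfolding eq by (rule fin)
  have mset: "set_integrable lborel {s..t} m" for s t by (rule set_nn_integral_finite[OF mm sq])
  have i0: "0 \<le> (LINT r:{s..t}|lborel. m r)" for s t
    unfolding set_lebesgue_integral_def using m0 by (intro integral_nonneg_AE) auto
  show ?thesis unfolding AC_def
  proof (intro exI[of _ m] conjI ballI impI)
    have "(\<lambda>t. indicator {a..b} t *\<^sub>R \<bar>m t\<bar> powr 2) = (\<lambda>t. (m t)\<^sup>2)"
      by (auto simp: m_def indicator_def fun_eq_iff powr_numeral)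
    moreover have "integrable lborel (\<lambda>t. (m t)\<^sup>2)"
      using sq by (intro integrableI_bounded) auto
    ultimately show "Lp_on 2 {a..b} m" unfolding Lp_on_def set_integrable_def set_borel_measurable_def by simp
    fix s t assume st: "s \<in> {a..b}" "t \<in> {a..b}" "s \<le> t"
    have "ennreal (dist (u s) (u t)) \<le> (\<integral>\<^sup>+r. ennreal (M r) * indicator {s..t} r \<partial>lborel)" using st by (intro d) auto
    also have "\<dots> = (\<integral>\<^sup>+r. ennreal (m r) * indicator {s..t} r \<partial>lborel)"
      using st by (intro nn_integral_cong) (auto simp: m_def indicator_def)
    also have "\<dots> = ennreal (LINT r:{s..t}|lborel. m r)" by (rule ennreal_set_integral[OF mset m0])
    finally show "dist (u s) (u t) \<le> (LINT r:{s..t}|lborel. m r)" using i0 by simp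
  qed
qed


section \<open>Compactness and descending curves\<close>

text \<open>This is the sequential content of (MT2): convergence in \<open>\<sigma>\<close> is
  insensitive to perturbations that vanish in the metric. Applied to a constant sequence it shows
  that metric convergence implies convergence in \<open>\<sigma>\<close>.\<close>

lemma compatible_limit_shift:
  fixes \<sigma> :: "'a::metric_space topology"
  assumes comp: "compatible \<sigma>" and lim: "limitin \<sigma> x l sequentially"
    and d: "(\<lambda>n. dist (x n) (y n)) \<longlonglongrightarrow> 0"
  shows "limitin \<sigma> y l sequentially"
  unfolding limitin_def
proof (intro conjI allI impI)
  show "l \<in> topspace \<sigma>" using comp by (simp add: compatible_def)
  fix U assume U: "openin \<sigma> U \<and> l \<in> U"
  then obtain V \<delta> where V: "openin \<sigma> V" "l \<in> V" "\<delta> > 0" "\<And>y. infdist y V < \<delta> \<Longrightarrow> y \<in> U"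
    using comp unfolding compatible_def by metis
  have "\<forall>\<^sub>F n in sequentially. x n \<in> V" using lim V unfolding limitin_def by blast
  moreover have "\<forall>\<^sub>F n in sequentially. dist (x n) (y n) < \<delta>" using d V(3) by (rule order_tendstoD)
  ultimately show "\<forall>\<^sub>F n in sequentially. y n \<in> U"
  proof eventually_elim
    case (elim n)
    have "infdist (y n) V \<le> dist (y n) (x n)" by (rule infdist_le[OF elim(1)])
    then show ?case using elim(2) by (intro V(4)) (simp add: dist_commute)
  qed
qed

lemma compatible_limitin_metric:
  fixes \<sigma> :: "'a::metric_space topology"
  assumes comp: "compatible \<sigma>" and "y \<longlonglongrightarrow> l"
  shows "limitin \<sigma> y l sequentially"
proof (rule compatible_limit_shift[OF comp])
  show "limitin \<sigma> (\<lambda>_. l) l sequentially" using comp by (simp add: compatible_def)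
  have "(\<lambda>n. dist l (y n)) \<longlonglongrightarrow> dist l l" by (intro tendsto_intros assms)
  then show "(\<lambda>n. dist l (y n)) \<longlonglongrightarrow> 0" by simp
qed

lemma compatible_dist_lower:
  fixes \<sigma> :: "'a::metric_space topology"
  assumes "compatible \<sigma>" "limitin \<sigma> x l sequentially" "limitin \<sigma> y k sequentially" "c < dist l k"
  shows "\<forall>\<^sub>F n in sequentially. c < dist (x n) (y n)"
proof -
  have "ereal c < liminf (\<lambda>n. ereal (dist (x n) (y n)))"
    using assms unfolding compatible_def by (meson ereal_less_eq(3) less_le_trans less_ereal.simps(1))
  from less_LiminfD[OF this] show ?thesis by simp
qed

lemma compatible_dist_le:
  fixes \<sigma> :: "'a::metric_space topology"
  assumes "compatible \<sigma>" "limitin \<sigma> x l sequentially" "limitin \<sigma> y k sequentially"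
    "\<forall>\<^sub>F n in sequentially. dist (x n) (y n) \<le> c n" "c \<longlonglongrightarrow> C"
  shows "dist l k \<le> C"
proof (rule ccontr)
  assume "\<not> dist l k \<le> C"
  then obtain D where D: "C < D" "D < dist l k" using dense not_le by metis
  have "\<forall>\<^sub>F n in sequentially. c n < D" using assms(5) D(1) by (rule order_tendstoD)
  with compatible_dist_lower[OF assms(1-3) D(2)] assms(4)
  have "\<forall>\<^sub>F n in sequentially. False" by eventually_elim linarith
  then show False by simp
qed

lemma compatible_unique:
  "compatible \<sigma> \<Longrightarrow> limitin \<sigma> x l sequentially \<Longrightarrow> limitin \<sigma> x k sequentially \<Longrightarrow> l = k"
  unfolding compatible_def using limitin_Hausdorff_unique sequentially_bot by metis

lemma compatible_const: "compatible \<sigma> \<Longrightarrow> limitin \<sigma> (\<lambda>_. x) x sequentially"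
  by (simp add: compatible_def)

text \<open>Rational times are treated by diagonal extraction; their limits form a uniformly continuous
  curve, which the completeness of \<open>d\<close> extends, and \<open>(MT2)\<close> transfers the convergence.\<close>

lemma compatible_Ascoli:
  fixes u :: "nat \<Rightarrow> real \<Rightarrow> 'a::complete_space" and \<sigma> :: "'a topology"
  assumes comp: "compatible \<sigma>"
    and cpt: "\<And>t r. 0 \<le> t \<Longrightarrow> strict_mono (r::nat\<Rightarrow>nat) \<Longrightarrow> \<exists>r' l. strict_mono (r'::nat\<Rightarrow>nat) \<and> limitin \<sigma> (\<lambda>n. u (r (r' n)) t) l sequentially"
    and equi: "\<And>T e. 0 < e \<Longrightarrow> \<exists>\<delta>>0. \<forall>s t. 0 \<le> s \<longrightarrow> 0 \<le> t \<longrightarrow> s \<le> T \<longrightarrow> t \<le> T \<longrightarrow> \<bar>s - t\<bar> < \<delta> \<longrightarrow>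
       (\<forall>\<^sub>F n in sequentially. dist (u n s) (u n t) < e)"
  obtains r w where "strict_mono (r::nat\<Rightarrow>nat)" "\<And>t. 0 \<le> t \<Longrightarrow> limitin \<sigma> (\<lambda>n. u (r n) t) (w t) sequentially"
proof -
  define D where "D = \<rat> \<inter> {0::real..}"
  have D: "countable D" "D \<noteq> {}" unfolding D_def using countable_rat by auto
  define q where "q = from_nat_into D"
  have qD: "range q = D" unfolding q_def by (rule range_from_nat_into[OF D(2,1)])
  define P where "P n s \<longleftrightarrow> (\<exists>l. limitin \<sigma> (\<lambda>k. u (s k) (q n)) l sequentially)" for n and s :: "nat \<Rightarrow> nat"
  interpret subseqs P
  proof
    fix n and s :: "nat \<Rightarrow> nat" assume s: "strict_mono s"
    have "0 \<le> q n" using qD by (auto simp: D_def)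
    from cpt[OF this s] show "\<exists>r'. strict_mono r' \<and> P n (s \<circ> r')" unfolding P_def by auto
  qed
  have "P k (diagseq \<circ> (+) (Suc k))" for k
  proof (rule diagseq_holds)
    fix r s n assume "strict_mono (r::nat\<Rightarrow>nat)" "P n s"
    then show "P n (s \<circ> r)" unfolding P_def using limitin_subsequence[of r \<sigma> "\<lambda>k. u (s k) (q n)"] by (auto simp: o_def)
  qed
  then have diag: "\<exists>l. limitin \<sigma> (\<lambda>n. u ((diagseq \<circ> (+) (Suc k)) n) (q k)) l sequentially" for k
    by (simp add: P_def)
  have "\<exists>l. limitin \<sigma> (\<lambda>n. u (diagseq n) (q k)) l sequentially" for k
  proof -
    obtain l where "limitin \<sigma> (\<lambda>n. u (diagseq (n + Suc k)) (q k)) l sequentially"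
      using diag[of k] unfolding o_def by (auto simp: add.commute)
    from limitin_sequentially_offset_rev[OF this] show ?thesis by blast
  qed
  then have "\<exists>l. limitin \<sigma> (\<lambda>n. u (diagseq n) t) l sequentially" if "t \<in> D" for t
    using that qD by (metis imageE)
  then obtain w0 where w0: "\<And>t. t \<in> D \<Longrightarrow> limitin \<sigma> (\<lambda>n. u (diagseq n) t) (w0 t) sequentially" by metis
  have equi': "\<exists>\<delta>>0. \<forall>s t. 0 \<le> s \<longrightarrow> 0 \<le> t \<longrightarrow> s \<le> T \<longrightarrow> t \<le> T \<longrightarrow> \<bar>s - t\<bar> < \<delta> \<longrightarrow>
       (\<forall>\<^sub>F n in sequentially. dist (u (diagseq n) s) (u (diagseq n) t) < e)" if e: "0 < e" for T e
  proof -
    obtain \<delta> where "\<delta> > 0" and \<delta>: "\<And>s t. 0 \<le> s \<Longrightarrow> 0 \<le> t \<Longrightarrow> s \<le> T \<Longrightarrow> t \<le> T \<Longrightarrow> \<bar>s - t\<bar> < \<delta> \<Longrightarrow>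
       \<forall>\<^sub>F n in sequentially. dist (u n s) (u n t) < e" using equi[OF e, of T] by blast
    then show ?thesis using eventually_subseq[OF subseq_diagseq \<delta>] by blast
  qed
  have "\<exists>l. limitin \<sigma> (\<lambda>n. u (diagseq n) t) l sequentially" if t: "0 \<le> t" for t
  proof -
    \<comment> \<open>The rational times approach \<open>t\<close> from the right, so that they
      remain nonnegative even for \<open>t = 0\<close>, and stay below \<open>t + 1\<close>, where
      one modulus of continuity serves for all of them.\<close>
    have "\<exists>y\<in>\<rat>. t \<le> y \<and> y < t + 1 / real (Suc j)" for j
      using Rats_dense_in_real[of t "t + 1 / real (Suc j)"] by (auto intro: less_imp_le)
    then obtain p where p: "\<And>j. p j \<in> \<rat>" "\<And>j. t \<le> p j" "\<And>j. p j < t + 1 / real (Suc j)" by metis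
    have pD: "p j \<in> D" for j using p t by (auto simp: D_def intro: order_trans)
    have plim: "p \<longlonglongrightarrow> t"
    proof (rule tendsto_sandwich[where f="\<lambda>_. t" and h="\<lambda>j. t + 1 / real (Suc j)"])
      have "(\<lambda>n. t + 1 / real (Suc n)) \<longlonglongrightarrow> t + 0"
        by (intro tendsto_add tendsto_const LIMSEQ_Suc[OF lim_1_over_n])
      then show "(\<lambda>n. t + 1 / real (Suc n)) \<longlonglongrightarrow> t" by simp
    qed (use p in \<open>auto intro!: always_eventually less_imp_le\<close>)
    have pT: "p j \<le> t + 1" for j
    proof -
      have "1 / real (Suc j) \<le> 1" by simp
      then show ?thesis using p(3)[of j] by linarith
    qed
    have p0: "0 \<le> p j" for j using p(2) t order_trans by blast
    have "Cauchy (\<lambda>j. w0 (p j))"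
    proof (rule metric_CauchyI)
      fix e :: real assume e: "0 < e"
      obtain \<delta> where \<delta>: "\<delta> > 0" "\<And>s t'. 0 \<le> s \<Longrightarrow> 0 \<le> t' \<Longrightarrow> s \<le> t + 1 \<Longrightarrow> t' \<le> t + 1 \<Longrightarrow> \<bar>s - t'\<bar> < \<delta> \<Longrightarrow>
       \<forall>\<^sub>F n in sequentially. dist (u (diagseq n) s) (u (diagseq n) t') < e/2" using equi'[of "e/2" "t+1"] e by auto
      obtain N where N: "\<And>m n. m \<ge> N \<Longrightarrow> n \<ge> N \<Longrightarrow> dist (p m) (p n) < \<delta>"
        using metric_CauchyD[OF LIMSEQ_imp_Cauchy[OF plim] \<delta>(1)] by blast
      have "dist (w0 (p m)) (w0 (p n)) < e" if "m \<ge> N" "n \<ge> N" for m n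
      proof -
        have "\<forall>\<^sub>F k in sequentially. dist (u (diagseq k) (p m)) (u (diagseq k) (p n)) < e/2"
          using N[OF that] by (intro \<delta>(2) p0 pT) (simp add: dist_real_def)
        then have "dist (w0 (p m)) (w0 (p n)) \<le> e/2"
          by (intro compatible_dist_le[OF comp w0[OF pD] w0[OF pD] _ tendsto_const]) (auto elim: eventually_mono)
        then show ?thesis using e by simp
      qed
      then show "\<exists>M. \<forall>m\<ge>M. \<forall>n\<ge>M. dist (w0 (p m)) (w0 (p n)) < e" by blast
    qed
    then obtain x where x: "(\<lambda>j. w0 (p j)) \<longlonglongrightarrow> x" using Cauchy_convergent convergent_def by blast
    have xs: "limitin \<sigma> (\<lambda>j. w0 (p j)) x sequentially" by (rule compatible_limitin_metric[OF comp x])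
    have "limitin \<sigma> (\<lambda>n. u (diagseq n) t) x sequentially"
      unfolding limitin_def
    proof (intro conjI allI impI)
      show "x \<in> topspace \<sigma>" using comp by (simp add: compatible_def)
      fix U assume U: "openin \<sigma> U \<and> x \<in> U"
      then obtain V \<delta> where V: "openin \<sigma> V" "x \<in> V" "\<delta> > 0" "\<And>y. infdist y V < \<delta> \<Longrightarrow> y \<in> U"
        using comp unfolding compatible_def by metis
      obtain \<eta> where \<eta>: "\<eta> > 0" "\<And>s t'. 0 \<le> s \<Longrightarrow> 0 \<le> t' \<Longrightarrow> s \<le> t + 1 \<Longrightarrow> t' \<le> t + 1 \<Longrightarrow> \<bar>s - t'\<bar> < \<eta> \<Longrightarrow>
       \<forall>\<^sub>F n in sequentially. dist (u (diagseq n) s) (u (diagseq n) t') < \<delta>" using equi'[OF V(3), of "t+1"] by blast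
      have "\<forall>\<^sub>F j in sequentially. w0 (p j) \<in> V" using xs V unfolding limitin_def by blast
      moreover have "\<forall>\<^sub>F j in sequentially. dist (p j) t < \<eta>" using plim \<eta>(1) by (rule tendstoD)
      ultimately have "\<forall>\<^sub>F j in sequentially. w0 (p j) \<in> V \<and> dist (p j) t < \<eta>" by (rule eventually_conj)
      then obtain j where j: "w0 (p j) \<in> V" "dist (p j) t < \<eta>" by (auto simp: eventually_sequentially)
      have "\<forall>\<^sub>F n in sequentially. u (diagseq n) (p j) \<in> V" using w0[OF pD] j(1) V(1) unfolding limitin_def by blast
      moreover have "\<forall>\<^sub>F n in sequentially. dist (u (diagseq n) (p j)) (u (diagseq n) t) < \<delta>"
        using j(2) t by (intro \<eta>(2) p0 pT) (auto simp: dist_real_def)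
      ultimately show "\<forall>\<^sub>F n in sequentially. u (diagseq n) t \<in> U"
      proof eventually_elim
        case (elim n)
        have "infdist (u (diagseq n) t) V \<le> dist (u (diagseq n) t) (u (diagseq n) (p j))" by (rule infdist_le[OF elim(1)])
        then show ?case using elim(2) by (intro V(4)) (simp add: dist_commute)
      qed
    qed
    then show ?thesis by blast
  qed
  then obtain w where "\<And>t. 0 \<le> t \<Longrightarrow> limitin \<sigma> (\<lambda>n. u (diagseq n) t) (w t) sequentially" by metis
  then show ?thesis using subseq_diagseq that by blast
qed

lemma lsc_limit:
  assumes "lower_semicont \<sigma> \<phi>" "bounded (range x)" "limitin \<sigma> x l sequentially"
    and "\<forall>\<^sub>F n in sequentially. \<phi> (x n) \<le> c n" "c \<longlonglongrightarrow> C"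
  shows "\<phi> l \<le> C"
proof -
  have "\<phi> l \<le> liminf (\<lambda>n. \<phi> (x n))" using assms unfolding lower_semicont_def by blast
  also have "\<dots> \<le> liminf c" by (rule Liminf_mono[OF assms(4)])
  also have "\<dots> = C" by (rule lim_imp_Liminf[OF sequentially_bot assms(5)])
  finally show ?thesis .
qed

text \<open>The direct method. A minimizing sequence stays in the ball and eventually below a fixed
  energy level, so it has a limit in \<open>\<sigma>\<close>; by (MT1) this limit is again in the
  ball and the distance term is lower semicontinuous, just like the energy.\<close>

lemma ball_minimizer:
  fixes \<sigma> :: "'a::metric_space topology"
  assumes comp: "compatible \<sigma>" and lsc: "lower_semicont \<sigma> \<phi>" and cpt: "compact_sublevels \<sigma> \<phi>"
    and x: "\<phi> x < \<infinity>" and c: "0 \<le> c" and \<eta>: "0 \<le> \<eta>"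
  obtains y where "dist y x \<le> \<eta>" "\<And>z. dist z x \<le> \<eta> \<Longrightarrow> \<phi> y + ereal (c * dist y x) \<le> \<phi> z + ereal (c * dist z x)"
proof -
  define J where "J z = \<phi> z + ereal (c * dist z x)" for z
  define I where "I = (INF z\<in>cball x \<eta>. J z)"
  obtain v where v: "range v \<subseteq> J ` cball x \<eta>" "v \<longlonglongrightarrow> I"
    using Inf_as_limit[of "J ` cball x \<eta>"] \<eta> unfolding I_def by auto
  have "\<exists>z. z \<in> cball x \<eta> \<and> J z = v n" for n using v(1) by (metis imageE range_subsetD)
  then obtain z0 where z0: "\<And>n. z0 n \<in> cball x \<eta>" "\<And>n. J (z0 n) = v n" by metis
  obtain C :: real where C: "\<phi> x \<le> ereal C" using x by (cases "\<phi> x") auto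
  have "I \<le> J x" unfolding I_def using \<eta> by (intro INF_lower) simp
  also have "\<dots> < ereal (C + 1)" using C by (simp add: J_def le_less_trans)
  finally have "\<forall>\<^sub>F n in sequentially. v n < ereal (C + 1)" using v(2) by (intro order_tendstoD)
  then obtain N where N: "\<And>n. n \<ge> N \<Longrightarrow> v n < ereal (C + 1)" by (auto simp: eventually_sequentially)
  define z where "z n = z0 (n + N)" for n
  have zb: "dist (z n) x \<le> \<eta>" for n using z0(1)[of "n + N"] by (simp add: z_def dist_commute)
  have zJ: "(\<lambda>n. J (z n)) \<longlonglongrightarrow> I" unfolding z_def z0(2) using v(2) by (rule LIMSEQ_ignore_initial_segment)
  have "\<phi> (z n) \<le> ereal (C + 1)" for n
  proof -
    have "\<phi> (z n) + 0 \<le> J (z n)" unfolding J_def using c by (intro add_left_mono) simp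
    also have "\<dots> \<le> ereal (C + 1)" unfolding z_def z0(2) using N by (simp add: less_imp_le)
    finally show ?thesis by simp
  qed
  then have "(SUP n. \<phi> (z n)) < \<infinity>" by (intro le_less_trans[OF SUP_least]) auto
  moreover have bdd: "bounded (range z)" using zb unfolding bounded_def by (auto simp: dist_commute)
  ultimately obtain r y where ry: "strict_mono r" "limitin \<sigma> (z \<circ> r) y sequentially"
    using cpt unfolding compact_sublevels_def by blast
  have yx: "dist y x \<le> \<eta>"
    by (rule compatible_dist_le[OF comp ry(2) compatible_const[OF comp] _ tendsto_const]) (use zb in auto)
  have rJ: "(\<lambda>n. J (z (r n))) \<longlonglongrightarrow> I" using LIMSEQ_subseq_LIMSEQ[OF zJ ry(1)] by (simp add: o_def)
  have "bounded (range (z \<circ> r))" by (rule bounded_subset[OF bdd]) auto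
  then have ylsc: "\<phi> y \<le> liminf (\<lambda>n. \<phi> (z (r n)))"
    using lsc ry(2) unfolding lower_semicont_def by (auto simp: o_def)
  \<comment> \<open>Testing with real or infinite \<open>a < \<phi> y\<close> avoids adding two
    lower limits in \<open>ereal\<close>, where the sum could be undefined; along the sequence both
    terms are bounded from below separately and then added.\<close>
  have "\<phi> y \<le> I - ereal (c * dist y x)"
  proof (rule dense_le)
    fix a assume "a < \<phi> y"
    then have ev1: "\<forall>\<^sub>F n in sequentially. a < \<phi> (z (r n))" using ylsc by (intro less_LiminfD) auto
    have "a + ereal (c * dist y x) \<le> I"
    proof (rule ereal_le_epsilon2)
      fix e :: real assume e: "0 < e"
      \<comment> \<open>The loss in distance is multiplied by \<open>c\<close> afterwards; dividing
        by \<open>c + 1\<close> makes the product at most \<open>e\<close> and allows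
        \<open>c = 0\<close>.\<close>
      have "\<forall>\<^sub>F n in sequentially. dist y x - e / (c + 1) < dist (z (r n)) x"
        using compatible_dist_lower[OF comp ry(2) compatible_const[OF comp], of "dist y x - e / (c + 1)" x] e c
        by (simp add: o_def)
      with ev1 have "\<forall>\<^sub>F n in sequentially. a + ereal (c * dist y x) \<le> J (z (r n)) + ereal e"
      proof eventually_elim
        case (elim n)
        have "c * (dist y x - e / (c + 1)) \<le> c * dist (z (r n)) x" using elim(2) c by (intro mult_left_mono) auto
        moreover have "c * (e / (c + 1)) \<le> e" using c e by (simp add: field_simps)
        ultimately have "c * dist y x \<le> c * dist (z (r n)) x + e" by (simp add: right_diff_distrib)
        then have "a + ereal (c * dist y x) \<le> \<phi> (z (r n)) + ereal (c * dist (z (r n)) x + e)"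
          using elim(1) by (intro add_mono) auto
        then show ?case by (simp add: J_def add.assoc)
      qed
      moreover have "(\<lambda>n. J (z (r n)) + ereal e) \<longlonglongrightarrow> I + ereal e"
        by (intro tendsto_add_ereal_general rJ tendsto_const) auto
      ultimately show "a + ereal (c * dist y x) \<le> I + ereal e"
        by (intro tendsto_lowerbound[where F=sequentially]) auto
    qed
    then show "a \<le> I - ereal (c * dist y x)" by (simp add: ereal_le_minus)
  qed
  then have "J y \<le> I" unfolding J_def by (simp add: ereal_le_minus)
  moreover have "I \<le> J z" if "dist z x \<le> \<eta>" for z
    unfolding I_def using that by (intro INF_lower) (simp add: dist_commute)
  ultimately show ?thesis using that yx unfolding J_def by (meson order_trans)
qed


text \<open>A minimizer of \<open>\<phi> + c d(\<cdot>, x)\<close> over the ball cannot lie in its interior, where the slope exceeds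
  \<open>c\<close>.\<close>

lemma slope_step:
  fixes \<sigma> :: "'a::metric_space topology"
  assumes comp: "compatible \<sigma>" and prp: "proper_functional \<phi>"
    and lsc: "lower_semicont \<sigma> \<phi>" and cpt: "compact_sublevels \<sigma> \<phi>"
    and x: "\<phi> x < \<infinity>" and c: "0 \<le> c" and \<eta>: "0 \<le> \<eta>"
    and slope: "\<And>y. dist y x \<le> \<eta> \<Longrightarrow> \<phi> y \<le> \<phi> x \<Longrightarrow> ennreal c < local_slope \<phi> y"
  obtains y where "dist y x = \<eta>" "\<phi> y + ereal (c * \<eta>) \<le> \<phi> x"
proof -
  obtain y where y: "dist y x \<le> \<eta>" "\<And>z. dist z x \<le> \<eta> \<Longrightarrow> \<phi> y + ereal (c * dist y x) \<le> \<phi> z + ereal (c * dist z x)"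
    using ball_minimizer[OF comp lsc cpt x c \<eta>] by blast
  have yx: "\<phi> y + ereal (c * dist y x) \<le> \<phi> x" using y(2)[of x] \<eta> by simp
  have "\<phi> y + 0 \<le> \<phi> y + ereal (c * dist y x)" using c by (intro add_left_mono) simp
  with yx have le: "\<phi> y \<le> \<phi> x" by simp
  have nm: "\<phi> z \<noteq> -\<infinity>" for z using prp by (simp add: proper_functional_def)
  obtain p where p: "\<phi> y = ereal p" using le x nm[of y] by (cases "\<phi> y") auto
  have "dist y x = \<eta>"
  proof (rule ccontr)
    assume "dist y x \<noteq> \<eta>"
    then have lt: "0 < \<eta> - dist y x" using y(1) by simp
    have "ennreal c < Limsup (at y) (\<lambda>v. e2ennreal (\<phi> y - \<phi> v) / ennreal (dist y v))"
      using slope[OF y(1) le] p by (simp add: local_slope_def eff_dom_def)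
    \<comment> \<open>An upper limit above \<open>c\<close> provides, arbitrarily close to
      \<open>y\<close>, some \<open>z\<close> with quotient above \<open>c\<close>. It is taken
      within \<open>\<eta> - dist y x\<close> of \<open>y\<close>, so that it still belongs to the
      ball and competes with \<open>y\<close>.\<close>
    then have "\<not> (\<forall>\<^sub>F v in at y. e2ennreal (\<phi> y - \<phi> v) / ennreal (dist y v) \<le> ennreal c)"
      using Limsup_bounded[of "\<lambda>v. e2ennreal (\<phi> y - \<phi> v) / ennreal (dist y v)" "ennreal c" "at y"] by (meson leD)
    then obtain z where z: "z \<noteq> y" "dist z y < \<eta> - dist y x" "ennreal c < e2ennreal (\<phi> y - \<phi> z) / ennreal (dist y z)"
      unfolding eventually_at using lt by (auto simp: not_le dest!: spec[of _ "\<eta> - dist y x"])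
    have d0: "0 < dist y z" using z(1) by simp
    obtain r where r: "\<phi> z = ereal r"
    proof (cases "\<phi> z")
      case PInf
      then have "e2ennreal (\<phi> y - \<phi> z) = 0" using p by (simp add: e2ennreal_neg)
      then show ?thesis using z(3) by simp
    qed (use nm[of z] that in auto)
    have *: "ennreal c < ennreal (p - r) / ennreal (dist y z)" using z(3) p r by simp
    have pr: "c * dist y z < p - r"
    proof (cases "0 \<le> p - r")
        case True
        then have "ennreal c < ennreal ((p - r) / dist y z)" using * d0 by (simp add: divide_ennreal)
        then have "c < (p - r) / dist y z" using c by (simp add: ennreal_less_iff)
        then show ?thesis using d0 by (simp add: pos_less_divide_eq)
      next
        case False
        then show ?thesis using * by (simp add: ennreal_neg)
    qed
    have tri: "dist z x \<le> dist y z + dist y x" using dist_triangle[of z x y] by (simp add: dist_commute)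
    have "dist z x \<le> \<eta>" using tri z(2) by (simp add: dist_commute)
    from y(2)[OF this] have "p + c * dist y x \<le> r + c * dist z x" by (simp add: p r)
    moreover have "c * dist z x \<le> c * dist y z + c * dist y x"
      using mult_left_mono[OF tri c] by (simp add: distrib_left)
    ultimately show False using pr by linarith
  qed
  with yx show ?thesis by (intro that) auto
qed

text \<open>After \<open>i\<close> steps of length \<open>\<eta>\<close> the chain is within
  \<open>real i * \<eta>\<close> of \<open>x0\<close> and not above its energy. All balls in which a
  step is minimized therefore lie where the slope bound is assumed, and the next step is
  possible.\<close>

lemma slope_chain:
  fixes \<sigma> :: "'a::metric_space topology"
  assumes comp: "compatible \<sigma>" and prp: "proper_functional \<phi>"
    and lsc: "lower_semicont \<sigma> \<phi>" and cpt: "compact_sublevels \<sigma> \<phi>"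
    and x0: "\<phi> x0 = ereal p0" and c: "0 \<le> c" and \<eta>: "0 \<le> \<eta>"
    and slope: "\<And>y. dist y x0 \<le> real N * \<eta> \<Longrightarrow> \<phi> y \<le> \<phi> x0 \<Longrightarrow> ennreal c < local_slope \<phi> y"
  obtains x where "x 0 = x0" "\<And>i j. i \<le> j \<Longrightarrow> j \<le> N \<Longrightarrow> dist (x i) (x j) \<le> real (j - i) * \<eta>"
    "\<And>i. i \<le> N \<Longrightarrow> \<phi> (x i) \<le> ereal (p0 - c * (real i * \<eta>))"
proof -
  \<comment> \<open>Nothing is demanded beyond index \<open>N\<close>, so that the choice principle,
    which constructs a sequence over all natural numbers, applies.\<close>
  define P where "P i y \<longleftrightarrow> (i = 0 \<longrightarrow> y = x0) \<and> (i \<le> N \<longrightarrow> dist y x0 \<le> real i * \<eta> \<and> \<phi> y \<le> ereal (p0 - c * (real i * \<eta>)))" for i y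
  have "\<exists>x. \<forall>i. P i (x i) \<and> (Suc i \<le> N \<longrightarrow> dist (x (Suc i)) (x i) = \<eta>)"
  proof (rule dependent_nat_choice)
    show "\<exists>y. P 0 y" unfolding P_def using x0 by auto
    fix y i assume P: "P i y"
    show "\<exists>z. P (Suc i) z \<and> (Suc i \<le> N \<longrightarrow> dist z y = \<eta>)"
    proof (cases "Suc i \<le> N")
      case False
      then show ?thesis unfolding P_def by auto
    next
      case True
      then have y: "dist y x0 \<le> real i * \<eta>" "\<phi> y \<le> ereal (p0 - c * (real i * \<eta>))" using P unfolding P_def by auto
      have iN: "real (Suc i) * \<eta> \<le> real N * \<eta>" using True \<eta> by (intro mult_right_mono) auto
      have "0 \<le> c * (real i * \<eta>)" using c \<eta> by simp
      then have yx0: "\<phi> y \<le> \<phi> x0" unfolding x0 by (intro order_trans[OF y(2)]) simp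
      obtain z where z: "dist z y = \<eta>" "\<phi> z + ereal (c * \<eta>) \<le> \<phi> y"
      proof (rule slope_step[OF comp prp lsc cpt _ c \<eta>, of y])
        show "\<phi> y < \<infinity>" by (rule le_less_trans[OF yx0]) (simp add: x0)
        fix v assume v: "dist v y \<le> \<eta>" "\<phi> v \<le> \<phi> y"
        have "dist v x0 \<le> \<eta> + real i * \<eta>" using dist_triangle[of v x0 y] v(1) y(1) by linarith
        also have "\<dots> \<le> real N * \<eta>" using iN by (simp add: distrib_right)
        finally show "ennreal c < local_slope \<phi> v" using v(2) yx0 by (intro slope) auto
      qed
      have "dist z x0 \<le> real (Suc i) * \<eta>" using dist_triangle[of z x0 y] z(1) y(1) by (simp add: distrib_right)
      moreover have "\<phi> z \<le> ereal (p0 - c * (real (Suc i) * \<eta>))"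
      proof -
        have "\<phi> z + ereal (c * \<eta>) \<le> ereal (p0 - c * (real i * \<eta>))" using z(2) y(2) by (rule order_trans)
        then show ?thesis by (cases "\<phi> z") (auto simp: algebra_simps)
      qed
      ultimately show ?thesis unfolding P_def using z(1) by auto
    qed
  qed
  then obtain x where x: "\<And>i. P i (x i)" "\<And>i. Suc i \<le> N \<Longrightarrow> dist (x (Suc i)) (x i) = \<eta>" by blast
  have "dist (x i) (x (i + k)) \<le> real k * \<eta>" if "i + k \<le> N" for i k
    using that
  proof (induction k)
    case (Suc k)
    have "dist (x i) (x (i + Suc k)) \<le> dist (x i) (x (i + k)) + dist (x (Suc (i + k))) (x (i + k))"
      using dist_triangle[of "x i" "x (i + Suc k)" "x (i + k)"] by (simp add: dist_commute)
    also have "\<dots> \<le> real k * \<eta> + \<eta>" using Suc x(2)[of "i + k"] by simp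
    finally show ?case by (simp add: distrib_right)
  qed simp
  then have "dist (x i) (x j) \<le> real (j - i) * \<eta>" if "i \<le> j" "j \<le> N" for i j
    using that by (metis le_add_diff_inverse)
  then show ?thesis using x(1) that unfolding P_def by metis
qed



text \<open>Chains of \<open>Suc n\<close> steps of length \<open>\<rho> / real (Suc n)\<close>,
  parametrized by the length travelled along the chain, are Lipschitz with constant one up to one
  mesh width. Boundedness and the energy bound provide compactness, the Ascoli lemma a limit curve,
  and lower semicontinuity its rate of descent. The limit may be shorter than the parameter
  suggests; only the Lipschitz bound is used.\<close>

lemma descending_curve:
  fixes \<sigma> :: "'a::complete_space topology"
  assumes comp: "compatible \<sigma>" and prp: "proper_functional \<phi>"
    and lsc: "lower_semicont \<sigma> \<phi>" and cpt: "compact_sublevels \<sigma> \<phi>"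
    and x0: "\<phi> x0 = ereal p0" and c: "0 \<le> c" and \<rho>: "0 < \<rho>"
    and slope: "\<And>y. dist y x0 \<le> \<rho> \<Longrightarrow> \<phi> y \<le> \<phi> x0 \<Longrightarrow> ennreal c < local_slope \<phi> y"
  obtains w where "w 0 = x0" "\<And>s t. 0 \<le> s \<Longrightarrow> 0 \<le> t \<Longrightarrow> dist (w s) (w t) \<le> \<bar>s - t\<bar>"
    "\<And>s. 0 \<le> s \<Longrightarrow> s \<le> \<rho> \<Longrightarrow> \<phi> (w s) \<le> ereal (p0 - c * s)"
proof -
  define \<eta> where "\<eta> n = \<rho> / real (Suc n)" for n
  have \<eta>: "0 < \<eta> n" "real (Suc n) * \<eta> n = \<rho>" for n using \<rho> by (auto simp: \<eta>_def)
  have \<eta>0: "\<eta> \<longlonglongrightarrow> 0"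
    unfolding \<eta>_def[abs_def] using tendsto_mult[OF tendsto_const[of \<rho>] LIMSEQ_Suc[OF lim_1_over_n]] by simp
  have "\<exists>x. x 0 = x0 \<and> (\<forall>i j. i \<le> j \<longrightarrow> j \<le> Suc n \<longrightarrow> dist (x i) (x j) \<le> real (j - i) * \<eta> n) \<and>
    (\<forall>i. i \<le> Suc n \<longrightarrow> \<phi> (x i) \<le> ereal (p0 - c * (real i * \<eta> n)))" for n
    by (rule slope_chain[OF comp prp lsc cpt x0 c less_imp_le[OF \<eta>(1)[of n]], of "Suc n"])
       (use slope \<eta>(2)[of n] in auto)
  then obtain X where X: "\<And>n. X n 0 = x0"
    "\<And>n i j. i \<le> j \<Longrightarrow> j \<le> Suc n \<Longrightarrow> dist (X n i) (X n j) \<le> real (j - i) * \<eta> n"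
    "\<And>n i. i \<le> Suc n \<Longrightarrow> \<phi> (X n i) \<le> ereal (p0 - c * (real i * \<eta> n))" by metis
  \<comment> \<open>The index of the chain point reached at parameter \<open>s\<close>. Clamping at
    \<open>\<rho>\<close> lets the curve rest at the end of the chain, so that it is defined and
    Lipschitz for all nonnegative parameters.\<close>
  define k where "k n s = nat \<lfloor>min s \<rho> / \<eta> n\<rfloor>" for n s
  have k: "real (k n s) * \<eta> n \<le> min s \<rho>" "min s \<rho> < (real (k n s) + 1) * \<eta> n" "k n s \<le> Suc n" if "0 \<le> s" for n s
  proof -
    have "0 \<le> min s \<rho> / \<eta> n" using that \<rho> \<eta>(1)[of n] by simp
    then have "real (k n s) = of_int \<lfloor>min s \<rho> / \<eta> n\<rfloor>" by (simp add: k_def)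
    then have "real (k n s) \<le> min s \<rho> / \<eta> n" "min s \<rho> / \<eta> n < real (k n s) + 1"
      using floor_correct[of "min s \<rho> / \<eta> n"] by auto
    then show 1: "real (k n s) * \<eta> n \<le> min s \<rho>" "min s \<rho> < (real (k n s) + 1) * \<eta> n"
      using \<eta>(1)[of n] by (simp_all add: pos_le_divide_eq pos_divide_less_eq)
    have "real (k n s) * \<eta> n \<le> real (Suc n) * \<eta> n" unfolding \<eta>(2) using 1(1) by simp
    then have "real (k n s) \<le> real (Suc n)" using \<eta>(1)[of n] by (rule mult_right_le_imp_le)
    then show "k n s \<le> Suc n" by simp
  qed
  define u where "u n s = X n (k n s)" for n s
  have lip: "dist (u n s) (u n t) \<le> \<bar>s - t\<bar> + \<eta> n" if "0 \<le> s" "0 \<le> t" for n s t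
  proof -
    have main: "dist (u n s) (u n t) \<le> \<bar>s - t\<bar> + \<eta> n" if "k n s \<le> k n t" "0 \<le> s" "0 \<le> t" for s t
    proof -
      have "dist (u n s) (u n t) \<le> real (k n t - k n s) * \<eta> n"
        unfolding u_def using that k(3) by (intro X(2)) auto
      also have "\<dots> = real (k n t) * \<eta> n - real (k n s) * \<eta> n" using that(1) by (simp add: of_nat_diff left_diff_distrib)
      also have "\<dots> \<le> min t \<rho> - min s \<rho> + \<eta> n" using k(1)[OF that(3), of n] k(2)[OF that(2), of n, unfolded distrib_right] by linarith
      also have "\<dots> \<le> \<bar>s - t\<bar> + \<eta> n" by (auto simp: min_def)
      finally show ?thesis .
    qed
    show ?thesis using main[of s t] main[of t s] that by (cases "k n s \<le> k n t") (auto simp: dist_commute abs_minus_commute)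
  qed
  have u\<phi>: "\<phi> (u n s) \<le> ereal (p0 - c * (min s \<rho> - \<eta> n))" if "0 \<le> s" for n s
  proof -
    have "c * (min s \<rho> - \<eta> n) \<le> c * (real (k n s) * \<eta> n)"
      using k(2)[OF that, of n] by (intro mult_left_mono c) (simp add: distrib_right)
    then show ?thesis unfolding u_def by (intro order_trans[OF X(3)[OF k(3)[OF that]]]) simp
  qed
  have u\<phi>0: "\<phi> (u n s) \<le> ereal p0" if "0 \<le> s" for n s
  proof -
    have "0 \<le> c * (real (k n s) * \<eta> n)" using c \<eta>(1)[of n] by simp
    then show ?thesis unfolding u_def by (intro order_trans[OF X(3)[OF k(3)[OF that]]]) simp
  qed
  have ub: "dist x0 (u n s) \<le> \<rho>" if "0 \<le> s" for n s
    using X(2)[of 0 "k n s" n] k(1,3)[OF that, of n] by (simp add: u_def X(1))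
  have bdd: "bounded (range (\<lambda>n. u (r n) s))" if "0 \<le> s" for r :: "nat \<Rightarrow> nat" and s
    unfolding bounded_def using ub[OF that] by auto
  obtain r w where r: "strict_mono (r::nat\<Rightarrow>nat)" and w: "\<And>t. 0 \<le> t \<Longrightarrow> limitin \<sigma> (\<lambda>n. u (r n) t) (w t) sequentially"
  proof (rule compatible_Ascoli[OF comp, of u])
    fix t :: real and r :: "nat \<Rightarrow> nat" assume t: "0 \<le> t" "strict_mono r"
    have "(SUP n. \<phi> (u (r n) t)) < \<infinity>" using u\<phi>0[OF t(1)] by (intro le_less_trans[OF SUP_least]) auto
    with bdd[OF t(1)] show "\<exists>r' l. strict_mono r' \<and> limitin \<sigma> (\<lambda>n. u (r (r' n)) t) l sequentially"
      using cpt[unfolded compact_sublevels_def, rule_format, of "\<lambda>n. u (r n) t"] by (auto simp: o_def)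
  next
    fix T e :: real assume e: "0 < e"
    show "\<exists>\<delta>>0. \<forall>s t. 0 \<le> s \<longrightarrow> 0 \<le> t \<longrightarrow> s \<le> T \<longrightarrow> t \<le> T \<longrightarrow> \<bar>s - t\<bar> < \<delta> \<longrightarrow> (\<forall>\<^sub>F n in sequentially. dist (u n s) (u n t) < e)"
    proof (intro exI[of _ "e/2"] conjI allI impI)
      fix s t :: real assume st: "0 \<le> s" "0 \<le> t" "\<bar>s - t\<bar> < e/2"
      have "\<forall>\<^sub>F n in sequentially. \<eta> n < e/2" using \<eta>0 e by (intro order_tendstoD) auto
      then show "\<forall>\<^sub>F n in sequentially. dist (u n s) (u n t) < e"
        by eventually_elim (use lip[OF st(1,2)] st(3) in \<open>smt (verit) field_sum_of_halves\<close>)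
    qed (use e in auto)
  next
    fix r :: "nat \<Rightarrow> nat" and w assume "strict_mono r" "\<And>t. 0 \<le> t \<Longrightarrow> limitin \<sigma> (\<lambda>n. u (r n) t) (w t) sequentially"
    then show thesis by (rule that)
  qed
  have \<eta>r: "(\<lambda>n. \<eta> (r n)) \<longlonglongrightarrow> 0" using LIMSEQ_subseq_LIMSEQ[OF \<eta>0 r] by (simp add: o_def)
  show ?thesis
  proof (rule that[of w])
    have "k n 0 = 0" for n using \<rho> by (simp add: k_def)
    then have "limitin \<sigma> (\<lambda>n. x0) (w 0) sequentially" using w[of 0] by (simp add: u_def X(1))
    then show "w 0 = x0" using compatible_const[OF comp] compatible_unique[OF comp] by blast
    show "dist (w s) (w t) \<le> \<bar>s - t\<bar>" if "0 \<le> s" "0 \<le> t" for s t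
    proof (rule compatible_dist_le[OF comp w[OF that(1)] w[OF that(2)]])
      show "(\<lambda>n. \<bar>s - t\<bar> + \<eta> (r n)) \<longlonglongrightarrow> \<bar>s - t\<bar>"
        using tendsto_add[OF tendsto_const \<eta>r, of "\<bar>s - t\<bar>"] by simp
    qed (use lip[OF that] in auto)
    show "\<phi> (w s) \<le> ereal (p0 - c * s)" if s: "0 \<le> s" "s \<le> \<rho>" for s
    proof (rule lsc_limit[OF lsc bdd[OF s(1)] w[OF s(1)]])
      have "(\<lambda>n. p0 - c * (min s \<rho> - \<eta> (r n))) \<longlonglongrightarrow> p0 - c * (min s \<rho> - 0)" by (intro tendsto_intros \<eta>r)
      then show "(\<lambda>n. ereal (p0 - c * (min s \<rho> - \<eta> (r n)))) \<longlonglongrightarrow> ereal (p0 - c * s)" using s(2) by simp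
    qed (use u\<phi>[OF s(1)] in auto)
  qed
qed


section \<open>The value along a minimizer\<close>

lemma nn_integral_exp_tail:
  assumes \<epsilon>: "0 < (\<epsilon>::real)"
  shows "(\<integral>\<^sup>+s. ennreal (exp (- s / \<epsilon>)) * indicator {a..} s \<partial>lborel) = ennreal (\<epsilon> * exp (- a / \<epsilon>))"
proof -
  have "((\<lambda>s. - \<epsilon> * exp (- s / \<epsilon>)) \<longlongrightarrow> - \<epsilon> * 0) at_top"
  proof (intro tendsto_mult tendsto_const)
    have "filterlim (\<lambda>s. (- 1 / \<epsilon>) * s) at_bot at_top"
      by (rule filterlim_tendsto_neg_mult_at_bot[OF tendsto_const _ filterlim_ident]) (use \<epsilon> in simp)
    then have "filterlim (\<lambda>s. - s / \<epsilon>) at_bot at_top" by simp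
    then show "((\<lambda>s. exp (- s / \<epsilon>)) \<longlongrightarrow> 0) at_top" by (rule filterlim_compose[OF exp_at_bot])
  qed
  then have lim: "((\<lambda>s. - \<epsilon> * exp (- s / \<epsilon>)) \<longlongrightarrow> 0) at_top" by simp
  have "(\<integral>\<^sup>+s. ennreal (exp (- s / \<epsilon>)) * indicator {a..} s \<partial>lborel) = ennreal (0 - (- \<epsilon> * exp (- a / \<epsilon>)))"
    by (rule nn_integral_FTC_atLeast[OF _ _ _ lim]) (use \<epsilon> in \<open>auto intro!: derivative_eq_intros\<close>)
  then show ?thesis by simp
qed

lemma exp_tail:
  assumes \<epsilon>: "0 < (\<epsilon>::real)"
  shows "set_integrable lborel {a..} (\<lambda>s. exp (- s / \<epsilon>))" "(LINT s:{a..}|lborel. exp (- s / \<epsilon>)) = \<epsilon> * exp (- a / \<epsilon>)"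
proof -
  have eq: "(\<integral>\<^sup>+s. ennreal (indicator {a..} s *\<^sub>R exp (- s / \<epsilon>)) \<partial>lborel) = ennreal (\<epsilon> * exp (- a / \<epsilon>))"
    unfolding nn_integral_exp_tail[OF \<epsilon>, symmetric] by (intro nn_integral_cong) (auto simp: indicator_def)
  show int: "set_integrable lborel {a..} (\<lambda>s. exp (- s / \<epsilon>))"
    unfolding set_integrable_def by (rule integrableI_nonneg; (unfold eq)?; simp)
  have "ennreal (LINT s:{a..}|lborel. exp (- s / \<epsilon>)) = ennreal (\<epsilon> * exp (- a / \<epsilon>))"
    unfolding set_lebesgue_integral_def eq[symmetric] using int unfolding set_integrable_def
    by (intro nn_integral_eq_integral[symmetric]) auto
  moreover have "0 \<le> (LINT s:{a..}|lborel. exp (- s / \<epsilon>))"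
    unfolding set_lebesgue_integral_def by (intro integral_nonneg_AE) auto
  ultimately show "(LINT s:{a..}|lborel. exp (- s / \<epsilon>)) = \<epsilon> * exp (- a / \<epsilon>)" using \<epsilon> by simp
qed

text \<open>The constant \<open>4\<close> is what makes \<open>16 \<epsilon> B \<le> 1\<close> suffice for the dissipation to control the
  negative part of the energy.\<close>

lemma weighted_Hardy:
  fixes f :: "real \<Rightarrow> ennreal"
  assumes [measurable]: "f \<in> borel_measurable borel" and \<epsilon>: "0 < \<epsilon>"
  shows "(\<integral>\<^sup>+s. ennreal (exp (- s / \<epsilon>)) * (\<integral>\<^sup>+r. f r * indicator {a..s} r \<partial>lborel)\<^sup>2 * indicator {a..} s \<partial>lborel)
    \<le> ennreal (4 * \<epsilon>\<^sup>2) * (\<integral>\<^sup>+s. ennreal (exp (- s / \<epsilon>)) * (f s)\<^sup>2 * indicator {a..} s \<partial>lborel)"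
proof -
  let ?w = "\<lambda>r. ennreal (exp (- r / (2 * \<epsilon>))) * (f r)\<^sup>2"
  have CS: "(\<integral>\<^sup>+r. f r * indicator {a..s} r \<partial>lborel)\<^sup>2
    \<le> ennreal (2 * \<epsilon> * exp (s / (2 * \<epsilon>))) * (\<integral>\<^sup>+r. ?w r * indicator {a..s} r \<partial>lborel)" if "a \<le> s" for s
  proof -
    \<comment> \<open>The Cauchy-Schwarz inequality is applied with a weight that spends half of the
      exponential decay on the first factor, at the price of \<open>2 * \<epsilon>\<close>. The
      other half survives for the integration in \<open>s\<close> after Fubini and costs
      \<open>2 * \<epsilon>\<close> again, which makes up
      \<open>4 * \<epsilon>\<^sup>2\<close>.\<close>
    let ?g = "\<lambda>r. ennreal (exp (r / (4 * \<epsilon>))) * indicator {a..s} r"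
    let ?h = "\<lambda>r. ennreal (exp (- r / (4 * \<epsilon>))) * f r * indicator {a..s} r"
    have "(\<integral>\<^sup>+r. f r * indicator {a..s} r \<partial>lborel) = (\<integral>\<^sup>+r. ?g r * ?h r \<partial>lborel)"
    proof (intro nn_integral_cong)
      fix r
      have "ennreal (exp (r / (4 * \<epsilon>))) * ennreal (exp (- r / (4 * \<epsilon>))) = 1"
        by (simp flip: ennreal_mult exp_add)
      then have "?g r * ?h r = 1 * f r * indicator {a..s} r"
        by (auto simp: indicator_def simp flip: mult.assoc)
      then show "f r * indicator {a..s} r = ?g r * ?h r" by simp
    qed
    then have "(\<integral>\<^sup>+r. f r * indicator {a..s} r \<partial>lborel)\<^sup>2 \<le> (\<integral>\<^sup>+r. (?g r)\<^sup>2 \<partial>lborel) * (\<integral>\<^sup>+r. (?h r)\<^sup>2 \<partial>lborel)"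
      using Cauchy_Schwarz_nn_integral[of ?g lborel ?h] by simp
    also have "(\<integral>\<^sup>+r. (?g r)\<^sup>2 \<partial>lborel) = (\<integral>\<^sup>+r. ennreal (exp (r / (2 * \<epsilon>))) * indicator {a..s} r \<partial>lborel)"
      by (intro nn_integral_cong) (auto simp: indicator_def ennreal_power simp flip: exp_double)
    also have "\<dots> = ennreal (2 * \<epsilon> * exp (s / (2 * \<epsilon>)) - 2 * \<epsilon> * exp (a / (2 * \<epsilon>)))"
      by (rule nn_integral_FTC_Icc) (use \<epsilon> that in \<open>auto intro!: derivative_eq_intros\<close>)
    also have "\<dots> \<le> ennreal (2 * \<epsilon> * exp (s / (2 * \<epsilon>)))" using \<epsilon> by (intro ennreal_leI) simp
    also have "(\<integral>\<^sup>+r. (?h r)\<^sup>2 \<partial>lborel) = (\<integral>\<^sup>+r. ?w r * indicator {a..s} r \<partial>lborel)"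
      by (intro nn_integral_cong) (auto simp: indicator_def power_mult_distrib ennreal_power simp flip: exp_double)
    finally show ?thesis by (simp add: mult_right_mono)
  qed
  define S where "S = {p :: real \<times> real. a \<le> snd p \<and> snd p \<le> fst p}"
  have S[measurable]: "S \<in> sets (borel \<Otimes>\<^sub>M borel)"
  proof -
    have "{p \<in> space (borel \<Otimes>\<^sub>M borel). a \<le> snd p \<and> snd p \<le> (fst p :: real)} \<in> sets (borel \<Otimes>\<^sub>M borel)" by measurable
    then show ?thesis by (simp add: S_def space_pair_measure)
  qed
  have "(\<integral>\<^sup>+s. ennreal (exp (- s / \<epsilon>)) * (\<integral>\<^sup>+r. f r * indicator {a..s} r \<partial>lborel)\<^sup>2 * indicator {a..} s \<partial>lborel)
    \<le> (\<integral>\<^sup>+s. \<integral>\<^sup>+r. ennreal (2 * \<epsilon> * exp (- s / (2 * \<epsilon>))) * (?w r * indicator S (s, r)) \<partial>lborel \<partial>lborel)"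
  proof (intro nn_integral_mono)
    fix s :: real
    show "ennreal (exp (- s / \<epsilon>)) * (\<integral>\<^sup>+r. f r * indicator {a..s} r \<partial>lborel)\<^sup>2 * indicator {a..} s
      \<le> (\<integral>\<^sup>+r. ennreal (2 * \<epsilon> * exp (- s / (2 * \<epsilon>))) * (?w r * indicator S (s, r)) \<partial>lborel)"
    proof (cases "a \<le> s")
      case True
      have e: "ennreal (exp (- s / \<epsilon>)) * ennreal (2 * \<epsilon> * exp (s / (2 * \<epsilon>))) = ennreal (2 * \<epsilon> * exp (- s / (2 * \<epsilon>)))"
      proof -
        have "exp (- s / \<epsilon>) * exp (s / (2 * \<epsilon>)) = exp (- s / (2 * \<epsilon>))"
          using \<epsilon> by (simp flip: exp_add)
        then show ?thesis using \<epsilon> by (simp add: mult_ac flip: ennreal_mult)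
      qed
      have "ennreal (exp (- s / \<epsilon>)) * (\<integral>\<^sup>+r. f r * indicator {a..s} r \<partial>lborel)\<^sup>2
        \<le> ennreal (exp (- s / \<epsilon>)) * (ennreal (2 * \<epsilon> * exp (s / (2 * \<epsilon>))) * (\<integral>\<^sup>+r. ?w r * indicator {a..s} r \<partial>lborel))"
        by (intro mult_left_mono CS True) simp
      also have "\<dots> = ennreal (2 * \<epsilon> * exp (- s / (2 * \<epsilon>))) * (\<integral>\<^sup>+r. ?w r * indicator {a..s} r \<partial>lborel)"
        unfolding mult.assoc[symmetric] e ..
      also have "(\<lambda>r. ?w r * indicator {a..s} r) = (\<lambda>r. ?w r * indicator S (s, r))"
        by (auto simp: S_def indicator_def)
      finally show ?thesis using True by (subst nn_integral_cmult) (auto simp: indicator_def)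
    qed simp
  qed
  also have "\<dots> = (\<integral>\<^sup>+r. \<integral>\<^sup>+s. ennreal (2 * \<epsilon> * exp (- s / (2 * \<epsilon>))) * (?w r * indicator S (s, r)) \<partial>lborel \<partial>lborel)"
    by (rule lborel_pair.Fubini'[symmetric]) measurable
  also have "\<dots> = (\<integral>\<^sup>+r. ennreal (4 * \<epsilon>\<^sup>2) * (ennreal (exp (- r / \<epsilon>)) * (f r)\<^sup>2 * indicator {a..} r) \<partial>lborel)"
  proof (intro nn_integral_cong)
    fix r :: real
    have "(\<integral>\<^sup>+s. ennreal (2 * \<epsilon> * exp (- s / (2 * \<epsilon>))) * (?w r * indicator S (s, r)) \<partial>lborel)
      = (\<integral>\<^sup>+s. (ennreal (2 * \<epsilon>) * ?w r * indicator {a..} r) * (ennreal (exp (- s / (2 * \<epsilon>))) * indicator {r..} s) \<partial>lborel)"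
      using \<epsilon> by (intro nn_integral_cong) (auto simp: S_def indicator_def ennreal_mult mult_ac)
    also have "\<dots> = (ennreal (2 * \<epsilon>) * ?w r * indicator {a..} r) * ennreal (2 * \<epsilon> * exp (- r / (2 * \<epsilon>)))"
      using \<epsilon> nn_integral_exp_tail[of "2 * \<epsilon>" r] by (subst nn_integral_cmult) auto
    also have "\<dots> = (ennreal (2 * \<epsilon>) * ennreal (exp (- r / (2 * \<epsilon>))) * ennreal (2 * \<epsilon> * exp (- r / (2 * \<epsilon>)))) * ((f r)\<^sup>2 * indicator {a..} r)"
      by (simp add: mult_ac)
    also have "ennreal (2 * \<epsilon>) * ennreal (exp (- r / (2 * \<epsilon>))) * ennreal (2 * \<epsilon> * exp (- r / (2 * \<epsilon>))) = ennreal (4 * \<epsilon>\<^sup>2) * ennreal (exp (- r / \<epsilon>))"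
    proof -
      have "exp (- r / (2 * \<epsilon>)) * exp (- r / (2 * \<epsilon>)) = exp (- r / \<epsilon>)"
        using \<epsilon> by (simp flip: exp_add)
      then show ?thesis using \<epsilon> by (simp add: power2_eq_square mult_ac flip: ennreal_mult)
    qed
    finally show "(\<integral>\<^sup>+s. ennreal (2 * \<epsilon> * exp (- s / (2 * \<epsilon>))) * (?w r * indicator S (s, r)) \<partial>lborel)
      = ennreal (4 * \<epsilon>\<^sup>2) * (ennreal (exp (- r / \<epsilon>)) * (f r)\<^sup>2 * indicator {a..} r)" by (simp add: mult_ac)
  qed
  also have "\<dots> = ennreal (4 * \<epsilon>\<^sup>2) * (\<integral>\<^sup>+s. ennreal (exp (- s / \<epsilon>)) * (f s)\<^sup>2 * indicator {a..} s \<partial>lborel)"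
    by (rule nn_integral_cmult) measurable
  finally show ?thesis .
qed

lemma ext_integral_eq:
  assumes b: "set_integrable lborel S b" and ae: "AE s in lborel. s \<in> S \<longrightarrow> f s = ereal (b s)"
  shows "ext_integral S f = ereal (LINT s:S|lborel. b s)"
proof -
  let ?b = "\<lambda>s. indicator S s *\<^sub>R b s"
  have int: "integrable lborel ?b" using b unfolding set_integrable_def .
  have 1: "(\<integral>\<^sup>+s\<in>S. e2ennreal (f s) \<partial>lborel) = (\<integral>\<^sup>+s. ennreal (?b s) \<partial>lborel)"
    by (rule nn_integral_cong_AE) (use ae in eventually_elim, auto simp: indicator_def)
  have 2: "(\<integral>\<^sup>+s\<in>S. e2ennreal (- f s) \<partial>lborel) = (\<integral>\<^sup>+s. ennreal (- ?b s) \<partial>lborel)"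
    by (rule nn_integral_cong_AE) (use ae in eventually_elim, auto simp: indicator_def)
  have f: "(\<integral>\<^sup>+s. ennreal (?b s) \<partial>lborel) \<noteq> \<infinity>" "(\<integral>\<^sup>+s. ennreal (- ?b s) \<partial>lborel) \<noteq> \<infinity>"
    using int unfolding real_integrable_def by auto
  show ?thesis
    unfolding ext_integral_def 1 2 set_lebesgue_integral_def real_lebesgue_integral_def[OF int]
    using f by (cases "(\<integral>\<^sup>+s. ennreal (?b s) \<partial>lborel)"; cases "(\<integral>\<^sup>+s. ennreal (- ?b s) \<partial>lborel)")
      (simp_all add: enn2ereal_ennreal)
qed

text \<open>Both nonnegative integrals are monotone for arbitrary functions, so nothing is asked
  about the measurability of \<open>f\<close>. In the applications \<open>f\<close> is the density
  of the functional along a competitor and \<open>b\<close> an explicit majorant.\<close>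

lemma ext_integral_le:
  assumes b: "set_integrable lborel S b" and ae: "AE s in lborel. s \<in> S \<longrightarrow> f s \<le> ereal (b s)"
  shows "ext_integral S f \<le> ereal (LINT s:S|lborel. b s)"
proof -
  have "ext_integral S f \<le> ext_integral S (\<lambda>s. ereal (b s))"
    unfolding ext_integral_def
  proof (intro ereal_minus_mono)
    have "(\<integral>\<^sup>+s\<in>S. e2ennreal (f s) \<partial>lborel) \<le> (\<integral>\<^sup>+s\<in>S. e2ennreal (ereal (b s)) \<partial>lborel)"
      by (rule nn_integral_mono_AE) (use ae in eventually_elim, auto simp: indicator_def simp del: e2ennreal_ereal intro: e2ennreal_mono)
    then show "enn2ereal (\<integral>\<^sup>+s\<in>S. e2ennreal (f s) \<partial>lborel) \<le> enn2ereal (\<integral>\<^sup>+s\<in>S. e2ennreal (ereal (b s)) \<partial>lborel)"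
      by (simp add: less_eq_ennreal.rep_eq)
    have "(\<integral>\<^sup>+s\<in>S. e2ennreal (- ereal (b s)) \<partial>lborel) \<le> (\<integral>\<^sup>+s\<in>S. e2ennreal (- f s) \<partial>lborel)"
      by (rule nn_integral_mono_AE) (use ae in eventually_elim, auto simp: indicator_def simp del: e2ennreal_ereal uminus_ereal.simps intro!: e2ennreal_mono)
    then show "enn2ereal (\<integral>\<^sup>+s\<in>S. e2ennreal (- ereal (b s)) \<partial>lborel) \<le> enn2ereal (\<integral>\<^sup>+s\<in>S. e2ennreal (- f s) \<partial>lborel)"
      by (simp add: less_eq_ennreal.rep_eq)
  qed
  also have "\<dots> = ereal (LINT s:S|lborel. b s)" by (rule ext_integral_eq[OF b]) simp
  finally show ?thesis .
qed

text \<open>Integration by parts in a form that suits a merely integrable \<open>f\<close>: both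
  sides integrate \<open>f x * g r\<close> over the triangle \<open>x \<le> r\<close>. It is used
  with \<open>g\<close> the derivative of the exponential factor in the value.\<close>

lemma Fubini_indefinite:
  fixes f g :: "real \<Rightarrow> real"
  assumes f: "set_integrable lborel {a..b} f" and g: "set_integrable lborel {a..b} g"
  shows "(LINT r:{a..b}|lborel. g r * (LINT x:{a..r}|lborel. f x)) = (LINT x:{a..b}|lborel. f x * (LINT r:{x..b}|lborel. g r))"
    and "set_integrable lborel {a..b} (\<lambda>r. g r * (LINT x:{a..r}|lborel. f x))"
proof -
  let ?f = "\<lambda>x. indicator {a..b} x *\<^sub>R f x" and ?g = "\<lambda>x. indicator {a..b} x *\<^sub>R g x"
  have fi: "integrable lborel ?f" and gi: "integrable lborel ?g" using f g unfolding set_integrable_def by auto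
  have [measurable]: "?f \<in> borel_measurable borel" "?g \<in> borel_measurable borel" using fi gi by auto
  define S where "S = {p :: real \<times> real. snd p \<le> fst p}"
  have S[measurable]: "S \<in> sets (borel \<Otimes>\<^sub>M borel)"
  proof -
    have "{p \<in> space (borel \<Otimes>\<^sub>M borel). snd p \<le> (fst p :: real)} \<in> sets (borel \<Otimes>\<^sub>M borel)" by measurable
    then show ?thesis by (simp add: S_def space_pair_measure)
  qed
  define K where "K = (\<lambda>(r, x). ?g r * ?f x * indicator S (r, x))"
  have Km[measurable]: "K \<in> borel_measurable (lborel \<Otimes>\<^sub>M lborel)" unfolding K_def by measurable
  have gf: "integrable (lborel \<Otimes>\<^sub>M lborel) (\<lambda>(r, x). ?g r * ?f x)"
    by (rule lborel_pair.Fubini_integrable) (use fi gi integrable_abs[OF fi] integrable_abs[OF gi] in \<open>auto simp: abs_mult intro!: integrable_mult_left\<close>)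
  have Ki: "integrable (lborel \<Otimes>\<^sub>M lborel) K"
    by (rule Bochner_Integration.integrable_bound[OF gf Km]) (auto simp: K_def indicator_def abs_mult)
  have inner1: "(\<integral>x. K (r, x) \<partial>lborel) = indicator {a..b} r *\<^sub>R (g r * (LINT x:{a..r}|lborel. f x))" for r
  proof -
    have "K (r, x) = (indicator {a..b} r * g r) * (indicator {a..r} x *\<^sub>R f x)" for x
      by (auto simp: K_def S_def indicator_def)
    then show ?thesis by (simp add: set_lebesgue_integral_def)
  qed
  have inner2: "(\<integral>r. K (r, x) \<partial>lborel) = indicator {a..b} x *\<^sub>R (f x * (LINT r:{x..b}|lborel. g r))" for x
  proof -
    have "K (r, x) = (indicator {a..b} x * f x) * (indicator {x..b} r *\<^sub>R g r)" for r
      by (auto simp: K_def S_def indicator_def)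
    then show ?thesis by (simp add: set_lebesgue_integral_def)
  qed
  show "(LINT r:{a..b}|lborel. g r * (LINT x:{a..r}|lborel. f x)) = (LINT x:{a..b}|lborel. f x * (LINT r:{x..b}|lborel. g r))"
    using lborel_pair.Fubini_integral[of "\<lambda>r x. K (r, x)"] Ki
    unfolding inner1 inner2 by (simp add: set_lebesgue_integral_def)
  show "set_integrable lborel {a..b} (\<lambda>r. g r * (LINT x:{a..r}|lborel. f x))"
    unfolding set_integrable_def inner1[symmetric] by (rule lborel_pair.integrable_fst'[OF Ki])
qed


lemma metric_speedD:
  assumes "metric_speed u M"
  shows "M \<in> borel_measurable borel" "\<And>t. 0 \<le> M t"
    "\<And>T. (\<integral>\<^sup>+t. ennreal ((M t)\<^sup>2) * indicator {0..T} t \<partial>lborel) < \<infinity>"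
    "\<And>s t. 0 \<le> s \<Longrightarrow> s \<le> t \<Longrightarrow> ennreal (dist (u s) (u t)) \<le> (\<integral>\<^sup>+r. ennreal (M r) * indicator {s..t} r \<partial>lborel)"
    "AE t in lborel. 0 < t \<longrightarrow> ((\<lambda>s. dist (u s) (u t) / \<bar>t - s\<bar>) \<longlongrightarrow> M t) (at t)"
  using assms unfolding metric_speed_def by blast+

lemma metric_speed_dist_sq:
  assumes u: "metric_speed u M" and st: "0 \<le> s" "s \<le> t"
  shows "ennreal ((dist (u s) (u t))\<^sup>2) \<le> ennreal (t - s) * (\<integral>\<^sup>+r. ennreal ((M r)\<^sup>2) * indicator {s..t} r \<partial>lborel)"
proof -
  note [measurable] = metric_speedD(1)[OF u]
  have "(ennreal (dist (u s) (u t)))\<^sup>2 \<le> (\<integral>\<^sup>+r. ennreal (M r) * indicator {s..t} r \<partial>lborel)\<^sup>2"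
    using metric_speedD(4)[OF u st] by (rule power_mono) simp
  also have "\<dots> \<le> (\<integral>\<^sup>+r. (ennreal (M r))\<^sup>2 * indicator {s..t} r \<partial>lborel) * emeasure lborel {s..t}"
    by (rule nn_integral_Cauchy_Schwarz_indicator) auto
  finally show ?thesis using st metric_speedD(2)[OF u] by (simp add: ennreal_power mult.commute)
qed

lemma metric_speed_continuous:
  assumes u: "metric_speed u M"
  shows "continuous_on {0..} u"
  unfolding continuous_on_def
proof (intro ballI)
  fix t :: real assume t: "t \<in> {0..}"
  define L where "L = enn2real (\<integral>\<^sup>+r. ennreal ((M r)\<^sup>2) * indicator {0..t + 1} r \<partial>lborel)"
  have L: "ennreal L = (\<integral>\<^sup>+r. ennreal ((M r)\<^sup>2) * indicator {0..t + 1} r \<partial>lborel)" "0 \<le> L"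
    using metric_speedD(3)[OF u, of "t + 1"] by (auto simp: L_def)
  have sq: "(dist (u a) (u b))\<^sup>2 \<le> (b - a) * L" if "0 \<le> a" "a \<le> b" "b \<le> t + 1" for a b
  proof -
    have "ennreal ((dist (u a) (u b))\<^sup>2) \<le> ennreal (b - a) * (\<integral>\<^sup>+r. ennreal ((M r)\<^sup>2) * indicator {a..b} r \<partial>lborel)"
      by (rule metric_speed_dist_sq[OF u that(1,2)])
    also have "\<dots> \<le> ennreal (b - a) * ennreal L" unfolding L using that
      by (intro mult_left_mono nn_integral_mono) (auto simp: indicator_def)
    finally show ?thesis using that L(2) by (simp flip: ennreal_mult)
  qed
  have le: "dist (u s) (u t) \<le> sqrt (\<bar>t - s\<bar> * L)" if "0 \<le> s" "s < t + 1" for s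
    using sq[of s t] sq[of t s] t that by (intro real_le_rsqrt) (cases "s \<le> t"; auto simp: dist_commute)
  have "((\<lambda>s. sqrt (\<bar>t - s\<bar> * L)) \<longlongrightarrow> sqrt (\<bar>t - t\<bar> * L)) (at t within {0..})" by (intro tendsto_intros)
  then have lim: "((\<lambda>s. sqrt (\<bar>t - s\<bar> * L)) \<longlongrightarrow> 0) (at t within {0..})" by simp
  have "\<forall>\<^sub>F s in at t within {0..}. dist (u s) (u t) \<le> sqrt (\<bar>t - s\<bar> * L)"
    unfolding eventually_at by (intro exI[of _ 1]) (auto simp: dist_real_def intro!: le)
  then have "((\<lambda>s. dist (u s) (u t)) \<longlongrightarrow> 0) (at t within {0..})"
    by (intro tendsto_sandwich[OF _ _ tendsto_const lim]) (simp_all add: always_eventually)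
  then show "(u \<longlongrightarrow> u t) (at t within {0..})" by (rule iffD2[OF tendsto_dist_iff])
qed

section \<open>The energy and the functional along trajectories\<close>

locale wed_functional =
  fixes \<sigma> :: "'a::complete_space topology" and \<phi> :: "'a \<Rightarrow> ereal" and ustar :: 'a and A B :: real
  assumes comp: "compatible \<sigma>" and prp: "proper_functional \<phi>" and lscc: "LSCC \<sigma> \<phi> ustar A B"
begin

lemma lsc: "lower_semicont \<sigma> \<phi>" and cpt: "compact_sublevels \<sigma> \<phi>" and AB: "0 \<le> A" "0 \<le> B"
  and coercive: "ereal (- B * (dist x y)\<^sup>2 - (B * (dist y ustar)\<^sup>2 + A)) \<le> \<phi> x"
  using lscc by (auto simp: LSCC_def coercive_def)

lemma not_minf: "\<phi> x \<noteq> - \<infinity>"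
  using prp by (simp add: proper_functional_def)

text \<open>Continuity of the curve and \<open>compatible_limitin_metric\<close> turn lower
  semicontinuity under \<open>\<sigma>\<close> into lower semicontinuity in time, so sublevels are
  closed. Times below zero are sent to zero in order to have a function on the line.\<close>

lemma phi_curve_measurable:
  fixes u :: "real \<Rightarrow> 'a"
  assumes "continuous_on {0..} u"
  shows "(\<lambda>t. \<phi> (u (max 0 t))) \<in> borel_measurable borel"
proof (rule borel_measurableI_le)
  fix y
  have "closed {t. \<phi> (u (max 0 t)) \<le> y}"
    unfolding closed_sequential_limits
  proof (intro allI impI)
    fix x and l assume x: "(\<forall>n. x n \<in> {t. \<phi> (u (max 0 t)) \<le> y}) \<and> x \<longlonglongrightarrow> l"
    have "(\<lambda>n. max 0 (x n)) \<longlonglongrightarrow> max 0 l" using x by (intro tendsto_intros) auto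
    then have lim: "(\<lambda>n. u (max 0 (x n))) \<longlonglongrightarrow> u (max 0 l)"
      by (intro continuous_on_tendsto_compose[OF assms]) auto
    have "\<phi> (u (max 0 l)) \<le> y"
      by (rule lsc_limit[where c="\<lambda>_. y", OF lsc convergent_imp_bounded[OF lim] compatible_limitin_metric[OF comp lim] _ tendsto_const])
         (use x in auto)
    then show "l \<in> {t. \<phi> (u (max 0 t)) \<le> y}" by simp
  qed
  then show "{x \<in> space borel. \<phi> (u (max 0 x)) \<le> y} \<in> sets borel" by simp
qed

end

lemma trajectories_energy:
  assumes "v \<in> trajectories \<epsilon> ubar" "metric_speed v N"
  shows "(\<integral>\<^sup>+s. ennreal (exp (- s / \<epsilon>)) * ennreal ((N s)\<^sup>2) * indicator {0..} s \<partial>lborel) < \<infinity>"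
proof -
  have "(\<integral>\<^sup>+s. ennreal (exp (- s / \<epsilon>)) * ennreal ((N s)\<^sup>2) * indicator {0..} s \<partial>lborel)
    = (\<integral>\<^sup>+ t\<in>{0..}. ennreal ((metric_deriv {0..} v t)\<^sup>2 * exp (- t / \<epsilon>)) \<partial>lborel)"
    by (rule nn_integral_cong_AE)
       (use metric_speed_deriv[OF assms(2)] AE_lborel_singleton[of 0] in eventually_elim,
        auto simp: indicator_def mult.commute simp flip: ennreal_mult)
  then show ?thesis using assms(1) unfolding trajectories_def by simp
qed

lemma weighted_dist_le:
  assumes v: "metric_speed v N" and \<epsilon>: "0 < \<epsilon>" and t0: "0 \<le> t0"
  shows "(\<integral>\<^sup>+s. ennreal (exp (- s / \<epsilon>)) * ennreal ((dist (v s) (v t0))\<^sup>2) * indicator {t0..} s \<partial>lborel)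
    \<le> ennreal (4 * \<epsilon>\<^sup>2) * (\<integral>\<^sup>+s. ennreal (exp (- s / \<epsilon>)) * ennreal ((N s)\<^sup>2) * indicator {t0..} s \<partial>lborel)"
proof -
  note [measurable] = metric_speedD(1)[OF v]
  have "(\<integral>\<^sup>+s. ennreal (exp (- s / \<epsilon>)) * ennreal ((dist (v s) (v t0))\<^sup>2) * indicator {t0..} s \<partial>lborel)
    \<le> (\<integral>\<^sup>+s. ennreal (exp (- s / \<epsilon>)) * (\<integral>\<^sup>+r. ennreal (N r) * indicator {t0..s} r \<partial>lborel)\<^sup>2 * indicator {t0..} s \<partial>lborel)"
  proof (intro nn_integral_mono)
    fix s
    show "ennreal (exp (- s / \<epsilon>)) * ennreal ((dist (v s) (v t0))\<^sup>2) * indicator {t0..} s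
      \<le> ennreal (exp (- s / \<epsilon>)) * (\<integral>\<^sup>+r. ennreal (N r) * indicator {t0..s} r \<partial>lborel)\<^sup>2 * indicator {t0..} s"
    proof (cases "t0 \<le> s")
      case True
      have "(ennreal (dist (v t0) (v s)))\<^sup>2 \<le> (\<integral>\<^sup>+r. ennreal (N r) * indicator {t0..s} r \<partial>lborel)\<^sup>2"
        by (rule power_mono[OF metric_speedD(4)[OF v t0 True]]) simp
      then show ?thesis using True by (auto simp: ennreal_power dist_commute intro!: mult_left_mono)
    qed simp
  qed
  also have "\<dots> \<le> ennreal (4 * \<epsilon>\<^sup>2) * (\<integral>\<^sup>+s. ennreal (exp (- s / \<epsilon>)) * (ennreal (N s))\<^sup>2 * indicator {t0..} s \<partial>lborel)"
    by (rule weighted_Hardy[OF _ \<epsilon>]) measurable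
  finally show ?thesis using metric_speedD(2)[OF v] by (simp add: ennreal_power)
qed

definition wed_density :: "('a \<Rightarrow> ereal) \<Rightarrow> real \<Rightarrow> real \<Rightarrow> real \<Rightarrow> 'a \<Rightarrow> ereal" where
  "wed_density \<phi> \<epsilon> s h x = ereal (exp (- s / \<epsilon>)) * (ereal (1/2 * h\<^sup>2) + ereal (1 / \<epsilon>) * \<phi> x)"

lemma WED_eq: "WED \<phi> \<epsilon> u = ext_integral {0..} (\<lambda>s. wed_density \<phi> \<epsilon> s (metric_deriv {0..} u s) (u s))"
  unfolding WED_def wed_density_def ..

lemma wed_density_real:
  "\<phi> x = ereal p \<Longrightarrow> wed_density \<phi> \<epsilon> s h x = ereal (exp (- s / \<epsilon>) * (1/2 * h\<^sup>2 + p / \<epsilon>))"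
  by (simp add: wed_density_def)

lemma wed_density_infinite: "\<phi> x = \<infinity> \<Longrightarrow> 0 < \<epsilon> \<Longrightarrow> wed_density \<phi> \<epsilon> s h x = \<infinity>"
  by (simp add: wed_density_def)

lemma wed_density_le:
  assumes "\<phi> x \<le> ereal p" "\<bar>h\<bar> \<le> k" "0 < \<epsilon>"
  shows "wed_density \<phi> \<epsilon> s h x \<le> ereal (exp (- s / \<epsilon>) * (1/2 * k\<^sup>2 + p / \<epsilon>))"
proof (cases "\<phi> x")
  case (real r)
  have "h\<^sup>2 \<le> k\<^sup>2" using assms(2) by (simp add: abs_le_square_iff[symmetric])
  moreover have "r / \<epsilon> \<le> p / \<epsilon>" using assms real by (simp add: divide_right_mono)
  ultimately show ?thesis unfolding wed_density_real[of \<phi> x, OF real] by simp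
qed (use assms in \<open>auto simp: wed_density_def\<close>)

context wed_functional
begin

text \<open>Coercivity with the second point \<open>y\<close> left free; it becomes the starting
  point of the curve, from which the Hardy inequality measures distances. The kinetic term only
  helps, and where the energy is infinite there is no negative part.\<close>

lemma wed_density_neg:
  assumes "0 < \<epsilon>"
  shows "e2ennreal (- wed_density \<phi> \<epsilon> s h x)
    \<le> ennreal (B / \<epsilon>) * (ennreal (exp (- s / \<epsilon>)) * ennreal ((dist x y)\<^sup>2)) +
      ennreal ((B * (dist y ustar)\<^sup>2 + A) / \<epsilon>) * ennreal (exp (- s / \<epsilon>))"
proof (cases "\<phi> x")
  case (real r)
  let ?q = "B * (dist y ustar)\<^sup>2 + A" and ?e = "exp (- s / \<epsilon>)"
  have q0: "0 \<le> ?q" using AB by simp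
  have "- r \<le> B * (dist x y)\<^sup>2 + ?q" using coercive[of x y] real by simp
  then have "- r / \<epsilon> \<le> (B * (dist x y)\<^sup>2 + ?q) / \<epsilon>" using assms by (intro divide_right_mono) auto
  also have "\<dots> = B / \<epsilon> * (dist x y)\<^sup>2 + ?q / \<epsilon>" by (simp only: add_divide_distrib times_divide_eq_left)
  moreover have "- (1/2 * h\<^sup>2 + r / \<epsilon>) \<le> - r / \<epsilon>" by simp
  ultimately have "- (1/2 * h\<^sup>2 + r / \<epsilon>) \<le> B / \<epsilon> * (dist x y)\<^sup>2 + ?q / \<epsilon>" by linarith
  then have "?e * - (1/2 * h\<^sup>2 + r / \<epsilon>) \<le> ?e * (B / \<epsilon> * (dist x y)\<^sup>2 + ?q / \<epsilon>)" by (intro mult_left_mono) auto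
  then have "e2ennreal (- wed_density \<phi> \<epsilon> s h x) \<le> ennreal (B / \<epsilon> * (?e * (dist x y)\<^sup>2) + ?q / \<epsilon> * ?e)"
    unfolding wed_density_real[of \<phi> x, OF real] by (simp add: algebra_simps ennreal_leI)
  also have "\<dots> = ennreal (B / \<epsilon>) * (ennreal ?e * ennreal ((dist x y)\<^sup>2)) + ennreal (?q / \<epsilon>) * ennreal ?e"
    using AB assms q0
    by (simp only: ennreal_plus ennreal_mult mult_nonneg_nonneg divide_nonneg_nonneg zero_le_power2 exp_ge_zero less_imp_le)
  finally show ?thesis .
qed (use not_minf assms in \<open>auto simp: wed_density_infinite e2ennreal_neg\<close>)

text \<open>By the Hardy inequality the finite weighted kinetic energy of a trajectory controls its
  weighted squared distance from the starting point, and thereby the negative part. The functional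
  thus never meets a difference of two infinities.\<close>

lemma wed_density_neg_finite:
  assumes \<epsilon>: "0 < \<epsilon>" and v: "v \<in> trajectories \<epsilon> ubar" "metric_speed v N"
  shows "(\<integral>\<^sup>+s. e2ennreal (- wed_density \<phi> \<epsilon> s (h s) (v s)) * indicator {0..} s \<partial>lborel) < \<infinity>"
proof -
  let ?q = "B * (dist (v 0) ustar)\<^sup>2 + A"
  have "continuous_on {0..} v" by (rule metric_speed_continuous[OF v(2)])
  then have "continuous_on UNIV (\<lambda>s. dist (v (max 0 s)) (v 0))"
    by (intro continuous_on_dist continuous_on_const continuous_on_compose2[of "{0..}" v UNIV "max 0"] continuous_on_max continuous_on_id) auto
  then have [measurable]: "(\<lambda>s. dist (v (max 0 s)) (v 0)) \<in> borel_measurable borel"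
    by (rule borel_measurable_continuous_onI)
  let ?I = "\<lambda>s. ennreal (exp (- s / \<epsilon>)) * ennreal ((dist (v (max 0 s)) (v 0))\<^sup>2) * indicator {0..} s"
  let ?E = "\<lambda>s. ennreal (exp (- s / \<epsilon>)) * indicator {0..} s"
  have "(\<integral>\<^sup>+s. ?I s \<partial>lborel) = (\<integral>\<^sup>+s. ennreal (exp (- s / \<epsilon>)) * ennreal ((dist (v s) (v 0))\<^sup>2) * indicator {0..} s \<partial>lborel)"
    by (intro nn_integral_cong) (auto simp: indicator_def)
  also have "\<dots> \<le> ennreal (4 * \<epsilon>\<^sup>2) * (\<integral>\<^sup>+s. ennreal (exp (- s / \<epsilon>)) * ennreal ((N s)\<^sup>2) * indicator {0..} s \<partial>lborel)"
    by (rule weighted_dist_le[OF v(2) \<epsilon>]) simp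
  also have "\<dots> < \<infinity>" using trajectories_energy[OF v] by (simp add: ennreal_mult_less_top)
  finally have I: "(\<integral>\<^sup>+s. ?I s \<partial>lborel) < \<infinity>" .
  have E: "(\<integral>\<^sup>+s. ?E s \<partial>lborel) < \<infinity>" using nn_integral_exp_tail[OF \<epsilon>, of 0] by simp
  have "(\<integral>\<^sup>+s. e2ennreal (- wed_density \<phi> \<epsilon> s (h s) (v s)) * indicator {0..} s \<partial>lborel)
    \<le> (\<integral>\<^sup>+s. ennreal (B / \<epsilon>) * ?I s + ennreal (?q / \<epsilon>) * ?E s \<partial>lborel)"
  proof (intro nn_integral_mono)
    fix s
    show "e2ennreal (- wed_density \<phi> \<epsilon> s (h s) (v s)) * indicator {0..} s \<le> ennreal (B / \<epsilon>) * ?I s + ennreal (?q / \<epsilon>) * ?E s"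
      using wed_density_neg[OF \<epsilon>, of s "h s" "v s" "v 0"] by (cases "0 \<le> s") auto
  qed
  also have "\<dots> = ennreal (B / \<epsilon>) * (\<integral>\<^sup>+s. ?I s \<partial>lborel) + ennreal (?q / \<epsilon>) * (\<integral>\<^sup>+s. ?E s \<partial>lborel)"
    by (subst nn_integral_add) (auto simp: nn_integral_cmult)
  also have "\<dots> < \<infinity>" using I E by (simp add: ennreal_mult_less_top)
  finally show ?thesis .
qed

end


lemma nn_integral_Icc_split:
  fixes f :: "real \<Rightarrow> ennreal"
  assumes "f \<in> borel_measurable borel" and "a \<le> b" "b \<le> c"
  shows "(\<integral>\<^sup>+r. f r * indicator {a..c} r \<partial>lborel) =
    (\<integral>\<^sup>+r. f r * indicator {a..b} r \<partial>lborel) + (\<integral>\<^sup>+r. f r * indicator {b..c} r \<partial>lborel)"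
  unfolding nn_integral_Icc_Ico by (rule nn_integral_Ico_split[OF assms])

lemma set_integral_Ico_Ici:
  fixes f :: "real \<Rightarrow> real"
  assumes "set_integrable lborel {a..} f" "a \<le> b"
  shows "(LINT s:{a..}|lborel. f s) = (LINT s:{a..<b}|lborel. f s) + (LINT s:{b..}|lborel. f s)"
proof -
  have "set_integrable lborel {a..<b} f" "set_integrable lborel {b..} f"
    using assms(2) by (auto intro: set_integrable_subset[OF assms(1)])
  moreover have "{a..} = {a..<b} \<union> {b..}" "{a..<b} \<inter> {b..} = {}" using assms(2) by auto
  ultimately show ?thesis using set_integral_Un[of "{a..<b}" "{b..}" lborel f] by simp
qed

lemma trajectories_metric_deriv:
  assumes "metric_speed u M" shows "AE s in lborel. s \<in> {0..} \<longrightarrow> metric_deriv {0..} u s = M s"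
  using metric_speed_deriv[OF assms] AE_lborel_singleton[of 0] by eventually_elim auto

section \<open>A minimizer and its competitors\<close>

locale wed_minimizer = wed_functional \<sigma> \<phi> ustar A B
  for \<sigma> :: "'a::complete_space topology" and \<phi> ustar A B +
  fixes \<epsilon> :: real and ubar :: 'a and u :: "real \<Rightarrow> 'a" and M :: "real \<Rightarrow> real"
  assumes \<epsilon>: "0 < \<epsilon>" and B\<epsilon>: "B \<le> 1 / (16 * \<epsilon>)" and ubar: "ubar \<in> eff_dom \<phi>"
    and min: "WED_minimizer \<phi> \<epsilon> ubar u" and speed: "metric_speed u M"
begin

lemma traj: "u \<in> trajectories \<epsilon> ubar" and minimal: "v \<in> trajectories \<epsilon> ubar \<Longrightarrow> WED \<phi> \<epsilon> u \<le> WED \<phi> \<epsilon> v"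
  using min by (auto simp: WED_minimizer_def)

lemma u0: "u 0 = ubar"
  using traj by (simp add: trajectories_def)

lemma M_measurable[measurable]: "M \<in> borel_measurable borel" and M_nonneg: "0 \<le> M t"
  using metric_speedD[OF speed] by auto

lemma phi_u_measurable[measurable]: "(\<lambda>t. \<phi> (u (max 0 t))) \<in> borel_measurable borel"
  by (rule phi_curve_measurable[OF metric_speed_continuous[OF speed]])

text \<open>An infinite energy is sent to zero. By \<open>pot_finite\<close> this concerns only a
  null set of nonnegative times, so it does not affect the integrals.\<close>

definition pot :: "real \<Rightarrow> real" where "pot t = real_of_ereal (\<phi> (u (max 0 t)))"

definition lagr :: "real \<Rightarrow> real" where "lagr s = exp (- s / \<epsilon>) * (1/2 * (M s)\<^sup>2 + pot s / \<epsilon>)"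

lemma pot_measurable[measurable]: "pot \<in> borel_measurable borel"
  unfolding pot_def[abs_def] by measurable

lemma lagr_measurable[measurable]: "lagr \<in> borel_measurable borel"
  unfolding lagr_def[abs_def] by measurable

lemma WED_u_finite: "WED \<phi> \<epsilon> u < \<infinity>"
proof -
  obtain p0 where p0: "\<phi> ubar = ereal p0" using ubar not_minf[of ubar] by (cases "\<phi> ubar") (auto simp: eff_dom_def)
  have md: "metric_deriv {0..} (\<lambda>_. ubar) s = 0" if "0 < s" for s
    by (rule metric_derivI) (use that in auto)
  have "(\<integral>\<^sup>+ t\<in>{0..}. ennreal ((metric_deriv {0..} (\<lambda>_. ubar) t)\<^sup>2 * exp (- t / \<epsilon>)) \<partial>lborel) = (\<integral>\<^sup>+t. 0 \<partial>(lborel :: real measure))"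
    by (rule nn_integral_cong_AE) (use AE_lborel_singleton[of 0] in eventually_elim, auto simp: indicator_def md)
  moreover have "AC 2 {a..b} (\<lambda>_. ubar)" for a b by (rule AC_2I[of "\<lambda>_. 0"]) auto
  ultimately have "(\<lambda>_. ubar) \<in> trajectories \<epsilon> ubar" unfolding trajectories_def AC_loc_def by simp
  then have "WED \<phi> \<epsilon> u \<le> WED \<phi> \<epsilon> (\<lambda>_. ubar)" by (rule minimal)
  also have "\<dots> \<le> ereal (LINT s:{0..}|lborel. exp (- s / \<epsilon>) * (1/2 * 0\<^sup>2 + p0 / \<epsilon>))"
    unfolding WED_eq
  proof (rule ext_integral_le)
    show "set_integrable lborel {0..} (\<lambda>s. exp (- s / \<epsilon>) * (1/2 * 0\<^sup>2 + p0 / \<epsilon>))"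
      by (rule set_integrable_mult_left) (use exp_tail(1)[OF \<epsilon>] in auto)
    show "AE s in lborel. s \<in> {0..} \<longrightarrow> wed_density \<phi> \<epsilon> s (metric_deriv {0..} (\<lambda>_. ubar) s) ubar
      \<le> ereal (exp (- s / \<epsilon>) * (1/2 * 0\<^sup>2 + p0 / \<epsilon>))"
      using AE_lborel_singleton[of 0]
      by eventually_elim (use wed_density_le[of \<phi> ubar p0 0 0 \<epsilon>] \<epsilon> in \<open>simp add: p0 md\<close>)
  qed
  finally show ?thesis by (rule le_less_trans) simp
qed

lemma density_eq:
  assumes "\<phi> (u s) < \<infinity>" "0 \<le> s"
  shows "\<phi> (u s) = ereal (pot s)" "wed_density \<phi> \<epsilon> s (M s) (u s) = ereal (lagr s)"
proof -
  show 1: "\<phi> (u s) = ereal (pot s)"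
    using assms not_minf[of "u s"] by (cases "\<phi> (u s)") (auto simp: pot_def max_absorb2)
  show "wed_density \<phi> \<epsilon> s (M s) (u s) = ereal (lagr s)"
    unfolding lagr_def by (rule wed_density_real[of \<phi> "u s", OF 1])
qed

text \<open>The constant curve makes the minimal value less than infinity. As the negative part has
  a finite integral, so must the positive part, and the density is finite almost everywhere and
  integrable.\<close>

lemma pot_finite: "AE s in lborel. 0 \<le> s \<longrightarrow> \<phi> (u s) < \<infinity>"
  and lagr_integrable: "set_integrable lborel {0..} lagr"
proof -
  let ?L = "\<lambda>s. wed_density \<phi> \<epsilon> s (M s) (u (max 0 s))"
  have [measurable]: "?L \<in> borel_measurable borel" unfolding wed_density_def by measurable
  have neg: "(\<integral>\<^sup>+s. e2ennreal (- ?L s) * indicator {0..} s \<partial>lborel) < \<infinity>"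
    using wed_density_neg_finite[OF \<epsilon> traj speed, of M]
    by (rule le_less_trans[rotated]) (auto intro!: nn_integral_mono simp: indicator_def max_absorb2)
  have pos_eq: "(\<integral>\<^sup>+s\<in>{0..}. e2ennreal (wed_density \<phi> \<epsilon> s (metric_deriv {0..} u s) (u s)) \<partial>lborel)
    = (\<integral>\<^sup>+s. e2ennreal (?L s) * indicator {0..} s \<partial>lborel)"
    by (rule nn_integral_cong_AE) (use trajectories_metric_deriv[OF speed] in eventually_elim, auto simp: indicator_def max_absorb2)
  have neg': "(\<integral>\<^sup>+s\<in>{0..}. e2ennreal (- wed_density \<phi> \<epsilon> s (metric_deriv {0..} u s) (u s)) \<partial>lborel) < \<infinity>"
    by (rule wed_density_neg_finite[OF \<epsilon> traj speed])
  have pos: "(\<integral>\<^sup>+s. e2ennreal (?L s) * indicator {0..} s \<partial>lborel) < \<infinity>"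
  proof (rule ccontr)
    assume "\<not> ?thesis"
    then have inf: "(\<integral>\<^sup>+s. e2ennreal (?L s) * indicator {0..} s \<partial>lborel) = \<infinity>"
      by (metis infinity_ennreal_def top.not_eq_extremum)
    have "WED \<phi> \<epsilon> u = \<infinity>"
      unfolding WED_eq ext_integral_def pos_eq inf using neg' by (simp add: top_ennreal.rep_eq)
    then show False using WED_u_finite by simp
  qed
  have "AE s in lborel. e2ennreal (?L s) * indicator {0..} s \<noteq> \<infinity>"
    using pos by (intro nn_integral_PInf_AE) auto
  then show fin: "AE s in lborel. 0 \<le> s \<longrightarrow> \<phi> (u s) < \<infinity>"
  proof eventually_elim
    case (elim s)
    show ?case
    proof (intro impI, rule ccontr)
      assume "0 \<le> s" "\<not> \<phi> (u s) < \<infinity>"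
      then have "?L s = \<infinity>" using \<epsilon> by (intro wed_density_infinite) (auto simp: max_absorb2)
      then show False using elim \<open>0 \<le> s\<close> by simp
    qed
  qed
  have "(\<integral>\<^sup>+s. ennreal (norm (indicator {0..} s *\<^sub>R lagr s)) \<partial>lborel)
    = (\<integral>\<^sup>+s. e2ennreal (?L s) * indicator {0..} s + e2ennreal (- ?L s) * indicator {0..} s \<partial>lborel)"
  proof (rule nn_integral_cong_AE)
    show "AE s in lborel. ennreal (norm (indicator {0..} s *\<^sub>R lagr s)) =
      e2ennreal (?L s) * indicator {0..} s + e2ennreal (- ?L s) * indicator {0..} s"
      using fin
    proof eventually_elim
      case (elim s)
      show ?case
      proof (cases "0 \<le> s")
        case True
        then have "?L s = ereal (lagr s)" using density_eq(2)[of s] elim by (simp add: max_absorb2)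
        moreover have "ennreal \<bar>x\<bar> = ennreal x + ennreal (- x)" for x :: real
          by (cases "0 \<le> x") (auto simp: ennreal_neg)
        ultimately show ?thesis using True by simp
      qed simp
    qed
  qed
  also have "\<dots> = (\<integral>\<^sup>+s. e2ennreal (?L s) * indicator {0..} s \<partial>lborel) + (\<integral>\<^sup>+s. e2ennreal (- ?L s) * indicator {0..} s \<partial>lborel)"
    by (rule nn_integral_add) measurable
  also have "\<dots> < \<infinity>" using pos neg by simp
  finally show "set_integrable lborel {0..} lagr" unfolding set_integrable_def by (intro integrableI_bounded) auto
qed

lemma WED_u: "WED \<phi> \<epsilon> u = ereal (LINT s:{0..}|lborel. lagr s)"
  unfolding WED_eq
proof (rule ext_integral_eq[OF lagr_integrable])
  show "AE s in lborel. s \<in> {0..} \<longrightarrow> wed_density \<phi> \<epsilon> s (metric_deriv {0..} u s) (u s) = ereal (lagr s)"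
    using pot_finite trajectories_metric_deriv[OF speed] by eventually_elim (auto simp: density_eq(2))
qed

text \<open>The cost of moving at speed \<open>c\<close> during time \<open>T\<close> while the
  energy falls at rate \<open>c\<^sup>2\<close>, and of resting afterwards. Integrated by parts, the
  discounted drop of energy is worth \<open>c\<^sup>2\<close> per unit of discounted moving time and
  the motion costs half of that, so the gain is \<open>1/2 * c\<^sup>2\<close> times the discounted
  length of \<open>{t0..t0 + T}\<close>.\<close>

lemma competitor_integral:
  fixes p0 c :: real
  assumes t0: "0 \<le> t0" and T: "0 \<le> (T::real)"
  defines "b \<equiv> \<lambda>s. exp (- s / \<epsilon>) * (1/2 * (if s < t0 + T then c else 0)\<^sup>2 + (p0 - c\<^sup>2 * min (s - t0) T) / \<epsilon>)"
  shows "set_integrable lborel {t0..} b"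
    "(LINT s:{t0..}|lborel. b s) = exp (- t0 / \<epsilon>) * (p0 - 1/2 * c\<^sup>2 * \<epsilon> * (1 - exp (- T / \<epsilon>)))"
proof -
  define f where "f s = exp (- s / \<epsilon>) * (1/2 * c\<^sup>2 + (p0 - c\<^sup>2 * (s - t0)) / \<epsilon>)" for s
  \<comment> \<open>An explicit primitive of the integrand \<open>f\<close> of the moving
    phase.\<close>
  define \<Psi> where "\<Psi> s = exp (- s / \<epsilon>) * (1/2 * c\<^sup>2 * \<epsilon> - (p0 - c\<^sup>2 * (s - t0)))" for s
  have der: "(\<Psi> has_real_derivative f s) (at s)" for s
    unfolding \<Psi>_def f_def using \<epsilon> by (auto intro!: derivative_eq_intros simp: field_simps)
  have cont: "isCont f s" for s unfolding f_def using \<epsilon> by (intro continuous_intros) auto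
  have "has_bochner_integral lborel (\<lambda>x. f x * indicator {t0..t0 + T} x) (\<Psi> (t0 + T) - \<Psi> t0)"
    by (rule has_bochner_integral_FTC_Icc_real) (use T der cont in auto)
  then have fI: "set_integrable lborel {t0..t0 + T} f" "(LINT s:{t0..t0 + T}|lborel. f s) = \<Psi> (t0 + T) - \<Psi> t0"
    unfolding set_integrable_def set_lebesgue_integral_def by (auto simp: has_bochner_integral_iff mult.commute)
  have fI': "set_integrable lborel {t0..<t0 + T} f" by (rule set_integrable_subset[OF fI(1)]) auto
  have fI'': "(LINT s:{t0..<t0 + T}|lborel. f s) = (LINT s:{t0..t0 + T}|lborel. f s)"
    by (rule set_integral_cong_set)
       (use fI(1) fI' AE_lborel_singleton[of "t0 + T"] in \<open>auto simp: set_borel_measurable_def set_integrable_def\<close>)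
  have eq1: "b s = f s" if "s \<in> {t0..<t0 + T}" for s using that by (auto simp: b_def f_def min_def)
  have eq2: "b s = exp (- s / \<epsilon>) * ((p0 - c\<^sup>2 * T) / \<epsilon>)" if "s \<in> {t0 + T..}" for s using that by (auto simp: b_def min_def)
  have b1: "set_integrable lborel {t0..<t0 + T} b"
    using fI' by (rule set_integrable_cong[THEN iffD1, rotated -1]) (auto simp: eq1)
  have b2: "set_integrable lborel {t0 + T..} b"
    using set_integrable_mult_left[of "(p0 - c\<^sup>2 * T) / \<epsilon>" lborel "{t0 + T..}" "\<lambda>s. exp (- s / \<epsilon>)"] exp_tail(1)[OF \<epsilon>, of "t0 + T"]
    by (intro set_integrable_cong[THEN iffD2, OF refl refl eq2]) auto
  have "{t0..<t0 + T} \<union> {t0 + T..} = {t0..}" using T by auto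
  then show int: "set_integrable lborel {t0..} b" using set_integrable_Un[OF b1 b2] by auto
  have "(LINT s:{t0..}|lborel. b s) = (LINT s:{t0..<t0 + T}|lborel. b s) + (LINT s:{t0 + T..}|lborel. b s)"
    using T by (intro set_integral_Ico_Ici[OF int]) auto
  also have "(LINT s:{t0..<t0 + T}|lborel. b s) = (LINT s:{t0..<t0 + T}|lborel. f s)"
    by (rule set_lebesgue_integral_cong) (auto simp: eq1)
  also have "\<dots> = \<Psi> (t0 + T) - \<Psi> t0" unfolding fI'' fI(2) ..
  also have "(LINT s:{t0 + T..}|lborel. b s) = (LINT s:{t0 + T..}|lborel. exp (- s / \<epsilon>) * ((p0 - c\<^sup>2 * T) / \<epsilon>))"
    by (rule set_lebesgue_integral_cong) (auto simp: eq2)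
  also have "\<dots> = \<epsilon> * exp (- (t0 + T) / \<epsilon>) * ((p0 - c\<^sup>2 * T) / \<epsilon>)"
    using exp_tail(2)[OF \<epsilon>, of "t0 + T"] by (subst set_integral_mult_left) simp
  also have "\<Psi> (t0 + T) - \<Psi> t0 + \<dots> = exp (- (t0 + T) / \<epsilon>) * (1/2 * c\<^sup>2 * \<epsilon>) - exp (- t0 / \<epsilon>) * (1/2 * c\<^sup>2 * \<epsilon> - p0)"
    unfolding \<Psi>_def using \<epsilon> by (simp add: field_simps)
  also have "exp (- (t0 + T) / \<epsilon>) = exp (- t0 / \<epsilon>) * exp (- T / \<epsilon>)"
    by (simp add: add_divide_distrib diff_divide_distrib flip: exp_add)
  also have "exp (- t0 / \<epsilon>) * exp (- T / \<epsilon>) * (1/2 * c\<^sup>2 * \<epsilon>) - exp (- t0 / \<epsilon>) * (1/2 * c\<^sup>2 * \<epsilon> - p0) =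
    exp (- t0 / \<epsilon>) * (p0 - 1/2 * c\<^sup>2 * \<epsilon> * (1 - exp (- T / \<epsilon>)))"
  proof -
    have "X * Y * k - X * (k - p) = X * (p - k * (1 - Y))" for X Y k p :: real by (simp add: algebra_simps)
    then show ?thesis .
  qed
  finally show "(LINT s:{t0..}|lborel. b s) = exp (- t0 / \<epsilon>) * (p0 - 1/2 * c\<^sup>2 * \<epsilon> * (1 - exp (- T / \<epsilon>)))" .
qed

end


context wed_minimizer
begin

text \<open>The minimizer is followed up to \<open>t0\<close> and then continued along
  \<open>w\<close> at speed \<open>c\<close>. The costs before \<open>t0\<close> coincide and
  cancel, which turns minimality from time zero into a bound on the remaining cost from time
  \<open>t0\<close>.\<close>

lemma competitor:
  assumes t0: "0 \<le> t0" and p0: "\<phi> (u t0) = ereal p0" and w0: "w 0 = u t0"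
    and lip: "\<And>s t. 0 \<le> s \<Longrightarrow> 0 \<le> t \<Longrightarrow> dist (w s) (w t) \<le> \<bar>s - t\<bar>"
    and c: "0 \<le> c" and T: "0 \<le> T"
    and desc: "\<And>s. 0 \<le> s \<Longrightarrow> s \<le> T \<Longrightarrow> \<phi> (w (c * s)) \<le> ereal (p0 - c\<^sup>2 * s)"
  shows "(LINT s:{t0..}|lborel. lagr s) \<le> exp (- t0 / \<epsilon>) * (p0 - 1/2 * c\<^sup>2 * \<epsilon> * (1 - exp (- T / \<epsilon>)))"
proof -
  define \<tau> where "\<tau> s = c * min (s - t0) T" for s
  define v where "v s = (if s \<le> t0 then u s else w (\<tau> s))" for s
  \<comment> \<open>This is only a bound on the speed of \<open>v\<close>; it shows that
    \<open>v\<close> is locally absolutely continuous. The metric derivative proper, which the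
    functional contains, exists by the general theory and is compared with the bound below.\<close>
  define N0 where "N0 r = (if r < t0 then M r else c)" for r
  have N0m[measurable]: "N0 \<in> borel_measurable borel" unfolding N0_def[abs_def] by measurable
  have N00: "0 \<le> N0 r" for r using c M_nonneg by (simp add: N0_def)
  have \<tau>0: "0 \<le> \<tau> s" if "t0 \<le> s" for s using that c T by (simp add: \<tau>_def)
  have vt0: "v s = w (\<tau> s)" if "t0 \<le> s" for s using that w0 T by (cases "s = t0") (auto simp: v_def \<tau>_def)
  have v_le: "v s = u s" if "s \<le> t0" for s using that by (simp add: v_def)
  have d_after: "dist (v s) (v t) \<le> c * \<bar>s - t\<bar>" if "t0 \<le> s" "t0 \<le> t" for s t
  proof -
    have "dist (v s) (v t) \<le> \<bar>\<tau> s - \<tau> t\<bar>" unfolding vt0[OF that(1)] vt0[OF that(2)] by (intro lip \<tau>0 that)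
    also have "\<dots> = c * \<bar>min (s - t0) T - min (t - t0) T\<bar>" unfolding \<tau>_def right_diff_distrib[symmetric] using c by (simp add: abs_mult)
    also have "\<dots> \<le> c * \<bar>s - t\<bar>" by (rule mult_left_mono[OF _ c]) (auto simp: min_def)
    finally show ?thesis .
  qed
  have before: "ennreal (dist (v s) (v t)) \<le> (\<integral>\<^sup>+r. ennreal (N0 r) * indicator {s..t} r \<partial>lborel)" if "0 \<le> s" "s \<le> t" "t \<le> t0" for s t
  proof -
    have "ennreal (dist (v s) (v t)) \<le> (\<integral>\<^sup>+r. ennreal (M r) * indicator {s..t} r \<partial>lborel)"
      using metric_speedD(4)[OF speed that(1,2)] that by (simp add: v_le)
    also have "\<dots> = (\<integral>\<^sup>+r. ennreal (N0 r) * indicator {s..t} r \<partial>lborel)"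
      by (rule nn_integral_cong_AE) (use AE_lborel_singleton[of t0] in eventually_elim, use that in \<open>auto simp: N0_def indicator_def\<close>)
    finally show ?thesis .
  qed
  have after: "ennreal (dist (v s) (v t)) \<le> (\<integral>\<^sup>+r. ennreal (N0 r) * indicator {s..t} r \<partial>lborel)" if "t0 \<le> s" "s \<le> t" for s t
  proof -
    have "ennreal (dist (v s) (v t)) \<le> ennreal (c * (t - s))" using d_after[of s t] that by (intro ennreal_leI) auto
    also have "\<dots> = (\<integral>\<^sup>+r. ennreal c * indicator {s..t} r \<partial>lborel)" using that c by (simp add: nn_integral_cmult_indicator ennreal_mult)
    also have "\<dots> = (\<integral>\<^sup>+r. ennreal (N0 r) * indicator {s..t} r \<partial>lborel)"
      using that by (intro nn_integral_cong) (auto simp: N0_def indicator_def)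
    finally show ?thesis .
  qed
  have vdist: "ennreal (dist (v s) (v t)) \<le> (\<integral>\<^sup>+r. ennreal (N0 r) * indicator {s..t} r \<partial>lborel)" if "0 \<le> s" "s \<le> t" for s t
  proof -
    consider "t \<le> t0" | "t0 \<le> s" | "s < t0" "t0 < t" by linarith
    then show ?thesis
    proof cases
      case 3
      have "ennreal (dist (v s) (v t)) \<le> ennreal (dist (v s) (v t0)) + ennreal (dist (v t0) (v t))"
        by (simp add: dist_triangle flip: ennreal_plus)
      also have "\<dots> \<le> (\<integral>\<^sup>+r. ennreal (N0 r) * indicator {s..t0} r \<partial>lborel) + (\<integral>\<^sup>+r. ennreal (N0 r) * indicator {t0..t} r \<partial>lborel)"
        using 3 that by (intro add_mono before after) auto
      also have "\<dots> = (\<integral>\<^sup>+r. ennreal (N0 r) * indicator {s..t} r \<partial>lborel)"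
        using 3 by (intro nn_integral_Icc_split[symmetric]) auto
      finally show ?thesis .
    qed (use that before after in auto)
  qed
  have AC: "AC 2 {a..b} v" if "{a..b} \<subseteq> {0..}" for a b
  proof (rule AC_2I[OF N0m N00])
    show "(\<integral>\<^sup>+ t\<in>{a..b}. ennreal ((N0 t)\<^sup>2) \<partial>lborel) < \<infinity>"
    proof -
      have "(\<integral>\<^sup>+ t\<in>{a..b}. ennreal ((N0 t)\<^sup>2) \<partial>lborel) \<le>
        (\<integral>\<^sup>+t. ennreal ((M t)\<^sup>2) * indicator {0..b} t + ennreal (c\<^sup>2) * indicator {a..b} t \<partial>lborel)"
        using that by (intro nn_integral_mono) (auto simp: N0_def indicator_def)
      also have "\<dots> = (\<integral>\<^sup>+t. ennreal ((M t)\<^sup>2) * indicator {0..b} t \<partial>lborel) + ennreal (c\<^sup>2) * emeasure lborel {a..b}"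
        by (simp add: nn_integral_add nn_integral_cmult_indicator)
      also have "\<dots> < \<infinity>" using metric_speedD(3)[OF speed, of b] by (cases "a \<le> b") (auto simp: ennreal_mult_less_top)
      finally show ?thesis .
    qed
    show "ennreal (dist (v s) (v t)) \<le> (\<integral>\<^sup>+ x\<in>{s..t}. ennreal (N0 x) \<partial>lborel)" if "a \<le> s" "s \<le> t" "t \<le> b" for s t
      using that \<open>{a..b} \<subseteq> {0..}\<close> by (intro vdist) auto
  qed
  then have ACloc: "AC_loc 2 {0..} v" unfolding AC_loc_def by blast
  then obtain N where N: "metric_speed v N" by (rule AC_loc_metric_speed)
  \<comment> \<open>The metric derivative is local: before \<open>t0\<close> it is that of
    \<open>u\<close>, after \<open>t0\<close> the Lipschitz bound caps it at \<open>c\<close>, and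
    beyond \<open>t0 + T\<close> the curve rests. The junction times, where two regimes meet, are
    left out as a null set.\<close>
  have N_le: "AE s in lborel. s \<in> {0..} \<longrightarrow> metric_deriv {0..} v s = (if s < t0 then M s else metric_deriv {0..} v s) \<and>
    (t0 \<le> s \<longrightarrow> \<bar>metric_deriv {0..} v s\<bar> \<le> (if s < t0 + T then c else 0)) \<and> s \<noteq> t0"
    using metric_speedD(5)[OF N] metric_speedD(5)[OF speed] metric_speed_deriv[OF N]
      AE_lborel_singleton[of 0] AE_lborel_singleton[of t0] AE_lborel_singleton[of "t0 + T"]
  proof eventually_elim
    case (elim s)
    show ?case
    proof (intro impI)
      assume "s \<in> {0..}"
      then have s: "0 < s" "s \<noteq> t0" "s \<noteq> t0 + T" using elim by auto
      have lim: "((\<lambda>r. dist (v r) (v s) / \<bar>s - r\<bar>) \<longlongrightarrow> N s) (at s)" and md: "metric_deriv {0..} v s = N s"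
        using elim s by auto
      show "metric_deriv {0..} v s = (if s < t0 then M s else metric_deriv {0..} v s) \<and>
        (t0 \<le> s \<longrightarrow> \<bar>metric_deriv {0..} v s\<bar> \<le> (if s < t0 + T then c else 0)) \<and> s \<noteq> t0"
      proof (cases "s < t0")
        case True
        have ev: "\<forall>\<^sub>F r in at s. dist (v r) (v s) / \<bar>s - r\<bar> = dist (u r) (u s) / \<bar>s - r\<bar>"
          using eventually_at_in_open[of "{..<t0}" s] True by (auto simp: v_le elim!: eventually_mono)
        have "((\<lambda>r. dist (v r) (v s) / \<bar>s - r\<bar>) \<longlongrightarrow> M s) (at s)"
          using elim(2) s(1) tendsto_cong[OF ev] by simp
        then have "N s = M s" by (rule tendsto_unique[OF at_neq_bot lim])
        then show ?thesis using True md s by simp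
      next
        case False
        then have s': "t0 < s" using s by simp
        have le_c: "N s \<le> c"
        proof (rule tendsto_upperbound[OF lim])
          show "\<forall>\<^sub>F r in at s. dist (v r) (v s) / \<bar>s - r\<bar> \<le> c"
            using eventually_at_in_open[of "{t0<..}" s] s'
            by (auto simp: eventually_at_filter divide_le_eq d_after abs_minus_commute elim!: eventually_mono)
        qed simp
        have eq0: "N s = 0" if "t0 + T < s"
        proof -
          have "\<forall>\<^sub>F r in at s. dist (v r) (v s) / \<bar>s - r\<bar> = 0"
            using eventually_at_in_open[of "{t0 + T<..}" s] that T by (auto simp: vt0 \<tau>_def min_def elim!: eventually_mono)
          then have "((\<lambda>r. dist (v r) (v s) / \<bar>s - r\<bar>) \<longlongrightarrow> 0) (at s)" by (rule tendsto_eventually)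
          then show ?thesis by (rule tendsto_unique[OF at_neq_bot lim])
        qed
        show ?thesis using False md s le_c eq0 metric_speedD(2)[OF N, of s] by (auto simp: not_less)
      qed
    qed
  qed
  have vtraj: "v \<in> trajectories \<epsilon> ubar"
    unfolding trajectories_def
  proof (intro CollectI conjI ACloc)
    show "v 0 = ubar" using t0 u0 by (simp add: v_le)
    have "(\<integral>\<^sup>+ t\<in>{0..}. ennreal ((metric_deriv {0..} v t)\<^sup>2 * exp (- t / \<epsilon>)) \<partial>lborel) \<le>
      (\<integral>\<^sup>+s. ennreal (exp (- s / \<epsilon>)) * ennreal ((M s)\<^sup>2) * indicator {0..} s + ennreal (c\<^sup>2) * (ennreal (exp (- s / \<epsilon>)) * indicator {0..} s) \<partial>lborel)"
    proof (rule nn_integral_mono_AE)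
      show "AE t in lborel. ennreal ((metric_deriv {0..} v t)\<^sup>2 * exp (- t / \<epsilon>)) * indicator {0..} t \<le>
        ennreal (exp (- t / \<epsilon>)) * ennreal ((M t)\<^sup>2) * indicator {0..} t + ennreal (c\<^sup>2) * (ennreal (exp (- t / \<epsilon>)) * indicator {0..} t)"
        using N_le
      proof eventually_elim
        case (elim t)
        show ?case
        proof (cases "0 \<le> t")
          case True
          have "(metric_deriv {0..} v t)\<^sup>2 \<le> (M t)\<^sup>2 + c\<^sup>2"
          proof (cases "t < t0")
            case False
            then have "\<bar>metric_deriv {0..} v t\<bar> \<le> c" using elim True c by (auto split: if_splits)
            then have "(metric_deriv {0..} v t)\<^sup>2 \<le> c\<^sup>2" using power_mono[of "\<bar>metric_deriv {0..} v t\<bar>" c 2] by simp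
            then show ?thesis by (simp add: add_increasing)
          qed (use elim True in auto)
          then have "(metric_deriv {0..} v t)\<^sup>2 * exp (- t / \<epsilon>) \<le> exp (- t / \<epsilon>) * (M t)\<^sup>2 + c\<^sup>2 * exp (- t / \<epsilon>)"
            using mult_right_mono[of "(metric_deriv {0..} v t)\<^sup>2" "(M t)\<^sup>2 + c\<^sup>2" "exp (- t / \<epsilon>)"] by (simp add: algebra_simps)
          then show ?thesis using True by (simp add: ennreal_leI flip: ennreal_mult ennreal_plus)
        qed simp
      qed
    qed
    also have "\<dots> = (\<integral>\<^sup>+s. ennreal (exp (- s / \<epsilon>)) * ennreal ((M s)\<^sup>2) * indicator {0..} s \<partial>lborel) +
      ennreal (c\<^sup>2) * (\<integral>\<^sup>+s. ennreal (exp (- s / \<epsilon>)) * indicator {0..} s \<partial>lborel)"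
      by (simp add: nn_integral_add nn_integral_cmult)
    also have "\<dots> < \<infinity>"
      using trajectories_energy[OF traj speed] nn_integral_exp_tail[OF \<epsilon>, of 0] by (simp add: ennreal_mult_less_top)
    finally show "(\<integral>\<^sup>+ t\<in>{0..}. ennreal ((metric_deriv {0..} v t)\<^sup>2 * exp (- t / \<epsilon>)) \<partial>lborel) < \<infinity>" .
  qed
  define b where "b s = exp (- s / \<epsilon>) * (1/2 * (if s < t0 + T then c else 0)\<^sup>2 + (p0 - c\<^sup>2 * min (s - t0) T) / \<epsilon>)" for s
  note bI = competitor_integral[OF t0 T, of c p0, folded b_def]
  define g where "g s = (if s < t0 then lagr s else b s)" for s
  have l1: "set_integrable lborel {0..<t0} lagr" by (rule set_integrable_subset[OF lagr_integrable]) auto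
  have g1: "set_integrable lborel {0..<t0} g"
    using l1 by (rule set_integrable_cong[THEN iffD1, rotated -1]) (auto simp: g_def)
  have g2: "set_integrable lborel {t0..} g"
    using bI(1) by (rule set_integrable_cong[THEN iffD1, rotated -1]) (auto simp: g_def)
  have "{0..<t0} \<union> {t0..} = {0..}" using t0 by auto
  then have gI: "set_integrable lborel {0..} g" using set_integrable_Un[OF g1 g2] by auto
  have "ereal (LINT s:{0..}|lborel. lagr s) \<le> WED \<phi> \<epsilon> v" using minimal[OF vtraj] unfolding WED_u .
  also have "\<dots> \<le> ereal (LINT s:{0..}|lborel. g s)"
    unfolding WED_eq
  proof (rule ext_integral_le[OF gI])
    show "AE s in lborel. s \<in> {0..} \<longrightarrow> wed_density \<phi> \<epsilon> s (metric_deriv {0..} v s) (v s) \<le> ereal (g s)"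
      using N_le pot_finite
    proof eventually_elim
      case (elim s)
      show ?case
      proof (intro impI)
        assume s: "s \<in> {0..}"
        show "wed_density \<phi> \<epsilon> s (metric_deriv {0..} v s) (v s) \<le> ereal (g s)"
        proof (cases "s < t0")
          case True
          then have "metric_deriv {0..} v s = M s" "\<phi> (u s) < \<infinity>" using elim s by auto
          then show ?thesis using True s by (simp add: v_le density_eq(2) g_def)
        next
          case False
          then have st: "t0 \<le> s" by simp
          have "\<phi> (v s) \<le> ereal (p0 - c\<^sup>2 * min (s - t0) T)"
            unfolding vt0[OF st] \<tau>_def using st T by (intro desc) auto
          then show ?thesis using False elim s \<epsilon> unfolding g_def b_def by (simp only: if_False) (intro wed_density_le, auto)
        qed
      qed
    qed
  qed
  finally have "(LINT s:{0..}|lborel. lagr s) \<le> (LINT s:{0..}|lborel. g s)" by simp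
  moreover have "(LINT s:{0..}|lborel. lagr s) = (LINT s:{0..<t0}|lborel. lagr s) + (LINT s:{t0..}|lborel. lagr s)"
    by (rule set_integral_Ico_Ici[OF lagr_integrable t0])
  moreover have "(LINT s:{0..}|lborel. g s) = (LINT s:{0..<t0}|lborel. g s) + (LINT s:{t0..}|lborel. g s)"
    by (rule set_integral_Ico_Ici[OF gI t0])
  moreover have "(LINT s:{0..<t0}|lborel. g s) = (LINT s:{0..<t0}|lborel. lagr s)"
    by (rule set_lebesgue_integral_cong) (auto simp: g_def)
  moreover have "(LINT s:{t0..}|lborel. g s) = (LINT s:{t0..}|lborel. b s)"
    by (rule set_lebesgue_integral_cong) (auto simp: g_def)
  ultimately show ?thesis using bI(2) by simp
qed

end


context wed_minimizer
begin

text \<open>By minimality of \<open>u\<close> this remaining cost, rescaled to start at time \<open>0\<close>, is the minimal value of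
  the functional over curves issuing from \<open>u t\<close>.\<close>

definition val :: "real \<Rightarrow> real" where "val t = exp (t / \<epsilon>) * (LINT s:{t..}|lborel. lagr s)"

lemma val_le:
  assumes "0 \<le> t0" "\<phi> (u t0) = ereal p0" "w 0 = u t0"
    and "\<And>s t. 0 \<le> s \<Longrightarrow> 0 \<le> t \<Longrightarrow> dist (w s) (w t) \<le> \<bar>s - t\<bar>"
    and "0 \<le> c" "0 \<le> T" "\<And>s. 0 \<le> s \<Longrightarrow> s \<le> T \<Longrightarrow> \<phi> (w (c * s)) \<le> ereal (p0 - c\<^sup>2 * s)"
  shows "val t0 \<le> p0 - 1/2 * c\<^sup>2 * \<epsilon> * (1 - exp (- T / \<epsilon>))"
proof -
  have "val t0 \<le> exp (t0 / \<epsilon>) * (exp (- t0 / \<epsilon>) * (p0 - 1/2 * c\<^sup>2 * \<epsilon> * (1 - exp (- T / \<epsilon>))))"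
    unfolding val_def by (rule mult_left_mono[OF competitor[OF assms]]) auto
  also have "\<dots> = p0 - 1/2 * c\<^sup>2 * \<epsilon> * (1 - exp (- T / \<epsilon>))"
    unfolding mult.assoc[symmetric] by (simp flip: exp_add)
  finally show ?thesis .
qed

lemma val_le_phi:
  assumes "0 \<le> t" "\<phi> (u t) = ereal p0" shows "val t \<le> p0"
  using val_le[OF assms, of "\<lambda>_. u t" 0 0] assms by simp

text \<open>Coercivity centred at \<open>u t\<close> costs \<open>B / \<epsilon>\<close> times the
  weighted squared distance from \<open>u t\<close>. The Hardy inequality bounds this by
  \<open>4 * B * \<epsilon>\<close> times the weighted kinetic energy, and
  \<open>B\<epsilon>\<close> makes that factor at most one quarter, so the kinetic term with its
  factor one half absorbs it. The constants that remain are integrated against a weight whose total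
  mass, after the rescaling in \<open>val\<close>, is one.\<close>

lemma val_lower:
  assumes t: "0 \<le> t" shows "- (B * (dist (u t) ustar)\<^sup>2 + A) \<le> val t"
proof -
  let ?q = "B * (dist (u t) ustar)\<^sup>2 + A"
  define e where "e s = exp (- s / \<epsilon>)" for s
  define m2 where "m2 s = e s * (M s)\<^sup>2" for s
  define d2 where "d2 s = e s * (dist (u (max 0 s)) (u t))\<^sup>2" for s
  have [measurable]: "e \<in> borel_measurable borel" unfolding e_def[abs_def] by measurable
  have "continuous_on UNIV (\<lambda>s. dist (u (max 0 s)) (u t))"
    by (intro continuous_on_dist continuous_on_const continuous_on_compose2[OF metric_speed_continuous[OF speed], of UNIV "max 0"]
        continuous_on_max continuous_on_id) auto
  then have [measurable]: "(\<lambda>s. dist (u (max 0 s)) (u t)) \<in> borel_measurable borel" by (rule borel_measurable_continuous_onI)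
  have [measurable]: "m2 \<in> borel_measurable borel" "d2 \<in> borel_measurable borel"
    unfolding m2_def[abs_def] d2_def[abs_def] by measurable
  have e0: "0 \<le> e s" for s by (simp add: e_def)
  have m0: "0 \<le> m2 s" and d0: "0 \<le> d2 s" for s by (auto simp: m2_def d2_def e0)
  have meq: "(\<integral>\<^sup>+s. ennreal (exp (- s / \<epsilon>)) * ennreal ((M s)\<^sup>2) * indicator {t..} s \<partial>lborel)
     = (\<integral>\<^sup>+s. ennreal (indicator {t..} s *\<^sub>R m2 s) \<partial>lborel)"
    by (intro nn_integral_cong) (auto simp: m2_def e_def indicator_def simp flip: ennreal_mult)
  have deq: "(\<integral>\<^sup>+s. ennreal (exp (- s / \<epsilon>)) * ennreal ((dist (u s) (u t))\<^sup>2) * indicator {t..} s \<partial>lborel)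
     = (\<integral>\<^sup>+s. ennreal (indicator {t..} s *\<^sub>R d2 s) \<partial>lborel)"
    using t by (intro nn_integral_cong) (auto simp: d2_def e_def indicator_def max_absorb2 simp flip: ennreal_mult)
  have "(\<integral>\<^sup>+s. ennreal (exp (- s / \<epsilon>)) * ennreal ((M s)\<^sup>2) * indicator {t..} s \<partial>lborel)
    \<le> (\<integral>\<^sup>+s. ennreal (exp (- s / \<epsilon>)) * ennreal ((M s)\<^sup>2) * indicator {0..} s \<partial>lborel)"
    using t by (intro nn_integral_mono) (auto simp: indicator_def)
  then have mfin: "(\<integral>\<^sup>+s. ennreal (indicator {t..} s *\<^sub>R m2 s) \<partial>lborel) < \<infinity>"
    using trajectories_energy[OF traj speed] unfolding meq by (rule le_less_trans)
  have md: "(\<integral>\<^sup>+s. ennreal (indicator {t..} s *\<^sub>R d2 s) \<partial>lborel) \<le> ennreal (4 * \<epsilon>\<^sup>2) * (\<integral>\<^sup>+s. ennreal (indicator {t..} s *\<^sub>R m2 s) \<partial>lborel)"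
    using weighted_dist_le[OF speed \<epsilon> t] unfolding meq deq .
  also have "\<dots> < \<infinity>" using mfin by (simp add: ennreal_mult_less_top)
  finally have dfin: "(\<integral>\<^sup>+s. ennreal (indicator {t..} s *\<^sub>R d2 s) \<partial>lborel) < \<infinity>" .
  have mI: "set_integrable lborel {t..} m2" and dI: "set_integrable lborel {t..} d2"
    unfolding set_integrable_def using mfin dfin m0 d0 by (auto intro!: integrableI_nonneg)
  have eI: "set_integrable lborel {t..} e" "(LINT s:{t..}|lborel. e s) = \<epsilon> * e t"
    unfolding e_def[abs_def] using exp_tail[OF \<epsilon>, of t] by auto
  have nnE: "(\<integral>\<^sup>+s. ennreal (indicator {t..} s *\<^sub>R f s) \<partial>lborel) = ennreal (LINT s:{t..}|lborel. f s)"
    if "set_integrable lborel {t..} f" "\<And>s. 0 \<le> f s" for f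
    unfolding set_lebesgue_integral_def
    by (rule nn_integral_eq_integral[OF that(1)[unfolded set_integrable_def]]) (simp add: that(2))
  note mE = nnE[OF mI m0] and dE = nnE[OF dI d0]
  have Im0: "0 \<le> (LINT s:{t..}|lborel. m2 s)"
    unfolding set_lebesgue_integral_def by (intro integral_nonneg_AE) (auto simp: m0)
  have "ennreal (LINT s:{t..}|lborel. d2 s) \<le> ennreal (4 * \<epsilon>\<^sup>2 * (LINT s:{t..}|lborel. m2 s))"
    using md unfolding mE dE by (simp add: ennreal_mult')
  then have Id: "(LINT s:{t..}|lborel. d2 s) \<le> 4 * \<epsilon>\<^sup>2 * (LINT s:{t..}|lborel. m2 s)"
    using Im0 by simp
  have lI: "set_integrable lborel {t..} lagr" using t by (intro set_integrable_subset[OF lagr_integrable]) auto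
  note i1 = set_integrable_mult_right[of "1/2", OF mI] and i2 = set_integrable_mult_right[of "B / \<epsilon>", OF dI]
    and i3 = set_integrable_mult_right[of "?q / \<epsilon>", OF eI(1)]
  have "(LINT s:{t..}|lborel. 1/2 * m2 s - B / \<epsilon> * d2 s - ?q / \<epsilon> * e s) \<le> (LINT s:{t..}|lborel. lagr s)"
  proof (rule set_integral_mono_AE)
    show "set_integrable lborel {t..} (\<lambda>s. 1/2 * m2 s - B / \<epsilon> * d2 s - ?q / \<epsilon> * e s)"
      by (intro set_integral_diff(1) i1 i2 i3)
    show "AE s\<in>{t..} in lborel. 1/2 * m2 s - B / \<epsilon> * d2 s - ?q / \<epsilon> * e s \<le> lagr s"
      using pot_finite
    proof eventually_elim
      case (elim s)
      show ?case
      proof (intro impI)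
        assume s: "s \<in> {t..}"
        then have fin: "\<phi> (u s) < \<infinity>" "0 \<le> s" using elim t by auto
        have "- (B * (dist (u s) (u t))\<^sup>2 + ?q) \<le> pot s" using coercive[of "u s" "u t"] density_eq(1)[OF fin] by simp
        then have "- (B * (dist (u s) (u t))\<^sup>2 + ?q) / \<epsilon> \<le> pot s / \<epsilon>" using \<epsilon> by (intro divide_right_mono) auto
        then have "e s * (1/2 * (M s)\<^sup>2 + - (B * (dist (u s) (u t))\<^sup>2 + ?q) / \<epsilon>) \<le> lagr s"
          unfolding lagr_def e_def by (intro mult_left_mono) auto
        moreover have "e s * (1/2 * (M s)\<^sup>2 + - (B * (dist (u s) (u t))\<^sup>2 + ?q) / \<epsilon>) = 1/2 * m2 s - B / \<epsilon> * d2 s - ?q / \<epsilon> * e s"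
          using fin(2) by (simp add: m2_def d2_def max_absorb2 algebra_simps add_divide_distrib diff_divide_distrib)
        ultimately show "1/2 * m2 s - B / \<epsilon> * d2 s - ?q / \<epsilon> * e s \<le> lagr s" by simp
      qed
    qed
  qed (rule lI)
  moreover have "(LINT s:{t..}|lborel. 1/2 * m2 s - B / \<epsilon> * d2 s - ?q / \<epsilon> * e s)
    = 1/2 * (LINT s:{t..}|lborel. m2 s) - B / \<epsilon> * (LINT s:{t..}|lborel. d2 s) - ?q / \<epsilon> * (\<epsilon> * e t)"
  proof -
    have "(LINT s:{t..}|lborel. 1/2 * m2 s - B / \<epsilon> * d2 s - ?q / \<epsilon> * e s)
      = (LINT s:{t..}|lborel. 1/2 * m2 s) - (LINT s:{t..}|lborel. B / \<epsilon> * d2 s) - (LINT s:{t..}|lborel. ?q / \<epsilon> * e s)"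
      unfolding set_integral_diff(2)[OF set_integral_diff(1)[OF i1 i2] i3] set_integral_diff(2)[OF i1 i2] ..
    then show ?thesis unfolding set_integral_mult_right eI(2) .
  qed
  moreover have "B / \<epsilon> * (LINT s:{t..}|lborel. d2 s) \<le> 1/2 * (LINT s:{t..}|lborel. m2 s)"
  proof -
    have "B / \<epsilon> * (LINT s:{t..}|lborel. d2 s) \<le> B / \<epsilon> * (4 * \<epsilon>\<^sup>2 * (LINT s:{t..}|lborel. m2 s))"
      using Id AB \<epsilon> by (intro mult_left_mono) auto
    also have "\<dots> = (4 * B * \<epsilon>) * (LINT s:{t..}|lborel. m2 s)" using \<epsilon> by (simp add: power2_eq_square)
    also have "\<dots> \<le> 1/2 * (LINT s:{t..}|lborel. m2 s)"
    proof (rule mult_right_mono[OF _ Im0])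
      have "B * (16 * \<epsilon>) \<le> 1" using B\<epsilon> \<epsilon> by (simp add: field_simps)
      then show "4 * B * \<epsilon> \<le> 1/2" by simp
    qed
    finally show ?thesis .
  qed
  ultimately have "- (?q * e t) \<le> (LINT s:{t..}|lborel. lagr s)" using \<epsilon> by simp
  then have "exp (t / \<epsilon>) * - (?q * e t) \<le> val t" unfolding val_def by (intro mult_left_mono) auto
  moreover have "exp (t / \<epsilon>) * - (?q * e t) = - ?q"
  proof -
    have "exp (t / \<epsilon>) * e t = 1" unfolding e_def by (simp flip: exp_add)
    moreover have "x * - (q * y) = - q" if "x * y = 1" for x y q :: real using that by algebra
    ultimately show ?thesis by blast
  qed
  ultimately show ?thesis by simp
qed

text \<open>By the product rule, \<open>val\<close> formally satisfies
  \<open>val' = val / \<epsilon> - exp (t / \<epsilon>) * lagr t\<close>, and the last product is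
  half the squared speed plus the potential over \<open>\<epsilon>\<close>. As \<open>lagr\<close>
  is merely integrable, the integrated form is proved by exchanging integrals.\<close>

lemma val_energy:
  assumes a: "0 \<le> a" and ab: "a \<le> b"
  shows "set_integrable lborel {a..b} (\<lambda>r. 1/2 * (M r)\<^sup>2 + (pot r - val r) / \<epsilon>)"
    and "val a - val b = (LINT r:{a..b}|lborel. 1/2 * (M r)\<^sup>2 + (pot r - val r) / \<epsilon>)"
proof -
  define G where "G = (LINT s:{a..}|lborel. lagr s)"
  define J where "J r = (LINT s:{a..r}|lborel. lagr s)" for r
  \<comment> \<open>The derivative of the exponential factor. The other factor of the value at time
    \<open>r\<close> is \<open>G - J r\<close>, the total cost from \<open>a\<close> on less what is
    spent up to \<open>r\<close>.\<close>
  define g where "g r = exp (r / \<epsilon>) / \<epsilon>" for r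
  define h where "h r = 1/2 * (M r)\<^sup>2 + pot r / \<epsilon>" for r
  have la: "set_integrable lborel {a..} lagr" using a by (intro set_integrable_subset[OF lagr_integrable]) auto
  have l1: "set_integrable lborel {x..y} lagr" if "a \<le> x" for x y
    using that by (intro set_integrable_subset[OF la]) auto
  have valJ: "val r = exp (r / \<epsilon>) * (G - J r)" if "a \<le> r" for r
  proof -
    have "G = (LINT s:{a..<r}|lborel. lagr s) + (LINT s:{r..}|lborel. lagr s)"
      unfolding G_def by (rule set_integral_Ico_Ici[OF la that])
    moreover have "(LINT s:{a..<r}|lborel. lagr s) = J r" unfolding J_def
      by (rule set_integral_cong_set)
        (use AE_lborel_singleton[of r] in \<open>auto simp: set_borel_measurable_def\<close>)
    ultimately show ?thesis by (simp add: val_def)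
  qed
  have gd: "((\<lambda>r. exp (r / \<epsilon>)) has_real_derivative g r) (at r)" for r
    unfolding g_def using \<epsilon> by (auto intro!: derivative_eq_intros)
  have gc: "isCont g r" for r unfolding g_def using \<epsilon> by (intro continuous_intros) auto
  have gI: "set_integrable lborel {x..b} g" "(LINT r:{x..b}|lborel. g r) = exp (b / \<epsilon>) - exp (x / \<epsilon>)" if "x \<le> b" for x
  proof -
    have "has_bochner_integral lborel (\<lambda>r. g r * indicator {x..b} r) (exp (b / \<epsilon>) - exp (x / \<epsilon>))"
      by (rule has_bochner_integral_FTC_Icc_real) (use that gd gc in auto)
    then show "set_integrable lborel {x..b} g" "(LINT r:{x..b}|lborel. g r) = exp (b / \<epsilon>) - exp (x / \<epsilon>)"
      unfolding set_integrable_def set_lebesgue_integral_def by (auto simp: has_bochner_integral_iff mult.commute)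
  qed
  have hl: "h r = lagr r * exp (r / \<epsilon>)" for r
  proof -
    have "exp (- r / \<epsilon>) * exp (r / \<epsilon>) = 1" by (simp flip: exp_add)
    moreover have "k = (x * k) * y" if "x * y = 1" for x y k :: real using that by algebra
    ultimately show ?thesis unfolding h_def lagr_def by blast
  qed
  have hI: "set_integrable lborel {a..b} h"
  proof -
    have "integrable lborel (\<lambda>r. exp (b / \<epsilon>) * (indicator {a..b} r *\<^sub>R lagr r))"
      using l1[of a b] unfolding set_integrable_def by simp
    then show ?thesis unfolding set_integrable_def
    proof (rule Bochner_Integration.integrable_bound)
      show "(\<lambda>r. indicator {a..b} r *\<^sub>R h r) \<in> borel_measurable lborel" unfolding h_def by measurable
      show "AE r in lborel. norm (indicator {a..b} r *\<^sub>R h r) \<le> norm (exp (b / \<epsilon>) * (indicator {a..b} r *\<^sub>R lagr r))"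
        using \<epsilon> by (intro AE_I2) (auto simp: indicator_def hl abs_mult mult.commute intro!: mult_right_mono divide_right_mono)
    qed
  qed
  note FI = Fubini_indefinite[OF l1[OF order_refl] gI(1)[OF ab], folded J_def]
  have gJ: "(LINT r:{a..b}|lborel. g r * J r) = exp (b / \<epsilon>) * J b - (LINT r:{a..b}|lborel. h r)"
  proof -
    have "(LINT r:{a..b}|lborel. g r * J r) = (LINT x:{a..b}|lborel. exp (b / \<epsilon>) * lagr x - h x)"
      unfolding FI(1) by (rule set_lebesgue_integral_cong) (auto simp: gI(2) hl algebra_simps)
    also have "\<dots> = (LINT x:{a..b}|lborel. exp (b / \<epsilon>) * lagr x) - (LINT r:{a..b}|lborel. h r)"
      by (intro set_integral_diff hI set_integrable_mult_right l1) simp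
    finally show ?thesis by (simp add: J_def)
  qed
  have eq: "1/2 * (M r)\<^sup>2 + (pot r - val r) / \<epsilon> = (h r - G * g r) + g r * J r" if "r \<in> {a..b}" for r
  proof -
    have v: "val r = exp (r / \<epsilon>) * (G - J r)" using that by (intro valJ) auto
    show ?thesis unfolding v h_def g_def using \<epsilon> by (simp add: field_simps)
  qed
  have I1: "set_integrable lborel {a..b} (\<lambda>r. h r - G * g r)"
    by (intro set_integral_diff hI set_integrable_mult_right gI ab)
  have I2: "set_integrable lborel {a..b} (\<lambda>r. (h r - G * g r) + g r * J r)"
    by (rule set_integral_add(1)[OF I1 FI(2)])
  show "set_integrable lborel {a..b} (\<lambda>r. 1/2 * (M r)\<^sup>2 + (pot r - val r) / \<epsilon>)"
    by (rule set_integrable_cong[THEN iffD1, OF refl refl _ I2]) (rule eq[symmetric])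
  have "(LINT r:{a..b}|lborel. 1/2 * (M r)\<^sup>2 + (pot r - val r) / \<epsilon>) = (LINT r:{a..b}|lborel. (h r - G * g r) + g r * J r)"
    by (rule set_lebesgue_integral_cong) (simp, use eq in blast)
  also have "\<dots> = (LINT r:{a..b}|lborel. h r - G * g r) + (LINT r:{a..b}|lborel. g r * J r)"
    by (rule set_integral_add(2)[OF I1 FI(2)])
  also have "(LINT r:{a..b}|lborel. h r - G * g r) = (LINT r:{a..b}|lborel. h r) - (LINT r:{a..b}|lborel. G * g r)"
    by (intro set_integral_diff hI set_integrable_mult_right gI ab)
  also have "(LINT r:{a..b}|lborel. G * g r) = G * (exp (b / \<epsilon>) - exp (a / \<epsilon>))"
    using gI(2)[OF ab] by simp
  also have "(LINT r:{a..b}|lborel. h r) - G * (exp (b / \<epsilon>) - exp (a / \<epsilon>)) + (LINT r:{a..b}|lborel. g r * J r) = val a - val b"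
    unfolding gJ valJ[OF ab] using valJ[OF order_refl] by (simp add: J_def G_def val_def algebra_simps)
  finally show "val a - val b = (LINT r:{a..b}|lborel. 1/2 * (M r)\<^sup>2 + (pot r - val r) / \<epsilon>)" by simp
qed

text \<open>The resting competitor makes the integrand nonnegative almost everywhere; monotonicity
  follows. The identity can be restated with a nonnegative integral, the form in which Fatou will be
  applied, and with the energy itself in place of its real version.\<close>

lemma val_dissipation:
  assumes a: "0 \<le> a" and ab: "a \<le> b"
  shows "val b \<le> val a"
    and "(\<integral>\<^sup>+r. (ennreal (1/2 * (M r)\<^sup>2) + e2ennreal (\<phi> (u r) - ereal (val r)) / ennreal \<epsilon>) * indicator {a..b} r \<partial>lborel) = ennreal (val a - val b)"
proof -
  let ?f = "\<lambda>r. indicator {a..b} r *\<^sub>R (1/2 * (M r)\<^sup>2 + (pot r - val r) / \<epsilon>)"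
  have ae: "AE r in lborel. r \<in> {a..b} \<longrightarrow> \<phi> (u r) = ereal (pot r) \<and> val r \<le> pot r"
    using pot_finite
  proof eventually_elim
    case (elim r)
    then show ?case using a density_eq(1)[of r] val_le_phi[of r] by auto
  qed
  then have nn: "AE r in lborel. 0 \<le> ?f r" by eventually_elim (use \<epsilon> in \<open>auto simp: indicator_def\<close>)
  have "0 \<le> (\<integral>r. ?f r \<partial>lborel)" by (rule integral_nonneg_AE[OF nn])
  then show "val b \<le> val a" using val_energy(2)[OF a ab] by (simp add: set_lebesgue_integral_def)
  have "(\<integral>\<^sup>+r. (ennreal (1/2 * (M r)\<^sup>2) + e2ennreal (\<phi> (u r) - ereal (val r)) / ennreal \<epsilon>) * indicator {a..b} r \<partial>lborel)
    = (\<integral>\<^sup>+r. ennreal (?f r) \<partial>lborel)"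
  proof (rule nn_integral_cong_AE)
    show "AE r in lborel. (ennreal (1/2 * (M r)\<^sup>2) + e2ennreal (\<phi> (u r) - ereal (val r)) / ennreal \<epsilon>) * indicator {a..b} r = ennreal (?f r)"
      using ae
    proof eventually_elim
      case (elim r)
      show ?case
      proof (cases "r \<in> {a..b}")
        case True
        then have "e2ennreal (\<phi> (u r) - ereal (val r)) / ennreal \<epsilon> = ennreal ((pot r - val r) / \<epsilon>)"
          using elim \<epsilon> by (simp add: divide_ennreal)
        then show ?thesis using True elim \<epsilon> by (simp flip: ennreal_plus)
      qed simp
    qed
  qed
  also have "\<dots> = ennreal (\<integral>r. ?f r \<partial>lborel)"
    by (rule nn_integral_eq_integral[OF _ nn]) (use val_energy(1)[OF a ab] in \<open>simp add: set_integrable_def\<close>)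
  also have "(\<integral>r. ?f r \<partial>lborel) = val a - val b" using val_energy(2)[OF a ab] by (simp add: set_lebesgue_integral_def)
  finally show "(\<integral>\<^sup>+r. (ennreal (1/2 * (M r)\<^sup>2) + e2ennreal (\<phi> (u r) - ereal (val r)) / ennreal \<epsilon>) * indicator {a..b} r \<partial>lborel) = ennreal (val a - val b)" .
qed

end


section \<open>The vanishing parameter limit\<close>

text \<open>\<open>F k t\<close> stands for the value \<open>val\<close> at time \<open>t\<close> along the minimizer \<open>U k\<close>; from here on only the
  listed properties of the two matter.\<close>

locale wed_limit = wed_functional \<sigma> \<phi> ustar A B
  for \<sigma> :: "'a::complete_space topology" and \<phi> ustar A B +
  fixes ubar :: 'a and p0 :: real and eps :: "nat \<Rightarrow> real" and U :: "nat \<Rightarrow> real \<Rightarrow> 'a"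
    and Ms :: "nat \<Rightarrow> real \<Rightarrow> real" and F :: "nat \<Rightarrow> real \<Rightarrow> real"
  assumes p0: "\<phi> ubar = ereal p0" and eps_pos: "\<And>k. 0 < eps k" and eps_lim: "eps \<longlonglongrightarrow> 0"
    and U0: "\<And>k. U k 0 = ubar" and speed: "\<And>k. metric_speed (U k) (Ms k)"
    and F_phi: "\<And>k t p. 0 \<le> t \<Longrightarrow> \<phi> (U k t) = ereal p \<Longrightarrow> F k t \<le> p"
    and F_comp: "\<And>k t p c T w. 0 \<le> t \<Longrightarrow> \<phi> (U k t) = ereal p \<Longrightarrow> w 0 = U k t \<Longrightarrow>
      (\<And>s t. 0 \<le> s \<Longrightarrow> 0 \<le> t \<Longrightarrow> dist (w s) (w t) \<le> \<bar>s - t\<bar>) \<Longrightarrow> 0 \<le> c \<Longrightarrow> 0 \<le> T \<Longrightarrow>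
      (\<And>s. 0 \<le> s \<Longrightarrow> s \<le> T \<Longrightarrow> \<phi> (w (c * s)) \<le> ereal (p - c\<^sup>2 * s)) \<Longrightarrow>
      F k t \<le> p - 1/2 * c\<^sup>2 * eps k * (1 - exp (- T / eps k))"
    and F_lower: "\<And>k t. 0 \<le> t \<Longrightarrow> - (B * (dist (U k t) ustar)\<^sup>2 + A) \<le> F k t"
    and F_antimono: "\<And>k a b. 0 \<le> a \<Longrightarrow> a \<le> b \<Longrightarrow> F k b \<le> F k a"
    and F_diss: "\<And>k a b. 0 \<le> a \<Longrightarrow> a \<le> b \<Longrightarrow>
      (\<integral>\<^sup>+r. (ennreal (1/2 * (Ms k r)\<^sup>2) + e2ennreal (\<phi> (U k r) - ereal (F k r)) / ennreal (eps k)) * indicator {a..b} r \<partial>lborel)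
       = ennreal (F k a - F k b)"
begin

lemma Ms_measurable[measurable]: "Ms k \<in> borel_measurable borel"
  using metric_speedD(1)[OF speed] .

lemma F_le: "0 \<le> t \<Longrightarrow> F k t \<le> p0"
  using F_antimono[of 0 t k] F_phi[of 0 k p0] p0 by (simp add: U0)

text \<open>Before the limit this quantity plays the part of half the squared slope. The truncation
  in \<open>e2ennreal\<close> loses nothing at nonnegative times, because there \<open>F\<close>
  does not exceed the energy.\<close>

definition excess :: "nat \<Rightarrow> real \<Rightarrow> ennreal" where
  "excess k r = e2ennreal (\<phi> (U k r) - ereal (F k r)) / ennreal (eps k)"

lemma excess_measurable[measurable]: "(\<lambda>r. excess k (max 0 r)) \<in> borel_measurable borel"
proof -
  have "mono (\<lambda>r. - F k (max 0 r))" unfolding mono_def by (auto intro!: F_antimono)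
  then have "(\<lambda>r. - (- F k (max 0 r))) \<in> borel_measurable borel" by (intro borel_measurable_uminus borel_measurable_mono)
  then have [measurable]: "(\<lambda>r. F k (max 0 r)) \<in> borel_measurable borel" by simp
  have [measurable]: "(\<lambda>t. \<phi> (U k (max 0 t))) \<in> borel_measurable borel"
    by (rule phi_curve_measurable[OF metric_speed_continuous[OF speed]])
  show ?thesis unfolding excess_def by measurable
qed

lemma dissipation:
  assumes a: "0 \<le> a" "a \<le> b"
  shows "(\<integral>\<^sup>+r. ennreal (1/2 * (Ms k r)\<^sup>2) * indicator {a..b} r \<partial>lborel) + (\<integral>\<^sup>+r. excess k r * indicator {a..b} r \<partial>lborel)
    = ennreal (F k a - F k b)"
proof -
  have e: "(\<integral>\<^sup>+r. excess k r * indicator {a..b} r \<partial>lborel) = (\<integral>\<^sup>+r. excess k (max 0 r) * indicator {a..b} r \<partial>lborel)"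
    using a by (intro nn_integral_cong) (auto simp: indicator_def max_absorb2)
  have "(\<integral>\<^sup>+r. ennreal (1/2 * (Ms k r)\<^sup>2) * indicator {a..b} r \<partial>lborel) + (\<integral>\<^sup>+r. excess k r * indicator {a..b} r \<partial>lborel)
    = (\<integral>\<^sup>+r. ennreal (1/2 * (Ms k r)\<^sup>2) * indicator {a..b} r + excess k (max 0 r) * indicator {a..b} r \<partial>lborel)"
    unfolding e by (rule nn_integral_add[symmetric]) measurable
  also have "\<dots> = (\<integral>\<^sup>+r. (ennreal (1/2 * (Ms k r)\<^sup>2) + e2ennreal (\<phi> (U k r) - ereal (F k r)) / ennreal (eps k)) * indicator {a..b} r \<partial>lborel)"
    using a by (intro nn_integral_cong) (auto simp: indicator_def max_absorb2 excess_def)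
  finally show ?thesis using F_diss[OF a] by simp
qed

lemma kinetic_le:
  assumes "0 \<le> a" "a \<le> b"
  obtains y where "0 \<le> y" "(\<integral>\<^sup>+r. ennreal ((Ms k r)\<^sup>2) * indicator {a..b} r \<partial>lborel) = ennreal y"
    "1/2 * y \<le> F k a - F k b" "(dist (U k a) (U k b))\<^sup>2 \<le> (b - a) * y"
proof -
  define Y where "Y = (\<integral>\<^sup>+r. ennreal ((Ms k r)\<^sup>2) * indicator {a..b} r \<partial>lborel)"
  have half: "ennreal (1/2) * Y = (\<integral>\<^sup>+r. ennreal (1/2 * (Ms k r)\<^sup>2) * indicator {a..b} r \<partial>lborel)"
  proof -
    have "ennreal (1/2 * (Ms k r)\<^sup>2) * indicator {a..b} r = ennreal (1/2) * (ennreal ((Ms k r)\<^sup>2) * indicator {a..b} r)" for r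
      by (subst ennreal_mult) (simp_all add: mult.assoc)
    then show ?thesis unfolding Y_def by (simp only:) (rule nn_integral_cmult[symmetric], measurable)
  qed
  have le: "ennreal (1/2) * Y \<le> ennreal (F k a - F k b)"
    unfolding half dissipation[OF assms, symmetric] by simp
  have "Y \<noteq> \<infinity>" using le by (auto simp: ennreal_mult_top top_unique)
  then obtain y where y: "Y = ennreal y" "0 \<le> y" by (cases Y) auto
  have "ennreal (1/2 * y) = ennreal (1/2) * ennreal y" by (rule ennreal_mult) (use y in auto)
  then have "ennreal (1/2 * y) \<le> ennreal (F k a - F k b)" using le unfolding y(1) by simp
  then have "1/2 * y \<le> F k a - F k b" using F_antimono[OF assms, of k] by simp
  moreover have "ennreal ((dist (U k a) (U k b))\<^sup>2) \<le> ennreal ((b - a) * y)"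
    using metric_speed_dist_sq[OF speed assms, of k] assms y unfolding Y_def[symmetric] by (simp add: ennreal_mult)
  then have "(dist (U k a) (U k b))\<^sup>2 \<le> (b - a) * y" using assms y(2) by simp
  ultimately show ?thesis using that[OF y(2)] y(1) unfolding Y_def by blast
qed

text \<open>On an interval of length \<open>\<tau>\<close> the dissipation absorbs the quadratic lower bound on \<open>F\<close>.\<close>

lemma dist_bound_step:
  defines "\<tau> \<equiv> 1 / (8 * (B + 1))"
  shows "\<exists>R\<ge>0. \<forall>k. \<forall>t\<in>{0..real n * \<tau>}. dist (U k t) ustar \<le> R"
proof (induction n)
  case 0
  show ?case by (intro exI[of _ "dist ubar ustar"]) (auto simp: U0)
next
  case (Suc n)
  then obtain R where R: "0 \<le> R" "\<And>k t. 0 \<le> t \<Longrightarrow> t \<le> real n * \<tau> \<Longrightarrow> dist (U k t) ustar \<le> R" by auto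
  \<comment> \<open>Squaring the triangle inequality turns the lower bound on \<open>F\<close> into
    a term of at most \<open>2 * B * \<tau> * y\<close>, to be absorbed into \<open>1/2 * y\<close>;
    the length \<open>\<tau>\<close> makes it at most a quarter of \<open>y\<close>. The summand one
    in its denominator provides for \<open>B = 0\<close>.\<close>
  have \<tau>: "0 < \<tau>" "2 * B * \<tau> \<le> 1/4" using AB by (auto simp: \<tau>_def field_simps)
  define s where "s = real n * \<tau>"
  have s0: "0 \<le> s" using \<tau> by (simp add: s_def)
  define P where "P = \<bar>p0\<bar>"
  have P: "p0 \<le> P" "0 \<le> P" by (auto simp: P_def)
  define Z where "Z = B * R\<^sup>2"
  define Y where "Y = 4 * P + 4 * A + 8 * Z"
  define R' where "R' = sqrt (2 * R\<^sup>2 + 2 * \<tau> * Y)"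
  have far: "dist (U k t) ustar \<le> R'" if t: "s \<le> t" "t \<le> s + \<tau>" for k t
  proof -
    obtain y where y: "0 \<le> y" "1/2 * y \<le> F k s - F k t" "(dist (U k s) (U k t))\<^sup>2 \<le> (t - s) * y"
      using kinetic_le[OF s0 t(1)] by blast
    have t0: "0 \<le> t" using s0 t by linarith
    define D where "D = dist (U k t) ustar"
    have "(t - s) * y \<le> \<tau> * y" using t y(1) by (intro mult_right_mono) auto
    then have d: "(dist (U k s) (U k t))\<^sup>2 \<le> \<tau> * y" using y(3) by linarith
    have "D \<le> R + dist (U k s) (U k t)" unfolding D_def
      using dist_triangle[of "U k t" ustar "U k s"] R(2)[of s k] s0 by (simp add: s_def dist_commute)
    then have "D\<^sup>2 \<le> (R + dist (U k s) (U k t))\<^sup>2" by (intro power_mono) (auto simp: D_def)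
    also have "\<dots> \<le> 2 * R\<^sup>2 + 2 * (dist (U k s) (U k t))\<^sup>2"
      using zero_le_power2[of "R - dist (U k s) (U k t)"] by (simp add: power2_eq_square algebra_simps)
    finally have D: "D\<^sup>2 \<le> 2 * R\<^sup>2 + 2 * (\<tau> * y)" using d by linarith
    have y1: "1/2 * y \<le> p0 + (B * D\<^sup>2 + A)"
      using y(2) F_le[OF s0, of k] F_lower[OF t0, of k] unfolding D_def by linarith
    have "B * D\<^sup>2 \<le> B * (2 * R\<^sup>2 + 2 * (\<tau> * y))" using D AB by (intro mult_left_mono) auto
    moreover have "B * (2 * R\<^sup>2 + 2 * (\<tau> * y)) = 2 * Z + (2 * B * \<tau>) * y" by (simp add: Z_def algebra_simps)
    moreover have "(2 * B * \<tau>) * y \<le> 1/4 * y" using \<tau>(2) y(1) by (rule mult_right_mono)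
    ultimately have "1/2 * y \<le> P + A + 2 * Z + 1/4 * y" using y1 P by linarith
    then have "y \<le> Y" unfolding Y_def by linarith
    then have "\<tau> * y \<le> \<tau> * Y" using \<tau>(1) by (intro mult_left_mono) auto
    then have "D\<^sup>2 \<le> 2 * R\<^sup>2 + 2 * \<tau> * Y" using D by simp
    then show ?thesis unfolding R'_def D_def by (rule real_le_rsqrt)
  qed
  have "dist (U k t) ustar \<le> max R R'" if "0 \<le> t" "t \<le> real (Suc n) * \<tau>" for k t
  proof (cases "t \<le> s")
    case True
    then show ?thesis using R(2)[of t k] that by (simp add: s_def le_max_iff_disj)
  next
    case False
    then have "s \<le> t" "t \<le> s + \<tau>" using that by (auto simp: s_def distrib_right)
    then show ?thesis using far[of t k] by (simp add: le_max_iff_disj)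
  qed
  then show ?case using R(1) by (intro exI[of _ "max R R'"]) auto
qed

text \<open>Once distances are bounded, \<open>F\<close> is bounded below uniformly in
  \<open>k\<close>. Twice its drop bounds the kinetic energy, whence the factor two in
  \<open>C\<close>, and Cauchy-Schwarz turns this into a uniform Hoelder modulus of exponent one
  half.\<close>

lemma bounds:
  obtains R C where "0 \<le> R" "0 < C" "\<And>k t. 0 \<le> t \<Longrightarrow> t \<le> T \<Longrightarrow> dist (U k t) ustar \<le> R"
    "\<And>k s t. 0 \<le> s \<Longrightarrow> s \<le> t \<Longrightarrow> t \<le> T \<Longrightarrow> F k s - F k t \<le> C"
    "\<And>k s t. 0 \<le> s \<Longrightarrow> 0 \<le> t \<Longrightarrow> s \<le> T \<Longrightarrow> t \<le> T \<Longrightarrow> dist (U k s) (U k t) \<le> sqrt (\<bar>s - t\<bar> * C)"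
    "\<And>k. (\<integral>\<^sup>+r. ennreal ((Ms k r)\<^sup>2) * indicator {0..T} r \<partial>lborel) \<le> ennreal C"
proof -
  let ?\<tau> = "1 / (8 * (B + 1))"
  have "0 < ?\<tau>" using AB by simp
  then obtain n :: nat where n: "T < real n * ?\<tau>" by (metis reals_Archimedean3)
  obtain R where R: "0 \<le> R" "\<forall>k. \<forall>t\<in>{0..real n * ?\<tau>}. dist (U k t) ustar \<le> R" using dist_bound_step[of n] by auto
  have dR: "dist (U k t) ustar \<le> R" if "0 \<le> t" "t \<le> T" for k t using R(2) that n by auto
  define P where "P = \<bar>p0\<bar>"
  have P: "p0 \<le> P" "0 \<le> P" by (auto simp: P_def)
  define Z where "Z = B * R\<^sup>2"
  define C where "C = 2 * P + 2 * Z + 2 * A + 1"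
  have BR: "0 \<le> Z" using AB by (simp add: Z_def)
  have C0: "0 < C" unfolding C_def using BR AB(1) P(2) by linarith
  have FC: "2 * F k s - 2 * F k t \<le> C" if "0 \<le> s" "s \<le> t" "t \<le> T" for k s t
  proof -
    have "(dist (U k t) ustar)\<^sup>2 \<le> R\<^sup>2" using dR[of t k] that by (intro power_mono) auto
    then have "B * (dist (U k t) ustar)\<^sup>2 \<le> Z" unfolding Z_def using AB by (intro mult_left_mono) auto
    moreover have t0: "0 \<le> t" using that by linarith
    ultimately show ?thesis
      using F_le[OF that(1), of k] F_lower[OF t0, of k] P unfolding C_def by linarith
  qed
  have FC1: "F k s - F k t \<le> C" if "0 \<le> s" "s \<le> t" "t \<le> T" for k s t using FC[OF that, of k] C0 by linarith
  have Hm: "dist (U k s) (U k t) \<le> sqrt (\<bar>s - t\<bar> * C)" if st: "0 \<le> s" "s \<le> t" "t \<le> T" for k s t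
  proof -
    obtain y where y: "0 \<le> y" "1/2 * y \<le> F k s - F k t" "(dist (U k s) (U k t))\<^sup>2 \<le> (t - s) * y"
      using kinetic_le[OF st(1,2)] by blast
    have "y \<le> C" using y(2) FC[OF st, of k] by linarith
    then have "(t - s) * y \<le> \<bar>s - t\<bar> * C" using st y(1) by (intro mult_mono) auto
    then show ?thesis using y(3) by (intro real_le_rsqrt) linarith
  qed
  have H: "dist (U k s) (U k t) \<le> sqrt (\<bar>s - t\<bar> * C)" if "0 \<le> s" "0 \<le> t" "s \<le> T" "t \<le> T" for k s t
    using Hm[of s t k] Hm[of t s k] that by (cases "s \<le> t") (auto simp: dist_commute abs_minus_commute)
  have K: "(\<integral>\<^sup>+r. ennreal ((Ms k r)\<^sup>2) * indicator {0..T} r \<partial>lborel) \<le> ennreal C" for k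
  proof (cases "0 \<le> T")
    case True
    obtain y where y: "0 \<le> y" "(\<integral>\<^sup>+r. ennreal ((Ms k r)\<^sup>2) * indicator {0..T} r \<partial>lborel) = ennreal y" "1/2 * y \<le> F k 0 - F k T"
      using kinetic_le[OF order_refl True, of k] by blast
    have "y \<le> C" using y(3) FC[OF order_refl True order_refl, of k] by linarith
    then show ?thesis using y(2) by (simp add: ennreal_leI)
  qed simp
  show ?thesis by (rule that[OF R(1) C0 dR FC1 H K])
qed

text \<open>The integrated excess forces the energy to be almost below the value \<open>F\<close> at some time shortly
  after any given \<open>t\<close>; this replaces a pointwise energy bound along the minimizers.\<close>

lemma good_times:
  assumes t: "0 \<le> t"
  obtains t' \<delta> where "\<And>k. t \<le> t' k" "\<And>k. t' k \<le> t + 1" "t' \<longlonglongrightarrow> t" "\<delta> \<longlonglongrightarrow> 0"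
    "\<forall>\<^sub>F k in sequentially. \<phi> (U k (t' k)) \<le> ereal (F k t + \<delta> k)"
    "(\<lambda>k. dist (U k (t' k)) (U k t)) \<longlonglongrightarrow> 0"
proof -
  obtain C where C: "0 < C" "\<And>k s r. 0 \<le> s \<Longrightarrow> s \<le> r \<Longrightarrow> r \<le> t + 1 \<Longrightarrow> F k s - F k r \<le> C"
    "\<And>k s r. 0 \<le> s \<Longrightarrow> 0 \<le> r \<Longrightarrow> s \<le> t + 1 \<Longrightarrow> r \<le> t + 1 \<Longrightarrow> dist (U k s) (U k r) \<le> sqrt (\<bar>s - r\<bar> * C)"
    by (rule bounds[of "t + 1"]) blast
  \<comment> \<open>If the energy exceeded \<open>F k t\<close> by more than
    \<open>\<delta> k\<close> throughout an interval of length \<open>\<delta> k\<close>, the excess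
    would dissipate at least \<open>(\<delta> k)\<^sup>2 / eps k\<close>. This equals
    \<open>C + 1\<close>, more than the total available.\<close>
  define \<delta> where "\<delta> k = sqrt (eps k * (C + 1))" for k
  have \<delta>0: "0 < \<delta> k" for k using eps_pos[of k] C(1) by (simp add: \<delta>_def)
  have "\<delta> \<longlonglongrightarrow> sqrt (0 * (C + 1))" unfolding \<delta>_def by (intro tendsto_intros eps_lim)
  then have \<delta>lim: "\<delta> \<longlonglongrightarrow> 0" by simp
  have ex: "\<exists>r. t \<le> r \<and> r \<le> t + \<delta> k \<and> \<phi> (U k r) \<le> ereal (F k t + \<delta> k)" if \<delta>1: "\<delta> k \<le> 1" for k
  proof (rule ccontr)
    assume no: "\<not> ?thesis"
    have le: "ennreal (\<delta> k / eps k) \<le> excess k r" if r: "t \<le> r" "r \<le> t + \<delta> k" for r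
    proof -
      have gt: "ereal (F k t + \<delta> k) < \<phi> (U k r)" using no r not_le by blast
      have "F k r \<le> F k t" using t r by (intro F_antimono) auto
      then have "ereal (\<delta> k) \<le> \<phi> (U k r) - ereal (F k r)" using gt by (cases "\<phi> (U k r)") auto
      then have "ennreal (\<delta> k) \<le> e2ennreal (\<phi> (U k r) - ereal (F k r))" using e2ennreal_mono by fastforce
      then have "ennreal (\<delta> k) / ennreal (eps k) \<le> excess k r" unfolding excess_def by (rule divide_right_mono_ennreal)
      then show ?thesis using \<delta>0[of k] eps_pos[of k] by (simp add: divide_ennreal)
    qed
    have "ennreal (\<delta> k / eps k * \<delta> k) = (\<integral>\<^sup>+r. ennreal (\<delta> k / eps k) * indicator {t..t + \<delta> k} r \<partial>lborel)"
      using \<delta>0[of k] eps_pos[of k] by (simp add: nn_integral_cmult_indicator ennreal_mult del: times_divide_eq_left)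
    also have "\<dots> \<le> (\<integral>\<^sup>+r. excess k r * indicator {t..t + \<delta> k} r \<partial>lborel)"
      using le by (intro nn_integral_mono) (auto simp: indicator_def)
    also have "\<dots> \<le> ennreal (F k t - F k (t + \<delta> k))"
    proof -
      have tt: "t \<le> t + \<delta> k" using \<delta>0[of k] by simp
      show ?thesis unfolding dissipation[OF t tt, symmetric] by (simp add: add_increasing)
    qed
    also have "\<dots> \<le> ennreal C" using t \<delta>0[of k] \<delta>1 by (intro ennreal_leI C(2)) auto
    finally have "\<delta> k / eps k * \<delta> k \<le> C" using C(1) by simp
    moreover have "\<delta> k / eps k * \<delta> k = C + 1"
    proof -
      have "\<delta> k * \<delta> k = eps k * (C + 1)" unfolding \<delta>_def using eps_pos[of k] C(1) by simp
      then show ?thesis using eps_pos[of k] by (simp add: field_simps)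
    qed
    ultimately show False by simp
  qed
  \<comment> \<open>Where \<open>\<delta> k\<close> exceeds one, which happens for finitely many
    \<open>k\<close> only, the value \<open>t\<close> is a placeholder; it makes the bounds on
    \<open>t'\<close> hold for all \<open>k\<close>.\<close>
  define t' where "t' k = (if \<delta> k \<le> 1 then SOME r. t \<le> r \<and> r \<le> t + \<delta> k \<and> \<phi> (U k r) \<le> ereal (F k t + \<delta> k) else t)" for k
  have t': "t \<le> t' k \<and> t' k \<le> t + \<delta> k \<and> \<phi> (U k (t' k)) \<le> ereal (F k t + \<delta> k)" if "\<delta> k \<le> 1" for k
    using someI_ex[OF ex[OF that]] that by (simp add: t'_def)
  have b: "t \<le> t' k" "t' k \<le> t + 1" "t' k \<le> t + \<delta> k" for k
    using t'[of k] \<delta>0[of k] by (cases "\<delta> k \<le> 1"; auto simp: t'_def)+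
  have t'lim: "t' \<longlonglongrightarrow> t"
  proof (rule tendsto_sandwich[of "\<lambda>_. t" _ _ "\<lambda>k. t + \<delta> k"])
    show "(\<lambda>k. t + \<delta> k) \<longlonglongrightarrow> t" using tendsto_add[OF tendsto_const \<delta>lim, of t] by simp
  qed (use b in auto)
  have "\<forall>\<^sub>F k in sequentially. \<delta> k < 1" using \<delta>lim by (rule order_tendstoD) simp
  then have ev: "\<forall>\<^sub>F k in sequentially. \<phi> (U k (t' k)) \<le> ereal (F k t + \<delta> k)"
    by eventually_elim (use t' in auto)
  have "(\<lambda>k. dist (U k (t' k)) (U k t)) \<longlonglongrightarrow> 0"
  proof (rule tendsto_sandwich[of "\<lambda>_. 0" _ _ "\<lambda>k. sqrt (\<bar>t' k - t\<bar> * C)"])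
    have "(\<lambda>k. sqrt (\<bar>t' k - t\<bar> * C)) \<longlonglongrightarrow> sqrt (\<bar>t - t\<bar> * C)" by (intro tendsto_intros t'lim)
    then show "(\<lambda>k. sqrt (\<bar>t' k - t\<bar> * C)) \<longlonglongrightarrow> 0" by simp
    have "dist (U k (t' k)) (U k t) \<le> sqrt (\<bar>t' k - t\<bar> * C)" for k
      using b[of k] t by (intro C(3)) auto
    then show "\<forall>\<^sub>F k in sequentially. dist (U k (t' k)) (U k t) \<le> sqrt (\<bar>t' k - t\<bar> * C)" by simp
  qed auto
  then show ?thesis using that[OF b(1,2) t'lim \<delta>lim ev] by blast
qed

text \<open>The energies at time \<open>t\<close> itself may be infinite or unbounded in
  \<open>k\<close>. Compactness is applied at the good times nearby, where the energy is eventually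
  below \<open>p0 + 1\<close>, and the limit is carried over to \<open>t\<close> because the
  distances vanish.\<close>

lemma pointwise_compact:
  assumes t: "0 \<le> t" and r: "strict_mono (r::nat\<Rightarrow>nat)"
  shows "\<exists>r' l. strict_mono (r'::nat\<Rightarrow>nat) \<and> limitin \<sigma> (\<lambda>n. U (r (r' n)) t) l sequentially"
proof -
  obtain t' \<delta> where g: "\<And>k. t \<le> t' k" "\<And>k. t' k \<le> t + 1" "\<delta> \<longlonglongrightarrow> 0"
    "\<forall>\<^sub>F k in sequentially. \<phi> (U k (t' k)) \<le> ereal (F k t + \<delta> k)"
    "(\<lambda>k. dist (U k (t' k)) (U k t)) \<longlonglongrightarrow> 0"
    by (rule good_times[OF t]) blast
  obtain R where R: "\<And>k s. 0 \<le> s \<Longrightarrow> s \<le> t + 1 \<Longrightarrow> dist (U k s) ustar \<le> R"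
    by (rule bounds[of "t + 1"]) blast
  have "\<forall>\<^sub>F k in sequentially. \<delta> k < 1" using g(3) by (rule order_tendstoD) simp
  with g(4) have "\<forall>\<^sub>F k in sequentially. \<phi> (U k (t' k)) \<le> ereal (p0 + 1)"
  proof eventually_elim
    case (elim k)
    have "ereal (F k t + \<delta> k) \<le> ereal (p0 + 1)" using F_le[OF t, of k] elim by simp
    then show ?case using elim(1) by (rule order_trans[rotated])
  qed
  then have "\<forall>\<^sub>F n in sequentially. \<phi> (U (r n) (t' (r n))) \<le> ereal (p0 + 1)" by (rule eventually_subseq[OF r])
  then obtain N where N: "\<And>n. n \<ge> N \<Longrightarrow> \<phi> (U (r n) (t' (r n))) \<le> ereal (p0 + 1)" by (auto simp: eventually_sequentially)
  define x where "x n = U (r (n + N)) (t' (r (n + N)))" for n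
  have "(SUP n. \<phi> (x n)) < \<infinity>" by (rule le_less_trans[OF SUP_least, of _ _ "ereal (p0 + 1)"]) (auto simp: x_def N)
  moreover have "dist ustar (x n) \<le> R" for n
  proof -
    have "0 \<le> t' (r (n + N))" using g(1)[of "r (n + N)"] t by linarith
    then show ?thesis using R[of "t' (r (n + N))" "r (n + N)"] g(2)[of "r (n + N)"] by (simp add: x_def dist_commute)
  qed
  then have "bounded (range x)" unfolding bounded_def by auto
  ultimately obtain q l where q: "strict_mono q" "limitin \<sigma> (x \<circ> q) l sequentially"
    using cpt unfolding compact_sublevels_def by blast
  have s: "strict_mono (\<lambda>n. r (q n + N))" using q(1) r by (simp add: strict_mono_def)
  have "limitin \<sigma> (\<lambda>n. U (r (q n + N)) t) l sequentially"
  proof (rule compatible_limit_shift[OF comp q(2)])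
    show "(\<lambda>n. dist ((x \<circ> q) n) (U (r (q n + N)) t)) \<longlonglongrightarrow> 0"
      using LIMSEQ_subseq_LIMSEQ[OF g(5) s] by (simp add: x_def o_def)
  qed
  moreover have "strict_mono (\<lambda>n. q n + N)" using q(1) by (simp add: strict_mono_def)
  ultimately show ?thesis by blast
qed

lemma convergent_subsequence:
  obtains r w where "strict_mono (r::nat\<Rightarrow>nat)" "\<And>t. 0 \<le> t \<Longrightarrow> limitin \<sigma> (\<lambda>n. U (r n) t) (w t) sequentially"
proof (rule compatible_Ascoli[OF comp, of U])
  show "\<exists>r' l. strict_mono (r'::nat\<Rightarrow>nat) \<and> limitin \<sigma> (\<lambda>n. U (r (r' n)) t) l sequentially"
    if "0 \<le> t" "strict_mono r" for t :: real and r :: "nat \<Rightarrow> nat"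
    using pointwise_compact[OF that] .
  show "\<exists>\<delta>>0. \<forall>s t. 0 \<le> s \<longrightarrow> 0 \<le> t \<longrightarrow> s \<le> T \<longrightarrow> t \<le> T \<longrightarrow> \<bar>s - t\<bar> < \<delta> \<longrightarrow> (\<forall>\<^sub>F n in sequentially. dist (U n s) (U n t) < e)"
    if e: "0 < e" for T e :: real
  proof -
    obtain C where C: "0 < C" "\<And>k s r. 0 \<le> s \<Longrightarrow> 0 \<le> r \<Longrightarrow> s \<le> T \<Longrightarrow> r \<le> T \<Longrightarrow> dist (U k s) (U k r) \<le> sqrt (\<bar>s - r\<bar> * C)"
      by (rule bounds[of T]) blast
    show ?thesis
    proof (intro exI[of _ "e\<^sup>2 / C"] conjI allI impI always_eventually)
      fix s t n assume st: "0 \<le> s" "0 \<le> t" "s \<le> T" "t \<le> T" "\<bar>s - t\<bar> < e\<^sup>2 / C"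
      have "\<bar>s - t\<bar> * C < e\<^sup>2" using st(5) C(1) by (simp add: pos_less_divide_eq)
      then have "sqrt (\<bar>s - t\<bar> * C) < e" using e by (simp add: real_less_lsqrt)
      then show "dist (U n s) (U n t) < e" using C(2)[OF st(1-4), of n] by simp
    qed (use e C in auto)
  qed
  show thesis if "strict_mono r" "\<And>t. 0 \<le> t \<Longrightarrow> limitin \<sigma> (\<lambda>n. U (r n) t) (w t) sequentially" for r :: "nat \<Rightarrow> nat" and w
    using \<open>\<And>r w. strict_mono r \<Longrightarrow> (\<And>t. 0 \<le> t \<Longrightarrow> limitin \<sigma> (\<lambda>n. U (r n) t) (w t) sequentially) \<Longrightarrow> thesis\<close> that by blast
qed

end


text \<open>At a Lebesgue point of \<open>m\<close> the right difference quotients are bounded by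
  averages that tend to \<open>m t\<close>. The metric derivative is therefore the least admissible
  speed bound, and estimates for some bound transfer to it.\<close>

lemma speed_minimal:
  assumes w: "metric_speed w M" and wT: "has_speed (\<lambda>t. w (max 0 (min t T))) m"
  shows "AE t in lborel. 0 < t \<and> t < T \<longrightarrow> M t \<le> m t"
  using metric_speedD(5)[OF w] Lebesgue_differentiation_local[OF has_speedD(5)[OF wT]]
proof eventually_elim
  case (elim t)
  show ?case
  proof (intro impI, elim conjE, rule field_le_epsilon)
    fix e :: real assume t: "0 < t" "t < T" and e: "0 < e"
    obtain d where d: "d > 0" "\<And>a b. a \<le> t \<and> t \<le> b \<and> a < b \<and> b - a < d \<Longrightarrow>
           \<bar>(LINT r:{a..b}|lborel. m r) - m t * (b - a)\<bar> \<le> e * (b - a)"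
      using elim(2) e by blast
    have lim: "((\<lambda>s. dist (w s) (w t) / \<bar>t - s\<bar>) \<longlongrightarrow> M t) (at_right t)"
      using elim(1) t(1) by (auto intro: filterlim_mono at_le)
    show "M t \<le> m t + e"
    proof (rule tendsto_upperbound[OF lim])
      have "\<forall>\<^sub>F s in at_right t. s \<in> {t<..<min T (t + d)}"
        using t d(1) by (intro eventually_at_right_real) auto
      then show "\<forall>\<^sub>F s in at_right t. dist (w s) (w t) / \<bar>t - s\<bar> \<le> m t + e"
      proof eventually_elim
        case (elim s)
        have "dist (w t) (w s) \<le> (LINT r:{t..s}|lborel. m r)"
          using has_speedD(6)[OF wT, of t s] elim t by (simp add: max_absorb2 min_absorb1)
        also have "\<dots> \<le> m t * (s - t) + e * (s - t)" using d(2)[of t s] elim by (simp add: abs_le_iff)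
        also have "\<dots> = (m t + e) * (s - t)" by (simp add: distrib_right)
        finally show ?case using elim by (simp add: dist_commute pos_divide_le_eq)
      qed
    qed simp
  qed
qed

lemma ennreal_liminf_add_le:
  fixes f g :: "nat \<Rightarrow> ennreal"
  assumes "\<forall>\<^sub>F k in sequentially. f k + g k \<le> c"
  shows "liminf f + liminf g \<le> c"
proof -
  obtain N where N: "\<And>k. k \<ge> N \<Longrightarrow> f k + g k \<le> c" using assms by (auto simp: eventually_sequentially)
  have inc: "incseq (\<lambda>n. INF k\<in>{n..}. h k)" for h :: "nat \<Rightarrow> ennreal"
    unfolding incseq_def by (auto intro!: INF_superset_mono)
  have "liminf f + liminf g = (SUP n. (INF k\<in>{n..}. f k) + (INF k\<in>{n..}. g k))"
    unfolding liminf_SUP_INF by (rule ennreal_SUP_add[OF inc inc, symmetric])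
  also have "\<dots> \<le> c"
  proof (rule SUP_least)
    fix n
    have "(INF k\<in>{n..}. f k) + (INF k\<in>{n..}. g k) \<le> f (max n N) + g (max n N)"
      by (intro add_mono INF_lower) auto
    also have "\<dots> \<le> c" by (rule N) simp
    finally show "(INF k\<in>{n..}. f k) + (INF k\<in>{n..}. g k) \<le> c" .
  qed
  finally show ?thesis .
qed

lemma (in wed_limit) subsequence:
  assumes r: "strict_mono r"
  shows "wed_limit \<sigma> \<phi> ustar A B ubar p0 (\<lambda>n. eps (r n)) (\<lambda>n. U (r n)) (\<lambda>n. Ms (r n)) (\<lambda>n. F (r n))"
proof unfold_locales
  show "(\<lambda>n. eps (r n)) \<longlonglongrightarrow> 0" using LIMSEQ_subseq_LIMSEQ[OF eps_lim r] by (simp add: o_def)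
  fix k :: nat and t p c T :: real and v :: "real \<Rightarrow> 'a"
  assume "0 \<le> t" "\<phi> (U (r k) t) = ereal p" "v 0 = U (r k) t"
    "\<And>s t. 0 \<le> s \<Longrightarrow> 0 \<le> t \<Longrightarrow> dist (v s) (v t) \<le> \<bar>s - t\<bar>" "0 \<le> c" "0 \<le> T"
    "\<And>s. 0 \<le> s \<Longrightarrow> s \<le> T \<Longrightarrow> \<phi> (v (c * s)) \<le> ereal (p - c\<^sup>2 * s)"
  then show "F (r k) t \<le> p - 1/2 * c\<^sup>2 * eps (r k) * (1 - exp (- T / eps (r k)))" by (rule F_comp)
qed (use p0 eps_pos U0 speed F_phi F_lower F_antimono F_diss in auto)

section \<open>Semicontinuity and the energy inequality for the limit curve\<close>

locale wed_limit_conv = wed_limit +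
  fixes w :: "real \<Rightarrow> 'a"
  assumes conv: "\<And>t. 0 \<le> t \<Longrightarrow> limitin \<sigma> (\<lambda>k. U k t) (w t) sequentially"
begin

lemma w_0: "w 0 = ubar"
  using conv[of 0] compatible_const[OF comp] compatible_unique[OF comp] by (auto simp: U0)

text \<open>The lower limit of \<open>F k t\<close> is at least the energy of the limit point. Lower
  semicontinuity is used along the good times, whose curve points have the same limit and whose
  energies exceed \<open>F k t\<close> by no more than \<open>\<delta> k\<close>; the energies at
  \<open>t\<close> itself would give no information on \<open>F\<close>.\<close>

lemma phi_w_lower:
  assumes t: "0 \<le> t" and a: "ereal a < \<phi> (w t)"
  shows "\<forall>\<^sub>F k in sequentially. a < F k t"
proof -
  obtain t' \<delta> where g: "\<And>k. t \<le> t' k" "\<And>k. t' k \<le> t + 1" "\<delta> \<longlonglongrightarrow> 0"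
    "\<forall>\<^sub>F k in sequentially. \<phi> (U k (t' k)) \<le> ereal (F k t + \<delta> k)"
    "(\<lambda>k. dist (U k (t' k)) (U k t)) \<longlonglongrightarrow> 0"
    by (rule good_times[OF t]) blast
  obtain R where R: "\<And>k s. 0 \<le> s \<Longrightarrow> s \<le> t + 1 \<Longrightarrow> dist (U k s) ustar \<le> R"
    by (rule bounds[of "t + 1"]) blast
  have "dist ustar (U k (t' k)) \<le> R" for k
  proof -
    have "0 \<le> t' k" using g(1)[of k] t by linarith
    then show ?thesis using R[of "t' k" k] g(2)[of k] by (simp add: dist_commute)
  qed
  then have bdd: "bounded (range (\<lambda>k. U k (t' k)))" unfolding bounded_def by auto
  have lim: "limitin \<sigma> (\<lambda>k. U k (t' k)) (w t) sequentially"
    by (rule compatible_limit_shift[OF comp conv[OF t]]) (use g(5) in \<open>simp add: dist_commute\<close>)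
  obtain a' where a': "ereal a < ereal a'" "ereal a' < \<phi> (w t)" using ereal_dense2[OF a] by blast
  have "ereal a' < liminf (\<lambda>k. \<phi> (U k (t' k)))"
    using a'(2) lsc[unfolded lower_semicont_def] bdd lim by (meson less_le_trans)
  from less_LiminfD[OF this] g(4) order_tendstoD(2)[OF g(3), of "a' - a"] a'(1)
  have "\<forall>\<^sub>F k in sequentially. ereal a' < \<phi> (U k (t' k)) \<and> \<phi> (U k (t' k)) \<le> ereal (F k t + \<delta> k) \<and> \<delta> k < a' - a"
    by (simp add: eventually_conj_iff)
  then show ?thesis
  proof eventually_elim
    case (elim k)
    then have "ereal a' < ereal (F k t + \<delta> k)" by (meson less_le_trans)
    then show ?case using elim by simp
  qed
qed

lemma phi_w:
  assumes t: "0 \<le> t"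
  obtains q where "\<phi> (w t) = ereal q" "q \<le> p0"
proof -
  have "\<phi> (w t) \<le> ereal p0"
  proof (rule ccontr)
    assume "\<not> ?thesis"
    then have "ereal p0 < \<phi> (w t)" by simp
    from phi_w_lower[OF t this] have "\<forall>\<^sub>F k in sequentially. p0 < F k t" .
    then have "\<forall>\<^sub>F k in sequentially. False" by eventually_elim (use F_le[OF t] in \<open>meson leD\<close>)
    then show False by simp
  qed
  then show ?thesis using not_minf[of "w t"] that by (cases "\<phi> (w t)") auto
qed

text \<open>Difference quotients see the curve only at dyadic times, so the criterion by
  \<open>dq_sq\<close> has to be supplemented by continuity. It comes from the uniform Hoelder
  modulus, which survives the limit by (MT1).\<close>

lemma w_clamp_continuous: "continuous_on UNIV (\<lambda>t. w (max 0 (min t T)))"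
proof -
  obtain C where C: "0 < C" "\<And>k s t. 0 \<le> s \<Longrightarrow> 0 \<le> t \<Longrightarrow> s \<le> max 0 T \<Longrightarrow> t \<le> max 0 T \<Longrightarrow> dist (U k s) (U k t) \<le> sqrt (\<bar>s - t\<bar> * C)"
    by (rule bounds[of "max 0 T"]) blast
  have H: "dist (w s) (w t) \<le> sqrt (\<bar>s - t\<bar> * C)" if "0 \<le> s" "0 \<le> t" "s \<le> max 0 T" "t \<le> max 0 T" for s t
    by (rule compatible_dist_le[OF comp conv conv _ tendsto_const]) (use that C(2) in auto)
  have H': "dist (w (max 0 (min s T))) (w (max 0 (min t T))) \<le> sqrt (\<bar>s - t\<bar> * C)" for s t
  proof -
    have "dist (w (max 0 (min s T))) (w (max 0 (min t T))) \<le> sqrt (\<bar>max 0 (min s T) - max 0 (min t T)\<bar> * C)"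
      by (intro H) auto
    also have "\<dots> \<le> sqrt (\<bar>s - t\<bar> * C)" using C(1) by (intro real_sqrt_le_mono mult_right_mono) auto
    finally show ?thesis .
  qed
  show ?thesis
    unfolding continuous_on_def
  proof (intro ballI)
    fix t
    have "((\<lambda>s. sqrt (\<bar>s - t\<bar> * C)) \<longlongrightarrow> sqrt (\<bar>t - t\<bar> * C)) (at t)" by (intro tendsto_intros)
    then have lim: "((\<lambda>s. sqrt (\<bar>s - t\<bar> * C)) \<longlongrightarrow> 0) (at t)" by simp
    have "((\<lambda>s. dist (w (max 0 (min s T))) (w (max 0 (min t T)))) \<longlongrightarrow> 0) (at t)"
      by (intro tendsto_sandwich[OF _ _ tendsto_const lim]) (simp_all add: always_eventually H')
    then show "((\<lambda>s. w (max 0 (min s T))) \<longlongrightarrow> w (max 0 (min t T))) (at t)" by (rule iffD2[OF tendsto_dist_iff])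
  qed
qed

lemma clamp_dq_sq:
  "dq_sq (\<lambda>t. U k (max 0 (min t T))) j \<le> (\<integral>\<^sup>+r. ennreal ((Ms k r)\<^sup>2) * indicator {0..T} r \<partial>lborel)"
proof -
  have "dq_sq (\<lambda>t. U k (max 0 (min t T))) j \<le> (\<integral>\<^sup>+r. (ennreal (Ms k r) * indicator {0..T} r)\<^sup>2 \<partial>lborel)"
    unfolding dq_sq_def
  proof (rule diffquot_square_le)
    fix s t :: real assume st: "s \<le> t"
    define s' t' where "s' = max 0 (min s T)" and "t' = max 0 (min t T)"
    have "ennreal (dist (U k s') (U k t')) \<le> (\<integral>\<^sup>+r. ennreal (Ms k r) * indicator {0..T} r * indicator {s..t} r \<partial>lborel)"
    proof (cases "s' = t'")
      case False
      then have sub: "{s'..t'} \<subseteq> {s..t} \<inter> {0..T}" "0 \<le> s'" "s' \<le> t'"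
        using st by (auto simp: s'_def t'_def min_def max_def split: if_splits)
      have "ennreal (dist (U k s') (U k t')) \<le> (\<integral>\<^sup>+r. ennreal (Ms k r) * indicator {s'..t'} r \<partial>lborel)"
        by (rule metric_speedD(4)[OF speed sub(2,3)])
      also have "\<dots> \<le> (\<integral>\<^sup>+r. ennreal (Ms k r) * indicator {0..T} r * indicator {s..t} r \<partial>lborel)"
        using sub(1) by (intro nn_integral_mono) (auto simp: indicator_def)
      finally show ?thesis .
    qed simp
    then show "ennreal (dist (U k (max 0 (min s T))) (U k (max 0 (min t T)))) \<le> (\<integral>\<^sup>+ x\<in>{s..t}. (ennreal (Ms k x) * indicator {0..T} x) \<partial>lborel)"
      by (simp add: s'_def t'_def)
  qed measurable
  also have "\<dots> = (\<integral>\<^sup>+r. ennreal ((Ms k r)\<^sup>2) * indicator {0..T} r \<partial>lborel)"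
    using metric_speedD(2)[OF speed] by (intro nn_integral_cong) (auto simp: indicator_def ennreal_power)
  finally show ?thesis .
qed

text \<open>For a fixed grid every quotient is lower semicontinuous in the limit by (MT1), and Fatou
  passes this to the integral. The resulting bound is the same for all grids, so
  \<open>has_speedI_dq_sq\<close> produces a speed bound without any limit of the functions
  \<open>Ms k\<close>.\<close>

lemma w_has_speed:
  obtains m where "has_speed (\<lambda>t. w (max 0 (min t T))) m"
    "(\<integral>\<^sup>+t. ennreal ((m t)\<^sup>2) \<partial>lborel) \<le> liminf (\<lambda>k. \<integral>\<^sup>+r. ennreal ((Ms k r)\<^sup>2) * indicator {0..T} r \<partial>lborel)"
proof -
  let ?\<Lambda> = "liminf (\<lambda>k. \<integral>\<^sup>+r. ennreal ((Ms k r)\<^sup>2) * indicator {0..T} r \<partial>lborel)"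
  let ?w = "\<lambda>t. w (max 0 (min t T))" and ?U = "\<lambda>k t. U k (max 0 (min t T))"
  obtain C where C: "\<And>k. (\<integral>\<^sup>+r. ennreal ((Ms k r)\<^sup>2) * indicator {0..T} r \<partial>lborel) \<le> ennreal C"
    by (rule bounds[of T]) blast
  have "?\<Lambda> \<le> liminf (\<lambda>k::nat. ennreal C)" by (intro Liminf_mono always_eventually allI C)
  also have "\<dots> < \<infinity>" by (simp add: Liminf_const)
  finally have fin: "?\<Lambda> < \<infinity>" .
  have bound: "dq_sq ?w j \<le> ?\<Lambda>" for j
  proof -
    have pt: "ennreal ((diffquot j ?w t)\<^sup>2) \<le> liminf (\<lambda>k. ennreal ((diffquot j (?U k) t)\<^sup>2))" for t
      unfolding le_Liminf_iff
    proof (intro allI impI)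
      fix y assume y: "y < ennreal ((diffquot j ?w t)\<^sup>2)"
      then obtain z where z: "y = ennreal z" "0 \<le> z" by (cases y) auto
      have "z < (diffquot j ?w t)\<^sup>2" using y z by (simp add: ennreal_less_iff)
      then have "sqrt z < diffquot j ?w t" by (intro real_less_lsqrt) auto
      then have "sqrt z / 2 ^ j < dist (?w (grid j t)) (?w (grid j t + 1 / 2 ^ j))"
        by (simp add: diffquot_def pos_divide_less_eq)
      then have "\<forall>\<^sub>F k in sequentially. sqrt z / 2 ^ j < dist (?U k (grid j t)) (?U k (grid j t + 1 / 2 ^ j))"
        by (intro compatible_dist_lower[OF comp conv conv]) auto
      then show "\<forall>\<^sub>F k in sequentially. y < ennreal ((diffquot j (?U k) t)\<^sup>2)"
      proof eventually_elim
        case (elim k)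
        then have "sqrt z < diffquot j (?U k) t" by (simp add: diffquot_def pos_divide_less_eq)
        then have "(sqrt z)\<^sup>2 < (diffquot j (?U k) t)\<^sup>2" using z(2) by (intro power_strict_mono) auto
        then show ?case using z by (simp add: ennreal_less_iff)
      qed
    qed
    have "dq_sq ?w j \<le> (\<integral>\<^sup>+t. liminf (\<lambda>k. ennreal ((diffquot j (?U k) t)\<^sup>2)) \<partial>lborel)"
      unfolding dq_sq_def by (intro nn_integral_mono pt)
    also have "\<dots> \<le> liminf (\<lambda>k. dq_sq (?U k) j)"
      unfolding dq_sq_def by (rule nn_integral_liminf) measurable
    also have "\<dots> \<le> ?\<Lambda>" by (intro Liminf_mono always_eventually allI clamp_dq_sq)
    finally show ?thesis .
  qed
  show ?thesis by (rule has_speedI_dq_sq[OF w_clamp_continuous bound fin]) (rule that)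
qed

lemma w_AC_loc: "AC_loc 2 {0..} w"
  unfolding AC_loc_def
proof (intro allI impI)
  fix a b :: real assume ab: "{a..b} \<subseteq> {0..}"
  obtain m where m: "has_speed (\<lambda>t. w (max 0 (min t b))) m" using w_has_speed[of b] by metis
  show "AC 2 {a..b} w"
  proof (rule AC_2I[OF has_speedD(1,2)[OF m]])
    show "(\<integral>\<^sup>+ t\<in>{a..b}. ennreal ((m t)\<^sup>2) \<partial>lborel) < \<infinity>"
      by (rule le_less_trans[OF nn_integral_mono has_speedD(3)[OF m]]) (simp add: indicator_def)
    fix s t assume st: "a \<le> s" "s \<le> t" "t \<le> b"
    then have "0 \<le> s" using ab by auto
    then show "ennreal (dist (w s) (w t)) \<le> (\<integral>\<^sup>+ x\<in>{s..t}. ennreal (m x) \<partial>lborel)"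
      using has_speedD(4)[OF m st(2)] st by (simp add: max_absorb2 min_absorb1)
  qed
qed

end


context wed_limit_conv
begin

lemma kinetic_liminf:
  assumes w: "metric_speed w M"
  shows "(\<integral>\<^sup>+r. ennreal ((M r)\<^sup>2) * indicator {0..T} r \<partial>lborel)
    \<le> liminf (\<lambda>k. \<integral>\<^sup>+r. ennreal ((Ms k r)\<^sup>2) * indicator {0..T} r \<partial>lborel)"
proof -
  obtain m where m: "has_speed (\<lambda>t. w (max 0 (min t T))) m"
    "(\<integral>\<^sup>+t. ennreal ((m t)\<^sup>2) \<partial>lborel) \<le> liminf (\<lambda>k. \<integral>\<^sup>+r. ennreal ((Ms k r)\<^sup>2) * indicator {0..T} r \<partial>lborel)"
    by (rule w_has_speed[of T])
  have "(\<integral>\<^sup>+r. ennreal ((M r)\<^sup>2) * indicator {0..T} r \<partial>lborel) \<le> (\<integral>\<^sup>+t. ennreal ((m t)\<^sup>2) \<partial>lborel)"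
  proof (rule nn_integral_mono_AE)
    show "AE r in lborel. ennreal ((M r)\<^sup>2) * indicator {0..T} r \<le> ennreal ((m r)\<^sup>2)"
      using speed_minimal[OF w m(1)] AE_lborel_singleton[of 0] AE_lborel_singleton[of T]
    proof eventually_elim
      case (elim r)
      show ?case
      proof (cases "r \<in> {0..T}")
        case True
        then have "M r \<le> m r" using elim by auto
        then have "(M r)\<^sup>2 \<le> (m r)\<^sup>2" using metric_speedD(2)[OF w] by (intro power_mono) auto
        then show ?thesis by (auto simp: indicator_def intro: ennreal_leI)
      qed simp
    qed
  qed
  then show ?thesis using m(2) by (rule order_trans)
qed

text \<open>Otherwise there are points at distance at most \<open>1 / real (Suc n)\<close> from the
  curves, with no larger energy and with slope at most \<open>c\<close>. They converge to
  \<open>w r\<close>, and their energies are bounded by \<open>K\<close>, so they are admissible in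
  the definition of the relaxed slope and force it below \<open>c\<close>.\<close>

lemma slope_near:
  assumes r: "0 \<le> r" and c: "ennreal c < relaxed_slope \<sigma> \<phi> (w r)"
    and s: "strict_mono (s :: nat \<Rightarrow> nat)" and b: "\<And>j. \<phi> (U (s j) r) \<le> ereal K"
  shows "\<exists>\<rho>>0. \<exists>N. \<forall>j\<ge>N. \<forall>y. dist y (U (s j) r) \<le> \<rho> \<longrightarrow> \<phi> y \<le> \<phi> (U (s j) r) \<longrightarrow> ennreal c < local_slope \<phi> y"
proof (rule ccontr)
  assume no: "\<not> ?thesis"
  have "\<exists>j y. n \<le> j \<and> dist y (U (s j) r) \<le> 1 / real (Suc n) \<and> \<phi> y \<le> \<phi> (U (s j) r) \<and> local_slope \<phi> y \<le> ennreal c" for n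
  proof -
    have "0 < 1 / real (Suc n)" by simp
    with no have "\<not> (\<forall>j\<ge>n. \<forall>y. dist y (U (s j) r) \<le> 1 / real (Suc n) \<longrightarrow> \<phi> y \<le> \<phi> (U (s j) r) \<longrightarrow> ennreal c < local_slope \<phi> y)"
      by blast
    then show ?thesis by (auto simp: not_less)
  qed
  then obtain j y where jy: "\<And>n. n \<le> j n" "\<And>n. dist (y n) (U (s (j n)) r) \<le> 1 / real (Suc n)"
    "\<And>n. \<phi> (y n) \<le> \<phi> (U (s (j n)) r)" "\<And>n. local_slope \<phi> (y n) \<le> ennreal c" by metis
  obtain R where R: "\<And>k t. 0 \<le> t \<Longrightarrow> t \<le> r \<Longrightarrow> dist (U k t) ustar \<le> R" by (rule bounds[of r]) blast
  have top: "filterlim (\<lambda>n. s (j n)) sequentially sequentially"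
  proof (rule filterlim_at_top_mono[OF filterlim_ident], rule always_eventually, rule allI)
    fix n
    have "j n \<le> s (j n)" using seq_suble[OF s] .
    then show "n \<le> s (j n)" using jy(1)[of n] by simp
  qed
  have "limitin \<sigma> (\<lambda>n. U (s (j n)) r) (w r) sequentially"
    using conv[OF r] unfolding limitin_def by (auto intro: eventually_compose_filterlim[OF _ top])
  moreover have "(\<lambda>n. dist (U (s (j n)) r) (y n)) \<longlonglongrightarrow> 0"
  proof (rule tendsto_sandwich[of "\<lambda>_. 0" _ _ "\<lambda>n. 1 / real (Suc n)"])
    show "(\<lambda>n. 1 / real (Suc n)) \<longlonglongrightarrow> 0" by (rule LIMSEQ_Suc[OF lim_1_over_n])
  qed (use jy(2) in \<open>auto simp: dist_commute\<close>)
  ultimately have lim: "limitin \<sigma> y (w r) sequentially" by (rule compatible_limit_shift[OF comp])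
  have "dist (y n) (w r) \<le> 1 + R + dist ustar (w r)" for n
  proof -
    have "dist (y n) (U (s (j n)) r) \<le> 1" using jy(2)[of n] by (rule order_trans) simp
    moreover have "dist (U (s (j n)) r) ustar \<le> R" using R[OF r order_refl] .
    moreover have "dist (y n) (w r) \<le> dist (y n) (U (s (j n)) r) + (dist (U (s (j n)) r) ustar + dist ustar (w r))"
      by (meson add_left_mono dist_triangle order_trans)
    ultimately show ?thesis by linarith
  qed
  then have bdd: "bdd_above (range (\<lambda>n. dist (y n) (w r)))" by (intro bdd_aboveI2)
  have "(SUP n. \<phi> (y n)) < \<infinity>"
    by (rule le_less_trans[OF SUP_least, of _ _ "ereal K"]) (use jy(3) b in \<open>auto intro: order_trans\<close>)
  with lim bdd have "relaxed_slope \<sigma> \<phi> (w r) \<le> liminf (\<lambda>n. local_slope \<phi> (y n))"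
    unfolding relaxed_slope_def by (intro Inf_lower) blast
  also have "\<dots> \<le> liminf (\<lambda>n::nat. ennreal c)" by (intro Liminf_mono always_eventually allI jy(4))
  finally show False using c unfolding Liminf_const[OF sequentially_bot] by simp
qed

text \<open>If the excess stayed small along a subsequence, the slope would exceed some fixed
  \<open>c\<close> on balls of one radius around the curve points. The descending curves there have
  a common duration, so the competitor bound loses only a factor tending to one and contradicts the
  smallness of the excess.\<close>

lemma slope_liminf:
  assumes r: "0 \<le> r"
  shows "ennreal (1/2) * (relaxed_slope \<sigma> \<phi> (w r))\<^sup>2 \<le> liminf (\<lambda>k. excess k r)"
proof (rule ccontr)
  let ?g = "relaxed_slope \<sigma> \<phi> (w r)"
  assume "\<not> ?thesis"
  then have "liminf (\<lambda>k. excess k r) < ennreal (1/2) * ?g\<^sup>2" by simp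
  \<comment> \<open>Two intermediate values are chosen: \<open>a\<close> bounds the excess along a
    subsequence, and \<open>z\<close> is what the competitors yield. As they yield it only in the
    limit, with a non-strict inequality, a strict gap between the two is required.\<close>
  then obtain z1 where z1: "liminf (\<lambda>k. excess k r) < z1" "z1 < ennreal (1/2) * ?g\<^sup>2" using dense by blast
  then obtain z2 where z2: "z1 < z2" "z2 < ennreal (1/2) * ?g\<^sup>2" using dense by blast
  obtain a where a: "z1 = ennreal a" "0 \<le> a" using z2(1) by (cases z1) auto
  obtain z where z: "z2 = ennreal z" "0 \<le> z" using z2(2) by (cases z2) auto
  have az: "a < z" using z2(1) a z by (simp add: ennreal_less_iff)
  \<comment> \<open>The speed whose gain \<open>1/2 * c\<^sup>2\<close> equals \<open>z\<close>;
    since \<open>z\<close> is below half the squared relaxed slope, \<open>c\<close> is below the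
    relaxed slope itself.\<close>
  define c where "c = sqrt (2 * z)"
  have c0: "0 < c" and csq: "c\<^sup>2 = 2 * z" using az a by (auto simp: c_def)
  have cg: "ennreal c < ?g"
  proof (rule ccontr)
    assume "\<not> ?thesis"
    then have "?g\<^sup>2 \<le> (ennreal c)\<^sup>2" by (intro power_mono) auto
    then have "ennreal (1/2) * ?g\<^sup>2 \<le> ennreal (1/2) * ennreal (c\<^sup>2)" using c0 by (intro mult_left_mono) (auto simp: ennreal_power)
    also have "\<dots> = ennreal (1/2 * c\<^sup>2)" by (rule ennreal_mult[symmetric]) auto
    also have "\<dots> = z2" by (simp add: csq z)
    finally show False using z2(2) by simp
  qed
  have "\<not> (\<forall>\<^sub>F k in sequentially. ennreal a \<le> excess k r)"
    using Liminf_bounded[of "ennreal a" "\<lambda>k. excess k r" sequentially] z1(1) a by (meson leD)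
  then have "\<exists>\<^sub>F k in sequentially. excess k r < ennreal a" by (simp add: not_eventually not_le)
  then have "infinite {k. excess k r < ennreal a}" unfolding frequently_sequentially infinite_nat_iff_unbounded_le by auto
  then obtain s :: "nat \<Rightarrow> nat" where s: "strict_mono s" "\<And>j. excess (s j) r < ennreal a"
    using infinite_enumerate by blast
  have "\<exists>p. \<phi> (U (s j) r) = ereal p \<and> p - F (s j) r \<le> eps (s j) * a" for j
  proof (cases "\<phi> (U (s j) r)")
    case (real p)
    have "ennreal (p - F (s j) r) / ennreal (eps (s j)) < ennreal a"
      using s(2)[of j] by (simp add: excess_def real)
    moreover have "0 \<le> p - F (s j) r" using F_phi[OF r real] by simp
    ultimately have "ennreal ((p - F (s j) r) / eps (s j)) < ennreal a" using eps_pos[of "s j"] by (simp add: divide_ennreal)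
    then have "(p - F (s j) r) / eps (s j) < a" using \<open>0 \<le> p - F (s j) r\<close> eps_pos[of "s j"] by (simp add: ennreal_less_iff)
    then have "p - F (s j) r < a * eps (s j)" using eps_pos[of "s j"] by (simp only: pos_divide_less_eq)
    then show ?thesis using real by (simp add: mult.commute)
  next
    case PInf
    then have "excess (s j) r = top" unfolding excess_def by (simp add: ennreal_top_divide)
    then show ?thesis using s(2)[of j] by simp
  qed (use not_minf in auto)
  then obtain p where p: "\<And>j. \<phi> (U (s j) r) = ereal (p j)" "\<And>j. p j - F (s j) r \<le> eps (s j) * a" by metis
  have "Bseq eps" using eps_lim by (rule convergent_imp_Bseq[OF convergentI])
  then obtain E where E: "\<And>k. eps k \<le> E" unfolding Bseq_def by (metis abs_le_D1 real_norm_def)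
  \<comment> \<open>Finite excess forces finite energy, and a bound on it keeps the energies at time
    \<open>r\<close> uniformly bounded along the subsequence. This is the energy bound that the
    relaxed slope asks of its approximating sequences.\<close>
  have pK: "\<phi> (U (s j) r) \<le> ereal (p0 + E * a)" for j
  proof -
    have "eps (s j) * a \<le> E * a" by (rule mult_right_mono[OF E a(2)])
    then show ?thesis using p(2)[of j] F_le[OF r, of "s j"] by (simp add: p(1))
  qed
  obtain \<rho> N where \<rho>: "0 < \<rho>" "\<And>j y. j \<ge> N \<Longrightarrow> dist y (U (s j) r) \<le> \<rho> \<Longrightarrow> \<phi> y \<le> \<phi> (U (s j) r) \<Longrightarrow> ennreal c < local_slope \<phi> y"
    using slope_near[OF r cg s(1) pK] by blast
  \<comment> \<open>The time to cover length \<open>\<rho>\<close> at speed \<open>c\<close>. It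
    does not depend on the index, so \<open>T / eps (s j)\<close> tends to infinity and the
    exponential loss disappears.\<close>
  define T where "T = \<rho> / c"
  have T0: "0 < T" using \<rho>(1) c0 by (simp add: T_def)
  have low: "z * (1 - exp (- T / eps (s j))) \<le> a" if jN: "j \<ge> N" for j
  proof -
    obtain v where v: "v 0 = U (s j) r" "\<And>s t. 0 \<le> s \<Longrightarrow> 0 \<le> t \<Longrightarrow> dist (v s) (v t) \<le> \<bar>s - t\<bar>"
      "\<And>x. 0 \<le> x \<Longrightarrow> x \<le> \<rho> \<Longrightarrow> \<phi> (v x) \<le> ereal (p j - c * x)"
      by (rule descending_curve[OF comp prp lsc cpt p(1) less_imp_le[OF c0] \<rho>(1) \<rho>(2)[OF jN]]) auto
    have "F (s j) r \<le> p j - 1/2 * c\<^sup>2 * eps (s j) * (1 - exp (- T / eps (s j)))"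
    proof (rule F_comp[OF r p(1) v(1,2) less_imp_le[OF c0] less_imp_le[OF T0]])
      fix x assume x: "0 \<le> x" "x \<le> T"
      have "c * x \<le> \<rho>" using x(2) c0 by (simp add: T_def pos_le_divide_eq mult.commute)
      then show "\<phi> (v (c * x)) \<le> ereal (p j - c\<^sup>2 * x)"
        using v(3)[of "c * x"] x(1) c0 by (simp add: power2_eq_square mult.assoc)
    qed auto
    then have "z * eps (s j) * (1 - exp (- T / eps (s j))) \<le> p j - F (s j) r" by (simp add: csq)
    also have "\<dots> \<le> eps (s j) * a" by (rule p(2))
    finally have "(z * (1 - exp (- T / eps (s j)))) * eps (s j) \<le> a * eps (s j)" by (simp add: mult_ac)
    then show ?thesis using eps_pos[of "s j"] by simp
  qed
  have es: "(\<lambda>j. eps (s j)) \<longlonglongrightarrow> 0" using LIMSEQ_subseq_LIMSEQ[OF eps_lim s(1)] by (simp add: o_def)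
  have "filterlim (\<lambda>j. eps (s j)) (at_right 0) sequentially"
  proof -
    have "eps k \<noteq> 0" for k using eps_pos[of k] by simp
    then show ?thesis using es eps_pos by (simp add: filterlim_at)
  qed
  then have "filterlim (\<lambda>j. inverse (eps (s j))) at_top sequentially"
    by (rule filterlim_compose[OF filterlim_inverse_at_top_right])
  then have "filterlim (\<lambda>j. (- T) * inverse (eps (s j))) at_bot sequentially"
    by (rule filterlim_tendsto_neg_mult_at_bot[OF tendsto_const, rotated]) (use T0 in simp)
  then have "(\<lambda>j. exp ((- T) * inverse (eps (s j)))) \<longlonglongrightarrow> 0" by (rule filterlim_compose[OF exp_at_bot])
  then have "(\<lambda>j. z * (1 - exp (- T / eps (s j)))) \<longlonglongrightarrow> z * (1 - 0)"
    by (intro tendsto_intros) (simp add: divide_inverse)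
  then have "z * (1 - 0) \<le> a" by (rule LIMSEQ_le_const2) (use low in blast)
  then show False using az by simp
qed



text \<open>The three terms of the dissipation identity pass to the limit independently. The two
  integrals remain separate because adding them would require the relaxed slope along
  \<open>w\<close> to be measurable, which only the upper gradient property will supply.\<close>

lemma energy_inequality:
  assumes w: "metric_speed w M" and t: "0 \<le> t" and q: "\<phi> (w t) = ereal q"
  shows "(\<integral>\<^sup>+r. ennreal (1/2) * ennreal ((M r)\<^sup>2) * indicator {0..t} r \<partial>lborel) +
    (\<integral>\<^sup>+r. ennreal (1/2) * (relaxed_slope \<sigma> \<phi> (w r))\<^sup>2 * indicator {0..t} r \<partial>lborel) \<le> ennreal (p0 - q)"
proof (rule ennreal_le_epsilon)
  fix e :: real assume e: "0 < e"
  let ?b = "\<lambda>k. \<integral>\<^sup>+r. ennreal (1/2 * (Ms k r)\<^sup>2) * indicator {0..t} r \<partial>lborel"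
  let ?c = "\<lambda>k. \<integral>\<^sup>+r. excess k r * indicator {0..t} r \<partial>lborel"
  have qp: "q \<le> p0" by (rule phi_w[OF t]) (use q in simp)
  have [measurable]: "M \<in> borel_measurable borel" by (rule metric_speedD(1)[OF w])
  have half: "ennreal (1/2) * ennreal x = ennreal (1/2 * x)" if "0 \<le> x" for x :: real
    using that by (intro ennreal_mult[symmetric]) auto
  have "(\<integral>\<^sup>+r. ennreal (1/2) * ennreal ((M r)\<^sup>2) * indicator {0..t} r \<partial>lborel) =
    ennreal (1/2) * (\<integral>\<^sup>+r. ennreal ((M r)\<^sup>2) * indicator {0..t} r \<partial>lborel)"
    by (subst nn_integral_cmult[symmetric]) (auto simp: mult.assoc)
  also have "\<dots> \<le> ennreal (1/2) * liminf (\<lambda>k. \<integral>\<^sup>+r. ennreal ((Ms k r)\<^sup>2) * indicator {0..t} r \<partial>lborel)"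
    by (intro mult_left_mono kinetic_liminf[OF w]) simp
  also have "\<dots> \<le> liminf ?b"
    unfolding le_Liminf_iff
  proof (intro allI impI)
    fix y assume y: "y < ennreal (1/2) * liminf (\<lambda>k. \<integral>\<^sup>+r. ennreal ((Ms k r)\<^sup>2) * indicator {0..t} r \<partial>lborel)"
    have twice: "ennreal (1/2) * (ennreal 2 * x) = x" for x
      unfolding mult.assoc[symmetric] by (subst ennreal_mult[symmetric]) auto
    have "ennreal 2 * y < liminf (\<lambda>k. \<integral>\<^sup>+r. ennreal ((Ms k r)\<^sup>2) * indicator {0..t} r \<partial>lborel)"
    proof (rule ccontr)
      assume "\<not> ?thesis"
      then have "ennreal (1/2) * liminf (\<lambda>k. \<integral>\<^sup>+r. ennreal ((Ms k r)\<^sup>2) * indicator {0..t} r \<partial>lborel) \<le> ennreal (1/2) * (ennreal 2 * y)"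
        by (intro mult_left_mono) auto
      then show False using y unfolding twice by simp
    qed
    from less_LiminfD[OF this] show "\<forall>\<^sub>F k in sequentially. y < ?b k"
    proof eventually_elim
      case (elim k)
      have b: "?b k = ennreal (1/2) * (\<integral>\<^sup>+r. ennreal ((Ms k r)\<^sup>2) * indicator {0..t} r \<partial>lborel)"
        unfolding half[OF zero_le_power2, symmetric] mult.assoc by (rule nn_integral_cmult) measurable
      show ?case
      proof (rule ccontr)
        assume "\<not> ?thesis"
        then have "ennreal 2 * ?b k \<le> ennreal 2 * y" by (intro mult_left_mono) auto
        moreover have "ennreal 2 * ?b k = (\<integral>\<^sup>+r. ennreal ((Ms k r)\<^sup>2) * indicator {0..t} r \<partial>lborel)"
          unfolding b using twice by (simp add: mult.left_commute)
        ultimately show False using elim by simp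
      qed
    qed
  qed
  finally have 1: "(\<integral>\<^sup>+r. ennreal (1/2) * ennreal ((M r)\<^sup>2) * indicator {0..t} r \<partial>lborel) \<le> liminf ?b" .
  have "(\<integral>\<^sup>+r. ennreal (1/2) * (relaxed_slope \<sigma> \<phi> (w r))\<^sup>2 * indicator {0..t} r \<partial>lborel)
    \<le> (\<integral>\<^sup>+r. liminf (\<lambda>k. excess k (max 0 r) * indicator {0..t} r) \<partial>lborel)"
  proof (intro nn_integral_mono)
    fix r
    show "ennreal (1/2) * (relaxed_slope \<sigma> \<phi> (w r))\<^sup>2 * indicator {0..t} r \<le> liminf (\<lambda>k. excess k (max 0 r) * indicator {0..t} r)"
      using slope_liminf[of r] by (cases "r \<in> {0..t}") (auto simp: max_absorb2)
  qed
  also have "\<dots> \<le> liminf (\<lambda>k. \<integral>\<^sup>+r. excess k (max 0 r) * indicator {0..t} r \<partial>lborel)"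
    by (rule nn_integral_liminf) measurable
  also have "(\<lambda>k. \<integral>\<^sup>+r. excess k (max 0 r) * indicator {0..t} r \<partial>lborel) = ?c"
    by (intro ext nn_integral_cong) (auto simp: indicator_def max_absorb2)
  finally have 2: "(\<integral>\<^sup>+r. ennreal (1/2) * (relaxed_slope \<sigma> \<phi> (w r))\<^sup>2 * indicator {0..t} r \<partial>lborel) \<le> liminf ?c" .
  have "ereal (q - e) < \<phi> (w t)" using e q by simp
  from phi_w_lower[OF t this] have "\<forall>\<^sub>F k in sequentially. ?b k + ?c k \<le> ennreal (p0 - q + e)"
  proof eventually_elim
    case (elim k)
    show ?case unfolding dissipation[OF order_refl t] using elim F_le[OF order_refl, of k] by (intro ennreal_leI) linarith
  qed
  then have "liminf ?b + liminf ?c \<le> ennreal (p0 - q + e)" by (rule ennreal_liminf_add_le)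
  also have "\<dots> = ennreal (p0 - q) + ennreal e" using qp e by (intro ennreal_plus) auto
  finally show "(\<integral>\<^sup>+r. ennreal (1/2) * ennreal ((M r)\<^sup>2) * indicator {0..t} r \<partial>lborel) +
    (\<integral>\<^sup>+r. ennreal (1/2) * (relaxed_slope \<sigma> \<phi> (w r))\<^sup>2 * indicator {0..t} r \<partial>lborel) \<le> ennreal (p0 - q) + ennreal e"
    using 1 2 by (meson add_mono order_trans)
qed

end


lemma Lebesgue_point_derivative:
  fixes f :: "real \<Rightarrow> real"
  assumes t: "0 < t" and f: "\<And>a b. set_integrable lborel {a..b} f"
    and leb: "\<forall>e>0. \<exists>d>0. \<forall>a b. a \<le> t \<and> t \<le> b \<and> a < b \<and> b - a < d \<longrightarrow>
           \<bar>(LINT r:{a..b}|lborel. f r) - f t * (b - a)\<bar> \<le> e * (b - a)"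
  shows "((\<lambda>s. LINT r:{0..s}|lborel. f r) has_real_derivative f t) (at t)"
  unfolding has_field_derivative_iff
proof (rule tendstoI)
  let ?F = "\<lambda>s. LINT r:{0..s}|lborel. f r"
  fix e :: real assume e: "0 < e"
  obtain d where d: "d > 0" "\<And>a b. a \<le> t \<and> t \<le> b \<and> a < b \<and> b - a < d \<Longrightarrow>
           \<bar>(LINT r:{a..b}|lborel. f r) - f t * (b - a)\<bar> \<le> (e/2) * (b - a)"
    using leb[rule_format, of "e/2"] e by auto
  have diff: "?F b - ?F a = (LINT r:{a..b}|lborel. f r)" if "0 \<le> a" "a \<le> b" for a b
    using set_integral_Icc_split[of f 0 a b] f that by simp
  have main: "\<bar>(?F b - ?F a) - f t * (b - a)\<bar> \<le> (e/2) * (b - a)" if "0 \<le> a" "a \<le> t" "t \<le> b" "a < b" "b - a < d" for a b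
    using d(2)[of a b] diff[of a b] that by simp
  have "dist ((?F s - ?F t) / (s - t)) (f t) < e" if s: "s \<noteq> t" "dist s t < min d t" for s
  proof -
    have sd: "\<bar>s - t\<bar> < d" "0 \<le> s" using s by (auto simp: dist_real_def)
    have "\<bar>(?F s - ?F t) - f t * (s - t)\<bar> \<le> (e/2) * \<bar>s - t\<bar>"
    proof (cases "t < s")
      case True
      then show ?thesis using main[of t s] t sd by simp
    next
      case False
      have eq: "(?F s - ?F t) - f t * (s - t) = - ((?F t - ?F s) - f t * (t - s))" by (simp add: algebra_simps)
      show ?thesis unfolding eq abs_minus_cancel using main[of s t] False s(1) sd by simp
    qed
    moreover have "(?F s - ?F t) / (s - t) - f t = ((?F s - ?F t) - f t * (s - t)) / (s - t)"
      using s(1) by (simp add: diff_divide_distrib)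
    ultimately have "\<bar>(?F s - ?F t) / (s - t) - f t\<bar> \<le> e/2" using s(1) by (simp add: pos_divide_le_eq)
    then show ?thesis using e by (simp add: dist_real_def)
  qed
  then show "\<forall>\<^sub>F s in at t. dist ((?F s - ?F t) / (s - t)) (f t) < e"
    unfolding eventually_at using d(1) t by (intro exI[of _ "min d t"]) auto
qed

text \<open>The equality case of Young's inequality. For infinite \<open>g\<close> and positive
  \<open>m\<close> both sides are infinite, so finiteness has to be known; it comes from the finite
  integral of the larger side.\<close>

lemma ennreal_AM_GM_eq:
  fixes g :: ennreal and m :: real
  assumes m: "0 \<le> m" and le: "ennreal (1/2) * ennreal (m\<^sup>2) + ennreal (1/2) * g\<^sup>2 \<le> g * ennreal m" and "g < \<infinity>"
  shows "g = ennreal m"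
proof -
  obtain x where x: "g = ennreal x" "0 \<le> x" using \<open>g < \<infinity>\<close> by (cases g) auto
  have "ennreal (1/2) * ennreal (m\<^sup>2) + ennreal (1/2) * g\<^sup>2 = ennreal (1/2 * m\<^sup>2 + 1/2 * x\<^sup>2)"
    using x m by (simp only: ennreal_power ennreal_mult[symmetric] ennreal_plus[symmetric] zero_le_power2 mult_nonneg_nonneg)
  then have "ennreal (1/2 * m\<^sup>2 + 1/2 * x\<^sup>2) \<le> ennreal (x * m)" using le x m by (simp add: ennreal_mult)
  then have "1/2 * m\<^sup>2 + 1/2 * x\<^sup>2 \<le> x * m" by (subst (asm) ennreal_le_iff) (use x m in auto)
  then have "(x - m)\<^sup>2 \<le> 0" by (simp add: power2_eq_square algebra_simps)
  then show ?thesis using x by simp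
qed

lemma ennreal_AM_GM:
  fixes g :: ennreal and m :: real
  assumes m: "0 \<le> m"
  shows "g * ennreal m \<le> ennreal (1/2) * ennreal (m\<^sup>2) + ennreal (1/2) * g\<^sup>2"
proof (cases g)
  case (real x)
  have "0 \<le> (x - m)\<^sup>2" by simp
  then have "x * m \<le> 1/2 * m\<^sup>2 + 1/2 * x\<^sup>2" by (simp add: power2_eq_square algebra_simps)
  then have "ennreal (x * m) \<le> ennreal (1/2 * m\<^sup>2 + 1/2 * x\<^sup>2)" by (rule ennreal_leI)
  also have "\<dots> = ennreal (1/2) * ennreal (m\<^sup>2) + ennreal (1/2) * g\<^sup>2"
    using real by (subst ennreal_plus) (auto simp: ennreal_mult' ennreal_power simp del: times_divide_eq_left)
  finally show ?thesis using real m by (simp add: ennreal_mult)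
next
  case top
  have "ennreal (1/2) * g\<^sup>2 = top" unfolding top by (simp add: power2_eq_square ennreal_mult_top ennreal_top_mult)
  then show ?thesis by simp
qed

context wed_limit_conv
begin

text \<open>Equality of the two integrals becomes equality of \<open>g\<close> and \<open>M\<close>
  almost everywhere by Young's inequality, on every interval \<open>{0..t}\<close>. The energy is
  then determined at every time as \<open>p0\<close> less the integral of the squared speed, hence
  is locally bounded, and its derivative is found at Lebesgue points.\<close>

lemma maximal_slope:
  assumes ug: "upper_gradient \<phi> (relaxed_slope \<sigma> \<phi>)"
  shows "curve_of_maximal_slope \<phi> (relaxed_slope \<sigma> \<phi>) w"
proof -
  obtain M where w: "metric_speed w M" by (rule AC_loc_metric_speed[OF w_AC_loc])
  have [measurable]: "M \<in> borel_measurable borel" and M0: "\<And>t. 0 \<le> M t"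
    using metric_speedD[OF w] by auto
  define g where "g r = relaxed_slope \<sigma> \<phi> (w r)" for r
  have main: "(AE r in lborel. r \<in> {0..t} \<longrightarrow> g r = ennreal (M r)) \<and>
    (\<exists>q. \<phi> (w t) = ereal q \<and> q \<le> p0 \<and> ennreal (p0 - q) = (\<integral>\<^sup>+r. ennreal ((M r)\<^sup>2) * indicator {0..t} r \<partial>lborel))"
    if t: "0 \<le> t" for t
  proof -
    obtain q where q: "\<phi> (w t) = ereal q" "q \<le> p0" by (rule phi_w[OF t])
    obtain m where m: "has_speed (\<lambda>r. w (max 0 (min r t))) m" by (rule w_has_speed[of t])
    have ms: "set_integrable lborel {0..t} m" by (rule has_speedD(5)[OF m])
    have AC1: "AC 1 {0..t} w"
      unfolding AC_def
    proof (intro exI[of _ m] conjI ballI impI)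
      show "Lp_on 1 {0..t} m"
        using ms has_speedD(1,2)[OF m] unfolding Lp_on_def set_borel_measurable_def set_integrable_def by simp
      show "dist (w a) (w b) \<le> (LINT r:{a..b}|lborel. m r)" if "a \<in> {0..t}" "b \<in> {0..t}" "a \<le> b" for a b
        using has_speedD(6)[OF m that(3)] that by (simp add: max_absorb2 min_absorb1)
    qed
    note ugt = ug[unfolded upper_gradient_def, rule_format, OF is_interval_cc AC1]
    have gm: "(\<lambda>r. g r * indicator {0..t} r) \<in> borel_measurable borel"
      using ugt unfolding g_def by (subst (asm) borel_measurable_restrict_space_iff_ennreal) auto
    let ?H = "\<lambda>r. ennreal (1/2) * ennreal ((M r)\<^sup>2) * indicator {0..t} r + ennreal (1/2) * (g r)\<^sup>2 * indicator {0..t} r"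
    let ?G = "\<lambda>r. g r * ennreal (M r) * indicator {0..t} r"
    have g2: "ennreal (1/2) * (g r)\<^sup>2 * indicator {0..t} r = ennreal (1/2) * (g r * indicator {0..t} r)\<^sup>2" for r
      by (auto simp: indicator_def)
    have [measurable]: "(\<lambda>r. ennreal (1/2) * (g r)\<^sup>2 * indicator {0..t} r) \<in> borel_measurable borel"
      unfolding g2 using gm by measurable
    have "?G = (\<lambda>r. (g r * indicator {0..t} r) * ennreal (M r))" by (auto simp: mult_ac)
    then have Gm[measurable]: "?G \<in> borel_measurable borel" using gm by simp
    have Hm: "?H \<in> borel_measurable borel" by measurable
    then have HGm: "(\<lambda>r. ?H r - ?G r) \<in> borel_measurable borel" by measurable
    have "(\<integral>\<^sup>+r. ?H r \<partial>lborel) = (\<integral>\<^sup>+r. ennreal (1/2) * ennreal ((M r)\<^sup>2) * indicator {0..t} r \<partial>lborel) +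
      (\<integral>\<^sup>+r. ennreal (1/2) * (g r)\<^sup>2 * indicator {0..t} r \<partial>lborel)"
      by (rule nn_integral_add) measurable
    then have H: "(\<integral>\<^sup>+r. ?H r \<partial>lborel) \<le> ennreal (p0 - q)"
      using energy_inequality[OF w t q(1)] unfolding g_def[symmetric] by simp
    have "ennreal (p0 - q) = e2ennreal \<bar>\<phi> (w t) - \<phi> (w 0)\<bar>" using q by (simp add: w_0 p0)
    also have "\<dots> \<le> (\<integral>\<^sup>+ r\<in>{0..t}. relaxed_slope \<sigma> \<phi> (w r) * ennreal (metric_deriv {0..t} w r) \<partial>lborel)"
      using ugt[THEN conjunct2, rule_format, of 0 t] t q(1) by (simp add: eff_dom_def)
    \<comment> \<open>At interior times the metric derivative does not depend on the interval in
      which it is formed, so the one for \<open>{0..t}\<close> may be replaced by \<open>M\<close>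
      up to the two end points.\<close>
    also have "\<dots> = (\<integral>\<^sup>+r. ?G r \<partial>lborel)"
    proof (rule nn_integral_cong_AE)
      show "AE r in lborel. relaxed_slope \<sigma> \<phi> (w r) * ennreal (metric_deriv {0..t} w r) * indicator {0..t} r = ?G r"
        using metric_speedD(5)[OF w] AE_lborel_singleton[of 0] AE_lborel_singleton[of t]
      proof eventually_elim
        case (elim r)
        show ?case
        proof (cases "r \<in> {0..t}")
          case True
          then have "metric_deriv {0..t} w r = M r" using elim by (intro metric_derivI) (auto simp: interior_atLeastAtMost_real)
          then show ?thesis by (simp add: g_def)
        qed simp
      qed
    qed
    finally have G: "ennreal (p0 - q) \<le> (\<integral>\<^sup>+r. ?G r \<partial>lborel)" .
    have GH: "?G r \<le> ?H r" for r using ennreal_AM_GM[OF M0, of "g r" r] by (auto simp: indicator_def)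
    have "(\<integral>\<^sup>+r. ?G r \<partial>lborel) \<le> (\<integral>\<^sup>+r. ?H r \<partial>lborel)" by (intro nn_integral_mono GH)
    then have eq: "(\<integral>\<^sup>+r. ?H r \<partial>lborel) = ennreal (p0 - q)" "(\<integral>\<^sup>+r. ?G r \<partial>lborel) = ennreal (p0 - q)"
      using G H by auto
    \<comment> \<open>The larger function minus the smaller one has integral zero, the two integrals
      being equal and finite, so it vanishes almost everywhere.\<close>
    have "(\<integral>\<^sup>+r. ?H r - ?G r \<partial>lborel) = (\<integral>\<^sup>+r. ?H r \<partial>lborel) - (\<integral>\<^sup>+r. ?G r \<partial>lborel)"
      by (rule nn_integral_diff) (use Hm Gm eq GH in auto)
    then have "(\<integral>\<^sup>+r. ?H r - ?G r \<partial>lborel) = 0" unfolding eq by simp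
    then have "AE r in lborel. ?H r - ?G r = 0" by (subst (asm) nn_integral_0_iff_AE) (use HGm in auto)
    moreover have "AE r in lborel. ?H r \<noteq> \<infinity>" by (rule nn_integral_PInf_AE) (use Hm eq in auto)
    ultimately have gM: "AE r in lborel. r \<in> {0..t} \<longrightarrow> g r = ennreal (M r)"
    proof eventually_elim
      case (elim r)
      show ?case
      proof (intro impI)
        assume r: "r \<in> {0..t}"
        have "?H r \<le> ?G r" using elim(1) by (simp add: diff_eq_0_iff_ennreal)
        moreover have "g r < \<infinity>"
        proof (rule ccontr)
          assume "\<not> ?thesis"
          then have "g r = top" by (metis infinity_ennreal_def top.not_eq_extremum)
          then show False using elim(2) r by (simp add: power2_eq_square ennreal_mult_top ennreal_top_mult)
        qed
        ultimately show "g r = ennreal (M r)" using r by (intro ennreal_AM_GM_eq M0) auto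
      qed
    qed
    have "(\<integral>\<^sup>+r. ?G r \<partial>lborel) = (\<integral>\<^sup>+r. ennreal ((M r)\<^sup>2) * indicator {0..t} r \<partial>lborel)"
    proof (rule nn_integral_cong_AE)
      show "AE r in lborel. ?G r = ennreal ((M r)\<^sup>2) * indicator {0..t} r"
        using gM by eventually_elim (auto simp: indicator_def power2_eq_square ennreal_mult M0)
    qed
    then show ?thesis using gM q eq(2) by auto
  qed
  \<comment> \<open>Cutting off negative times, where nothing is known about \<open>M\<close>, makes
    the function integrable on every bounded interval, as the differentiation theorem
    demands.\<close>
  define f where "f r = (M r)\<^sup>2 * indicator {0..} r" for r
  have fI: "set_integrable lborel {a..b} f" for a b
    unfolding set_integrable_def
  proof (rule integrableI_nonneg)
    show "(\<lambda>r. indicator {a..b} r *\<^sub>R f r) \<in> borel_measurable lborel" unfolding f_def by measurable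
    have "(\<integral>\<^sup>+r. ennreal (indicator {a..b} r *\<^sub>R f r) \<partial>lborel) \<le> (\<integral>\<^sup>+r. ennreal ((M r)\<^sup>2) * indicator {0..b} r \<partial>lborel)"
      by (intro nn_integral_mono) (auto simp: f_def indicator_def)
    also have "\<dots> < \<infinity>" by (rule metric_speedD(3)[OF w])
    finally show "(\<integral>\<^sup>+r. ennreal (indicator {a..b} r *\<^sub>R f r) \<partial>lborel) < \<infinity>" .
  qed (auto simp: f_def)
  have f0: "0 \<le> f r" for r by (simp add: f_def)
  define Fi where "Fi t = (LINT r:{0..t}|lborel. f r)" for t
  have Fi0: "0 \<le> Fi t" for t
    unfolding Fi_def set_lebesgue_integral_def by (intro integral_nonneg_AE) (auto simp: f0)
  have phi: "\<phi> (w t) = ereal (p0 - Fi t)" if t: "0 \<le> t" for t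
  proof -
    obtain q where q: "\<phi> (w t) = ereal q" "q \<le> p0" "ennreal (p0 - q) = (\<integral>\<^sup>+r. ennreal ((M r)\<^sup>2) * indicator {0..t} r \<partial>lborel)"
      using main[OF t] by blast
    note q(3)
    also have "(\<integral>\<^sup>+r. ennreal ((M r)\<^sup>2) * indicator {0..t} r \<partial>lborel) = (\<integral>\<^sup>+r. ennreal (f r) * indicator {0..t} r \<partial>lborel)"
      by (intro nn_integral_cong) (auto simp: f_def indicator_def)
    also have "\<dots> = ennreal (Fi t)" unfolding Fi_def by (rule ennreal_set_integral[OF fI f0])
    finally have "p0 - q = Fi t" using q(2) Fi0 by simp
    then show ?thesis using q(1) by simp
  qed
  have Fi_mono: "Fi s \<le> Fi t" if "s \<le> t" for s t
  proof (cases "0 \<le> s")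
    case True
    have "0 \<le> (LINT r:{s..t}|lborel. f r)"
      unfolding set_lebesgue_integral_def by (intro integral_nonneg_AE) (auto simp: f0)
    then show ?thesis unfolding Fi_def using set_integral_Icc_split[of f 0 s t] fI True that by simp
  next
    case False
    then show ?thesis using Fi0[of t] by (simp add: Fi_def set_lebesgue_integral_def)
  qed
  show ?thesis
    unfolding curve_of_maximal_slope_def
  proof (intro conjI allI w_AC_loc)
    show "\<exists>C. \<forall>t\<in>{0..T}. \<bar>\<phi> (w t)\<bar> \<le> ereal C" for T
    proof (intro exI[of _ "\<bar>p0\<bar> + Fi T"] ballI)
      fix t assume "t \<in> {0..T}"
      then show "\<bar>\<phi> (w t)\<bar> \<le> ereal (\<bar>p0\<bar> + Fi T)" using phi[of t] Fi_mono[of t T] Fi0[of t] by auto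
    qed
    \<comment> \<open>The exceptional null sets depend on the interval; a countable exhaustion of
      the half-line leaves a single one.\<close>
    have "AE t in lborel. \<forall>n::nat. t \<in> {0..real n} \<longrightarrow> g t = ennreal (M t)"
      unfolding AE_all_countable using main by auto
    then show "AE t in lborel. t > 0 \<longrightarrow>
        ((\<lambda>s. real_of_ereal (\<phi> (w s))) has_real_derivative - (metric_deriv {0..} w t)\<^sup>2) (at t) \<and>
        ennreal ((metric_deriv {0..} w t)\<^sup>2) = (relaxed_slope \<sigma> \<phi> (w t))\<^sup>2"
      using metric_speed_deriv[OF w] Lebesgue_differentiation_local[OF fI]
    proof eventually_elim
      case (elim t)
      show ?case
      proof (intro impI)
        assume t: "0 < t"
        have md: "metric_deriv {0..} w t = M t" using elim t by simp
        obtain n :: nat where n: "t < real n" using reals_Archimedean2 by blast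
        have gt: "g t = ennreal (M t)" using elim(1)[rule_format, of n] n t by simp
        have ft: "f t = (M t)\<^sup>2" using t by (simp add: f_def)
        have "(Fi has_real_derivative (M t)\<^sup>2) (at t)"
          unfolding Fi_def[abs_def] ft[symmetric] by (rule Lebesgue_point_derivative[OF t fI elim(3)])
        then have "((\<lambda>s. p0 - Fi s) has_real_derivative - (M t)\<^sup>2) (at t)"
          by (auto intro!: derivative_eq_intros)
        moreover have ev: "\<forall>\<^sub>F s in nhds t. p0 - Fi s = real_of_ereal (\<phi> (w s))"
          using eventually_nhds_in_open[of "{0<..}" t] t by (auto simp: phi elim!: eventually_mono)
        ultimately have "((\<lambda>s. real_of_ereal (\<phi> (w s))) has_real_derivative - (M t)\<^sup>2) (at t)"
          unfolding DERIV_cong_ev[OF refl ev refl] by simp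
        then show "((\<lambda>s. real_of_ereal (\<phi> (w s))) has_real_derivative - (metric_deriv {0..} w t)\<^sup>2) (at t) \<and>
          ennreal ((metric_deriv {0..} w t)\<^sup>2) = (relaxed_slope \<sigma> \<phi> (w t))\<^sup>2"
          using gt unfolding md g_def by (simp add: ennreal_power M0)
      qed
    qed
  qed
qed

end

theorem theorem1p1:
  fixes \<sigma> :: "('a::complete_space) topology"
    and \<phi> :: "'a \<Rightarrow> ereal"
    and ustar ubar :: 'a
    and A B :: real
    and u\<epsilon> :: "real \<Rightarrow> real \<Rightarrow> 'a"
    and eps :: "nat \<Rightarrow> real"
  assumes "compatible \<sigma>"
    and "proper_functional \<phi>"
    and "LSCC \<sigma> \<phi> ustar A B"
    and "upper_gradient \<phi> (relaxed_slope \<sigma> \<phi>)"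
    and "ubar \<in> eff_dom \<phi>"
    and "\<And>\<epsilon>. \<epsilon> > 0 \<Longrightarrow> 1 / (16 * \<epsilon>) \<ge> B \<Longrightarrow> WED_minimizer \<phi> \<epsilon> ubar (u\<epsilon> \<epsilon>)"
    and "\<And>k. eps k > 0" and "\<And>k. 1 / (16 * eps k) \<ge> B"
    and "eps \<longlonglongrightarrow> 0"
  shows "\<exists>r u. strict_mono (r :: nat \<Rightarrow> nat) \<and>
           (\<forall>t\<ge>0. limitin \<sigma> (\<lambda>k. u\<epsilon> (eps (r k)) t) (u t) sequentially) \<and>
           curve_of_maximal_slope \<phi> (relaxed_slope \<sigma> \<phi>) u"
proof -
  interpret wed_functional \<sigma> \<phi> ustar A B by (rule wed_functional.intro[OF assms(1-3)])
  define U where "U k = u\<epsilon> (eps k)" for k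
  have min: "WED_minimizer \<phi> (eps k) ubar (U k)" for k unfolding U_def by (intro assms)
  have "\<exists>M. metric_speed (U k) M" for k
  proof -
    have "AC_loc 2 {0..} (U k)" using min[of k] by (simp add: WED_minimizer_def trajectories_def)
    then show ?thesis by (rule AC_loc_metric_speed) blast
  qed
  then obtain Ms where Ms: "\<And>k. metric_speed (U k) (Ms k)" by metis
  have m: "wed_minimizer \<sigma> \<phi> ustar A B (eps k) ubar (U k) (Ms k)" for k
    by unfold_locales (fact assms(7) assms(8) assms(5) min Ms)+
  obtain p0 where p0: "\<phi> ubar = ereal p0"
    using assms(5) not_minf[of ubar] by (cases "\<phi> ubar") (auto simp: eff_dom_def)
  define F where "F k = wed_minimizer.val \<phi> (eps k) (U k) (Ms k)" for k
  have lim: "wed_limit \<sigma> \<phi> ustar A B ubar p0 eps U Ms F"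
  proof unfold_locales
    show "U k 0 = ubar" for k using wed_minimizer.u0[OF m] .
    fix k :: nat
    show "F k t \<le> p" if "0 \<le> t" "\<phi> (U k t) = ereal p" for t p
      unfolding F_def by (rule wed_minimizer.val_le_phi[OF m that])
    show "- (B * (dist (U k t) ustar)\<^sup>2 + A) \<le> F k t" if "0 \<le> t" for t
      unfolding F_def by (rule wed_minimizer.val_lower[OF m that])
    show "F k b \<le> F k a" if "0 \<le> a" "a \<le> b" for a b
      unfolding F_def by (rule wed_minimizer.val_dissipation(1)[OF m that])
    show "(\<integral>\<^sup>+ r\<in>{a..b}. (ennreal (1/2 * (Ms k r)\<^sup>2) + e2ennreal (\<phi> (U k r) - ereal (F k r)) / ennreal (eps k)) \<partial>lborel)
      = ennreal (F k a - F k b)" if "0 \<le> a" "a \<le> b" for a b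
      unfolding F_def by (rule wed_minimizer.val_dissipation(2)[OF m that])
    fix t p c T :: real and v :: "real \<Rightarrow> 'a"
    assume "0 \<le> t" "\<phi> (U k t) = ereal p" "v 0 = U k t"
      "\<And>s t. 0 \<le> s \<Longrightarrow> 0 \<le> t \<Longrightarrow> dist (v s) (v t) \<le> \<bar>s - t\<bar>" "0 \<le> c" "0 \<le> T"
      "\<And>s. 0 \<le> s \<Longrightarrow> s \<le> T \<Longrightarrow> \<phi> (v (c * s)) \<le> ereal (p - c\<^sup>2 * s)"
    then show "F k t \<le> p - 1/2 * c\<^sup>2 * eps k * (1 - exp (- T / eps k))"
      unfolding F_def by (rule wed_minimizer.val_le[OF m])
  qed (fact p0 assms(7) assms(9) Ms)+
  obtain r u where r: "strict_mono r" and u: "\<And>t. 0 \<le> t \<Longrightarrow> limitin \<sigma> (\<lambda>n. U (r n) t) (u t) sequentially"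
    by (rule wed_limit.convergent_subsequence[OF lim]) blast
  have "wed_limit_conv \<sigma> \<phi> ustar A B ubar p0 (\<lambda>n. eps (r n)) (\<lambda>n. U (r n)) (\<lambda>n. Ms (r n)) (\<lambda>n. F (r n)) u"
    unfolding wed_limit_conv_def wed_limit_conv_axioms_def using wed_limit.subsequence[OF lim r] u by blast
  then have "curve_of_maximal_slope \<phi> (relaxed_slope \<sigma> \<phi>) u"
    by (rule wed_limit_conv.maximal_slope[OF _ assms(4)])
  then show ?thesis using r u unfolding U_def by blast
qed


end
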